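(* Let $f:[0,1]\to\mathbb{R}^+$ be a quasi-convex function such that $\inf\{f(x):x\in I\}$ exists for each sub-interval $I$ of $[0,1]$. Then either the infimum of $f$ on $[0,1]$ is positive or $\inf f=0$. Furthermore, in case the second alternative holds, $f$ has a discontinuity and WLPO holds.
   Context: The setting is Bishop-style constructive mathematics: intuitionistic logic (no law of excluded middle), with countable and dependent choice allowed. "Either $A$ or $B$" is the constructive disjunction $A\lor B$. $\mathbb{R}^+$ is the set of reals $>0$, so $f(x)>0$ for every $x$. $f$ is quasi-convex if $f(\lambda x+(1-\lambda)y)\leqslant\max\{f(x),f(y)\}$ for all $x,y\in[0,1]$ and every $\lambda\in[0,1]$. No continuity of $f$ is assumed. $f$ has a discontinuity if there exist $x\in[0,1]$, a sequence $(x_n)$ in $[0,1]$ with $x_n\to x$, and $\varepsilon>0$ such that $|f(x_n)-f(x)|>\varepsilon$ for all $n$. WLPO is the statement: for every binary sequence $(a_n)_{n\geqslant1}$, either $\forall n\,(a_n=0)$ or $\neg\forall n\,(a_n=0)$. *)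

theory Defs
  imports Main
begin

text \<open>
  HOL is classical: stated with the connectives of HOL, a constructive disjunction ``either A or
  not A'' and a principle such as WLPO are tautologies.  Bishop-style constructive mathematics is
  therefore represented by an object logic: many-sorted intuitionistic first-order logic with
  equality over the finite types generated from the natural numbers and the reals, with Heyting
  arithmetic, the constructive axioms of the real line, countable choice and dependent choice.
  A constructive theorem is a formula that is derivable in this system.

  Everything assumed below is accepted in Bishop-style mathematics.  Principles that it also
  accepts but that are not listed (extensionality of functions, unique choice at all types, ...)
  are not available to derivations, so derivability here is at least as demanding.
\<close>

section \<open>Types, terms and formulas\<close>

datatype ty =
    NatT
  | RealT
  | ProdT ty ty  (infixr "\<otimes>" 75)
  | FunT ty ty   (infixr "\<rightarrow>" 70)

datatype const =
    CNZero | CNSuc | CNAdd | CNMul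
  | CRZero | CROne | CRAdd | CRNeg | CRMul | CRMax | CROfNat
  | CPair ty ty | CFst ty ty | CSnd ty ty

primrec const_ty :: "const \<Rightarrow> ty" where
  "const_ty CNZero = NatT"
| "const_ty CNSuc = NatT \<rightarrow> NatT"
| "const_ty CNAdd = NatT \<rightarrow> NatT \<rightarrow> NatT"
| "const_ty CNMul = NatT \<rightarrow> NatT \<rightarrow> NatT"
| "const_ty CRZero = RealT"
| "const_ty CROne = RealT"
| "const_ty CRAdd = RealT \<rightarrow> RealT \<rightarrow> RealT"
| "const_ty CRNeg = RealT \<rightarrow> RealT"
| "const_ty CRMul = RealT \<rightarrow> RealT \<rightarrow> RealT"
| "const_ty CRMax = RealT \<rightarrow> RealT \<rightarrow> RealT"
| "const_ty CROfNat = NatT \<rightarrow> RealT"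
| "const_ty (CPair \<sigma> \<tau>) = \<sigma> \<rightarrow> \<tau> \<rightarrow> \<sigma> \<otimes> \<tau>"
| "const_ty (CFst \<sigma> \<tau>) = \<sigma> \<otimes> \<tau> \<rightarrow> \<sigma>"
| "const_ty (CSnd \<sigma> \<tau>) = \<sigma> \<otimes> \<tau> \<rightarrow> \<tau>"

text \<open>
  Locally nameless terms: \<open>Bnd i\<close> is a de Bruijn index referring to an enclosing quantifier,
  \<open>Par a \<tau>\<close> is the \<open>a\<close>-th free variable (eigenvariable) of type \<open>\<tau>\<close>.
\<close>

datatype trm =
    Bnd nat
  | Par nat ty
  | Con const
  | App trm trm

datatype fm =
    FBot
  | FEq trm trm
  | FLess trm trm
  | FAnd fm fm
  | FOr fm fm
  | FImp fm fm
  | FAll ty fm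
  | FEx ty fm

text \<open>A typed term contains no \<open>Bnd\<close>.\<close>

inductive has_ty :: "trm \<Rightarrow> ty \<Rightarrow> bool" where
  "has_ty (Par a \<tau>) \<tau>"
| "has_ty (Con c) (const_ty c)"
| "has_ty s (\<sigma> \<rightarrow> \<tau>) \<Longrightarrow> has_ty t \<sigma> \<Longrightarrow> has_ty (App s t) \<tau>"

primrec subst_trm :: "trm \<Rightarrow> (nat \<Rightarrow> trm) \<Rightarrow> trm" where
  "subst_trm (Bnd i) \<theta> = \<theta> i"
| "subst_trm (Par a \<tau>) \<theta> = Par a \<tau>"
| "subst_trm (Con c) \<theta> = Con c"
| "subst_trm (App s t) \<theta> = App (subst_trm s \<theta>) (subst_trm t \<theta>)"

definition under_binder :: "(nat \<Rightarrow> trm) \<Rightarrow> nat \<Rightarrow> trm" where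
  "under_binder \<theta> = case_nat (Bnd 0) (\<lambda>i. subst_trm (\<theta> i) (\<lambda>j. Bnd (Suc j)))"

primrec subst_fm :: "fm \<Rightarrow> (nat \<Rightarrow> trm) \<Rightarrow> fm" where
  "subst_fm FBot \<theta> = FBot"
| "subst_fm (FEq s t) \<theta> = FEq (subst_trm s \<theta>) (subst_trm t \<theta>)"
| "subst_fm (FLess s t) \<theta> = FLess (subst_trm s \<theta>) (subst_trm t \<theta>)"
| "subst_fm (FAnd A B) \<theta> = FAnd (subst_fm A \<theta>) (subst_fm B \<theta>)"
| "subst_fm (FOr A B) \<theta> = FOr (subst_fm A \<theta>) (subst_fm B \<theta>)"
| "subst_fm (FImp A B) \<theta> = FImp (subst_fm A \<theta>) (subst_fm B \<theta>)"
| "subst_fm (FAll \<tau> A) \<theta> = FAll \<tau> (subst_fm A (under_binder \<theta>))"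
| "subst_fm (FEx \<tau> A) \<theta> = FEx \<tau> (subst_fm A (under_binder \<theta>))"

definition instantiate :: "fm \<Rightarrow> trm \<Rightarrow> fm" where
  "instantiate A t = subst_fm A (case_nat t Bnd)"


section \<open>Readable syntax for formulas\<close>

text \<open>
  To write formulas with named variables, terms and formulas are presented as functions of the
  number \<open>d\<close> of enclosing quantifiers.  A variable bound by a quantifier at depth \<open>d\<close> is, seen
  from depth \<open>e > d\<close>, the de Bruijn index \<open>e - Suc d\<close>; hence binding is capture-free and a
  closed formula \<open>A\<close> denotes the element \<open>A 0\<close> of type \<open>fm\<close>.
\<close>

type_synonym tm = "nat \<Rightarrow> trm"
type_synonym form = "nat \<Rightarrow> fm"

definition all_of :: "ty \<Rightarrow> (tm \<Rightarrow> form) \<Rightarrow> form" where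
  "all_of \<tau> F = (\<lambda>d. FAll \<tau> (F (\<lambda>e. Bnd (e - Suc d)) (Suc d)))"

definition ex_of :: "ty \<Rightarrow> (tm \<Rightarrow> form) \<Rightarrow> form" where
  "ex_of \<tau> F = (\<lambda>d. FEx \<tau> (F (\<lambda>e. Bnd (e - Suc d)) (Suc d)))"

abbreviation all_nat (binder "\<^bold>\<forall>\<^sub>N" 10) where "all_nat \<equiv> all_of NatT"
abbreviation ex_nat (binder "\<^bold>\<exists>\<^sub>N" 10) where "ex_nat \<equiv> ex_of NatT"
abbreviation all_real (binder "\<^bold>\<forall>\<^sub>R" 10) where "all_real \<equiv> all_of RealT"
abbreviation ex_real (binder "\<^bold>\<exists>\<^sub>R" 10) where "ex_real \<equiv> ex_of RealT"

definition bot :: form ("\<^bold>\<bottom>") where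
  "\<^bold>\<bottom> = (\<lambda>d. FBot)"
definition conj_fm :: "form \<Rightarrow> form \<Rightarrow> form" (infixr "\<^bold>\<and>" 35) where
  "(A \<^bold>\<and> B) = (\<lambda>d. FAnd (A d) (B d))"
definition disj_fm :: "form \<Rightarrow> form \<Rightarrow> form" (infixr "\<^bold>\<or>" 30) where
  "(A \<^bold>\<or> B) = (\<lambda>d. FOr (A d) (B d))"
definition imp_fm :: "form \<Rightarrow> form \<Rightarrow> form" (infixr "\<^bold>\<longrightarrow>" 25) where
  "(A \<^bold>\<longrightarrow> B) = (\<lambda>d. FImp (A d) (B d))"
definition iff_fm :: "form \<Rightarrow> form \<Rightarrow> form" (infixr "\<^bold>\<longleftrightarrow>" 25) where
  "(A \<^bold>\<longleftrightarrow> B) = ((A \<^bold>\<longrightarrow> B) \<^bold>\<and> (B \<^bold>\<longrightarrow> A))"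
definition not_fm :: "form \<Rightarrow> form" ("\<^bold>\<not> _" [40] 40) where
  "(\<^bold>\<not> A) = (A \<^bold>\<longrightarrow> \<^bold>\<bottom>)"

definition eq_fm :: "tm \<Rightarrow> tm \<Rightarrow> form" (infix "\<^bold>=" 50) where
  "(s \<^bold>= t) = (\<lambda>d. FEq (s d) (t d))"
definition less_fm :: "tm \<Rightarrow> tm \<Rightarrow> form" (infix "\<^bold><" 50) where
  "(s \<^bold>< t) = (\<lambda>d. FLess (s d) (t d))"
definition le_fm :: "tm \<Rightarrow> tm \<Rightarrow> form" (infix "\<^bold>\<le>" 50) where
  "(s \<^bold>\<le> t) = (\<^bold>\<not> (t \<^bold>< s))"

definition con :: "const \<Rightarrow> tm" where
  "con c = (\<lambda>d. Con c)"
definition app :: "tm \<Rightarrow> tm \<Rightarrow> tm" (infixl "\<^bold>\<cdot>" 90) where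
  "s \<^bold>\<cdot> t = (\<lambda>d. App (s d) (t d))"

abbreviation nat_zero :: tm ("\<^bold>0\<^sub>N") where "\<^bold>0\<^sub>N \<equiv> con CNZero"
abbreviation nat_suc :: "tm \<Rightarrow> tm" where "nat_suc m \<equiv> con CNSuc \<^bold>\<cdot> m"
abbreviation nat_add :: "tm \<Rightarrow> tm \<Rightarrow> tm" (infixl "\<^bold>+\<^sub>N" 65) where
  "m \<^bold>+\<^sub>N n \<equiv> con CNAdd \<^bold>\<cdot> m \<^bold>\<cdot> n"
abbreviation nat_mul :: "tm \<Rightarrow> tm \<Rightarrow> tm" (infixl "\<^bold>*\<^sub>N" 70) where
  "m \<^bold>*\<^sub>N n \<equiv> con CNMul \<^bold>\<cdot> m \<^bold>\<cdot> n"
definition nat_le :: "tm \<Rightarrow> tm \<Rightarrow> form" (infix "\<^bold>\<le>\<^sub>N" 50) where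
  "(m \<^bold>\<le>\<^sub>N n) = (\<^bold>\<exists>\<^sub>N k. n \<^bold>= m \<^bold>+\<^sub>N k)"

abbreviation real_zero :: tm ("\<^bold>0") where "\<^bold>0 \<equiv> con CRZero"
abbreviation real_one :: tm ("\<^bold>1") where "\<^bold>1 \<equiv> con CROne"
abbreviation real_add :: "tm \<Rightarrow> tm \<Rightarrow> tm" (infixl "\<^bold>+" 65) where
  "x \<^bold>+ y \<equiv> con CRAdd \<^bold>\<cdot> x \<^bold>\<cdot> y"
abbreviation real_neg :: "tm \<Rightarrow> tm" where "real_neg x \<equiv> con CRNeg \<^bold>\<cdot> x"
abbreviation real_sub :: "tm \<Rightarrow> tm \<Rightarrow> tm" (infixl "\<^bold>-" 65) where
  "x \<^bold>- y \<equiv> x \<^bold>+ real_neg y"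
abbreviation real_mul :: "tm \<Rightarrow> tm \<Rightarrow> tm" (infixl "\<^bold>*" 70) where
  "x \<^bold>* y \<equiv> con CRMul \<^bold>\<cdot> x \<^bold>\<cdot> y"
abbreviation real_max :: "tm \<Rightarrow> tm \<Rightarrow> tm" where
  "real_max x y \<equiv> con CRMax \<^bold>\<cdot> x \<^bold>\<cdot> y"
abbreviation real_abs :: "tm \<Rightarrow> tm" where
  "real_abs x \<equiv> real_max x (real_neg x)"
abbreviation real_of :: "tm \<Rightarrow> tm" where
  "real_of n \<equiv> con CROfNat \<^bold>\<cdot> n"

abbreviation pair :: "ty \<Rightarrow> ty \<Rightarrow> tm \<Rightarrow> tm \<Rightarrow> tm" where
  "pair \<sigma> \<tau> x y \<equiv> con (CPair \<sigma> \<tau>) \<^bold>\<cdot> x \<^bold>\<cdot> y"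
abbreviation first :: "ty \<Rightarrow> ty \<Rightarrow> tm \<Rightarrow> tm" where
  "first \<sigma> \<tau> z \<equiv> con (CFst \<sigma> \<tau>) \<^bold>\<cdot> z"
abbreviation second :: "ty \<Rightarrow> ty \<Rightarrow> tm \<Rightarrow> tm" where
  "second \<sigma> \<tau> z \<equiv> con (CSnd \<sigma> \<tau>) \<^bold>\<cdot> z"

text \<open>
  The unary and binary predicates given by an arbitrary formula whose indices 0 (and 1) stand for
  the arguments; further variables of the formula are parameters \<open>Par a \<tau>\<close>.
\<close>

definition pred1 :: "fm \<Rightarrow> tm \<Rightarrow> form" where
  "pred1 A x = (\<lambda>d. subst_fm A (\<lambda>i. x d))"
definition pred2 :: "fm \<Rightarrow> tm \<Rightarrow> tm \<Rightarrow> form" where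
  "pred2 A x y = (\<lambda>d. subst_fm A (\<lambda>i. if i = 0 then x d else y d))"


section \<open>Axioms and derivability\<close>

definition converges :: "tm \<Rightarrow> tm \<Rightarrow> form" where
  "converges s x =
     (\<^bold>\<forall>\<^sub>R \<epsilon>. \<^bold>0 \<^bold>< \<epsilon> \<^bold>\<longrightarrow> (\<^bold>\<exists>\<^sub>N k. \<^bold>\<forall>\<^sub>N n. k \<^bold>\<le>\<^sub>N n \<^bold>\<longrightarrow> real_abs (s \<^bold>\<cdot> n \<^bold>- x) \<^bold>< \<epsilon>))"

definition cauchy :: "tm \<Rightarrow> form" where
  "cauchy s =
     (\<^bold>\<forall>\<^sub>R \<epsilon>. \<^bold>0 \<^bold>< \<epsilon> \<^bold>\<longrightarrow>
        (\<^bold>\<exists>\<^sub>N k. \<^bold>\<forall>\<^sub>N m. \<^bold>\<forall>\<^sub>N n. k \<^bold>\<le>\<^sub>N m \<^bold>\<and> k \<^bold>\<le>\<^sub>N n \<^bold>\<longrightarrow> real_abs (s \<^bold>\<cdot> m \<^bold>- s \<^bold>\<cdot> n) \<^bold>< \<epsilon>))"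

text \<open>
  The reals are described by Bridges' axioms for a constructive (Heyting) ordered field that is
  Archimedean; completeness is stated for Cauchy sequences.  The maximum is determined by the
  constructively valid equivalence \<open>z < max x y \<longleftrightarrow> z < x \<or> z < y\<close>.
  In \<open>dependent_choice\<close>, \<open>A\<close> is the subset of \<open>\<sigma>\<close> in which the choices take place.
\<close>

inductive bish_axiom :: "form \<Rightarrow> bool" where
  suc_not_zero: "bish_axiom (\<^bold>\<forall>\<^sub>N m. \<^bold>\<not> (nat_suc m \<^bold>= \<^bold>0\<^sub>N))"
| suc_inject: "bish_axiom (\<^bold>\<forall>\<^sub>N m. \<^bold>\<forall>\<^sub>N n. nat_suc m \<^bold>= nat_suc n \<^bold>\<longrightarrow> m \<^bold>= n)"
| nat_add_zero: "bish_axiom (\<^bold>\<forall>\<^sub>N m. m \<^bold>+\<^sub>N \<^bold>0\<^sub>N \<^bold>= m)"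
| nat_add_suc: "bish_axiom (\<^bold>\<forall>\<^sub>N m. \<^bold>\<forall>\<^sub>N n. m \<^bold>+\<^sub>N nat_suc n \<^bold>= nat_suc (m \<^bold>+\<^sub>N n))"
| nat_mul_zero: "bish_axiom (\<^bold>\<forall>\<^sub>N m. m \<^bold>*\<^sub>N \<^bold>0\<^sub>N \<^bold>= \<^bold>0\<^sub>N)"
| nat_mul_suc: "bish_axiom (\<^bold>\<forall>\<^sub>N m. \<^bold>\<forall>\<^sub>N n. m \<^bold>*\<^sub>N nat_suc n \<^bold>= (m \<^bold>*\<^sub>N n) \<^bold>+\<^sub>N m)"
| induction:
    "bish_axiom (pred1 A \<^bold>0\<^sub>N \<^bold>\<and> (\<^bold>\<forall>\<^sub>N n. pred1 A n \<^bold>\<longrightarrow> pred1 A (nat_suc n)) \<^bold>\<longrightarrow> (\<^bold>\<forall>\<^sub>N n. pred1 A n))"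
| first_pair:
    "bish_axiom (all_of \<sigma> (\<lambda>x. all_of \<tau> (\<lambda>y. first \<sigma> \<tau> (pair \<sigma> \<tau> x y) \<^bold>= x)))"
| second_pair:
    "bish_axiom (all_of \<sigma> (\<lambda>x. all_of \<tau> (\<lambda>y. second \<sigma> \<tau> (pair \<sigma> \<tau> x y) \<^bold>= y)))"
| pair_surj:
    "bish_axiom (all_of (\<sigma> \<otimes> \<tau>) (\<lambda>z. pair \<sigma> \<tau> (first \<sigma> \<tau> z) (second \<sigma> \<tau> z) \<^bold>= z))"
| countable_choice:
    "bish_axiom ((\<^bold>\<forall>\<^sub>N n. ex_of \<sigma> (\<lambda>y. pred2 P n y)) \<^bold>\<longrightarrow>
       ex_of (NatT \<rightarrow> \<sigma>) (\<lambda>g. \<^bold>\<forall>\<^sub>N n. pred2 P n (g \<^bold>\<cdot> n)))"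
| dependent_choice:
    "bish_axiom (all_of \<sigma> (\<lambda>x. pred1 A x \<^bold>\<longrightarrow> ex_of \<sigma> (\<lambda>y. pred1 A y \<^bold>\<and> pred2 P x y)) \<^bold>\<longrightarrow>
       all_of \<sigma> (\<lambda>x. pred1 A x \<^bold>\<longrightarrow>
         ex_of (NatT \<rightarrow> \<sigma>) (\<lambda>g. g \<^bold>\<cdot> \<^bold>0\<^sub>N \<^bold>= x \<^bold>\<and>
           (\<^bold>\<forall>\<^sub>N n. pred1 A (g \<^bold>\<cdot> n) \<^bold>\<and> pred2 P (g \<^bold>\<cdot> n) (g \<^bold>\<cdot> nat_suc n)))))"
| add_assoc: "bish_axiom (\<^bold>\<forall>\<^sub>R x. \<^bold>\<forall>\<^sub>R y. \<^bold>\<forall>\<^sub>R z. (x \<^bold>+ y) \<^bold>+ z \<^bold>= x \<^bold>+ (y \<^bold>+ z))"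
| add_commute: "bish_axiom (\<^bold>\<forall>\<^sub>R x. \<^bold>\<forall>\<^sub>R y. x \<^bold>+ y \<^bold>= y \<^bold>+ x)"
| add_zero: "bish_axiom (\<^bold>\<forall>\<^sub>R x. x \<^bold>+ \<^bold>0 \<^bold>= x)"
| add_neg: "bish_axiom (\<^bold>\<forall>\<^sub>R x. x \<^bold>+ real_neg x \<^bold>= \<^bold>0)"
| mul_assoc: "bish_axiom (\<^bold>\<forall>\<^sub>R x. \<^bold>\<forall>\<^sub>R y. \<^bold>\<forall>\<^sub>R z. (x \<^bold>* y) \<^bold>* z \<^bold>= x \<^bold>* (y \<^bold>* z))"
| mul_commute: "bish_axiom (\<^bold>\<forall>\<^sub>R x. \<^bold>\<forall>\<^sub>R y. x \<^bold>* y \<^bold>= y \<^bold>* x)"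
| mul_one: "bish_axiom (\<^bold>\<forall>\<^sub>R x. x \<^bold>* \<^bold>1 \<^bold>= x)"
| distrib: "bish_axiom (\<^bold>\<forall>\<^sub>R x. \<^bold>\<forall>\<^sub>R y. \<^bold>\<forall>\<^sub>R z. x \<^bold>* (y \<^bold>+ z) \<^bold>= x \<^bold>* y \<^bold>+ x \<^bold>* z)"
| inverse:
    "bish_axiom (\<^bold>\<forall>\<^sub>R x. x \<^bold>< \<^bold>0 \<^bold>\<or> \<^bold>0 \<^bold>< x \<^bold>\<longrightarrow> (\<^bold>\<exists>\<^sub>R y. x \<^bold>* y \<^bold>= \<^bold>1))"
| zero_less_one: "bish_axiom (\<^bold>0 \<^bold>< \<^bold>1)"
| less_asym: "bish_axiom (\<^bold>\<forall>\<^sub>R x. \<^bold>\<forall>\<^sub>R y. \<^bold>\<not> (x \<^bold>< y \<^bold>\<and> y \<^bold>< x))"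
| less_cotrans:
    "bish_axiom (\<^bold>\<forall>\<^sub>R x. \<^bold>\<forall>\<^sub>R y. \<^bold>\<forall>\<^sub>R z. x \<^bold>< y \<^bold>\<longrightarrow> x \<^bold>< z \<^bold>\<or> z \<^bold>< y)"
| less_tight:
    "bish_axiom (\<^bold>\<forall>\<^sub>R x. \<^bold>\<forall>\<^sub>R y. \<^bold>\<not> (x \<^bold>< y \<^bold>\<or> y \<^bold>< x) \<^bold>\<longrightarrow> x \<^bold>= y)"
| less_add: "bish_axiom (\<^bold>\<forall>\<^sub>R x. \<^bold>\<forall>\<^sub>R y. \<^bold>\<forall>\<^sub>R z. x \<^bold>< y \<^bold>\<longrightarrow> x \<^bold>+ z \<^bold>< y \<^bold>+ z)"
| mul_pos: "bish_axiom (\<^bold>\<forall>\<^sub>R x. \<^bold>\<forall>\<^sub>R y. \<^bold>0 \<^bold>< x \<^bold>\<and> \<^bold>0 \<^bold>< y \<^bold>\<longrightarrow> \<^bold>0 \<^bold>< x \<^bold>* y)"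
| less_max:
    "bish_axiom (\<^bold>\<forall>\<^sub>R x. \<^bold>\<forall>\<^sub>R y. \<^bold>\<forall>\<^sub>R z. z \<^bold>< real_max x y \<^bold>\<longleftrightarrow> (z \<^bold>< x \<^bold>\<or> z \<^bold>< y))"
| of_nat_zero: "bish_axiom (real_of \<^bold>0\<^sub>N \<^bold>= \<^bold>0)"
| of_nat_suc: "bish_axiom (\<^bold>\<forall>\<^sub>N n. real_of (nat_suc n) \<^bold>= real_of n \<^bold>+ \<^bold>1)"
| archimedean: "bish_axiom (\<^bold>\<forall>\<^sub>R x. \<^bold>\<exists>\<^sub>N n. x \<^bold>< real_of n)"
| complete:
    "bish_axiom (all_of (NatT \<rightarrow> RealT) (\<lambda>s. cauchy s \<^bold>\<longrightarrow> (\<^bold>\<exists>\<^sub>R x. converges s x)))"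

text \<open>
  Intuitionistic natural deduction with equality.  In \<open>AllI\<close> and \<open>ExE\<close> the premise is required
  for every parameter \<open>a\<close> of the type; as the finite list \<open>\<Gamma>\<close> and the formulas involved mention only
  finitely many parameters, this amounts to the usual rule with a fresh eigenvariable.  Formulas
  are not required to be well-typed: quantifiers are instantiated by terms of the right type only,
  so ill-typed atoms behave like uninterpreted atoms.
\<close>

inductive derivable :: "fm list \<Rightarrow> fm \<Rightarrow> bool" (infix "\<^bold>\<turnstile>" 20) where
  Axiom: "bish_axiom A \<Longrightarrow> \<Gamma> \<^bold>\<turnstile> A 0"
| Assm: "A \<in> set \<Gamma> \<Longrightarrow> \<Gamma> \<^bold>\<turnstile> A"
| BotE: "\<Gamma> \<^bold>\<turnstile> FBot \<Longrightarrow> \<Gamma> \<^bold>\<turnstile> A"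
| AndI: "\<Gamma> \<^bold>\<turnstile> A \<Longrightarrow> \<Gamma> \<^bold>\<turnstile> B \<Longrightarrow> \<Gamma> \<^bold>\<turnstile> FAnd A B"
| AndE1: "\<Gamma> \<^bold>\<turnstile> FAnd A B \<Longrightarrow> \<Gamma> \<^bold>\<turnstile> A"
| AndE2: "\<Gamma> \<^bold>\<turnstile> FAnd A B \<Longrightarrow> \<Gamma> \<^bold>\<turnstile> B"
| OrI1: "\<Gamma> \<^bold>\<turnstile> A \<Longrightarrow> \<Gamma> \<^bold>\<turnstile> FOr A B"
| OrI2: "\<Gamma> \<^bold>\<turnstile> B \<Longrightarrow> \<Gamma> \<^bold>\<turnstile> FOr A B"
| OrE: "\<Gamma> \<^bold>\<turnstile> FOr A B \<Longrightarrow> A # \<Gamma> \<^bold>\<turnstile> C \<Longrightarrow> B # \<Gamma> \<^bold>\<turnstile> C \<Longrightarrow> \<Gamma> \<^bold>\<turnstile> C"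
| ImpI: "A # \<Gamma> \<^bold>\<turnstile> B \<Longrightarrow> \<Gamma> \<^bold>\<turnstile> FImp A B"
| ImpE: "\<Gamma> \<^bold>\<turnstile> FImp A B \<Longrightarrow> \<Gamma> \<^bold>\<turnstile> A \<Longrightarrow> \<Gamma> \<^bold>\<turnstile> B"
| AllI: "(\<And>a. \<Gamma> \<^bold>\<turnstile> instantiate A (Par a \<tau>)) \<Longrightarrow> \<Gamma> \<^bold>\<turnstile> FAll \<tau> A"
| AllE: "\<Gamma> \<^bold>\<turnstile> FAll \<tau> A \<Longrightarrow> has_ty t \<tau> \<Longrightarrow> \<Gamma> \<^bold>\<turnstile> instantiate A t"
| ExI: "\<Gamma> \<^bold>\<turnstile> instantiate A t \<Longrightarrow> has_ty t \<tau> \<Longrightarrow> \<Gamma> \<^bold>\<turnstile> FEx \<tau> A"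
| ExE: "\<Gamma> \<^bold>\<turnstile> FEx \<tau> A \<Longrightarrow> (\<And>a. instantiate A (Par a \<tau>) # \<Gamma> \<^bold>\<turnstile> C) \<Longrightarrow> \<Gamma> \<^bold>\<turnstile> C"
| EqI: "\<Gamma> \<^bold>\<turnstile> FEq t t"
| EqE: "\<Gamma> \<^bold>\<turnstile> FEq s t \<Longrightarrow> \<Gamma> \<^bold>\<turnstile> instantiate A s \<Longrightarrow> \<Gamma> \<^bold>\<turnstile> instantiate A t"

definition BISH_proves :: "form \<Rightarrow> bool" where
  "BISH_proves A \<longleftrightarrow> ([] \<^bold>\<turnstile> A 0)"


section \<open>Quasi-convex functions, infima, discontinuity, WLPO\<close>

text \<open>
  A function on [0,1] is represented by a term \<open>f\<close> of type \<open>RealT \<rightarrow> RealT\<close> of which only the values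
  on [0,1] are used.  This is no restriction: \<open>x \<mapsto> max 0 (min 1 x)\<close> maps the line to [0,1] and is
  the identity on [0,1], so a function on [0,1] extends by composition.
\<close>

definition unit_interval :: "tm \<Rightarrow> form" where
  "unit_interval x = (\<^bold>0 \<^bold>\<le> x \<^bold>\<and> x \<^bold>\<le> \<^bold>1)"

definition positive_valued :: "tm \<Rightarrow> form" where
  "positive_valued f = (\<^bold>\<forall>\<^sub>R x. unit_interval x \<^bold>\<longrightarrow> \<^bold>0 \<^bold>< f \<^bold>\<cdot> x)"

definition quasi_convex :: "tm \<Rightarrow> form" where
  "quasi_convex f =
     (\<^bold>\<forall>\<^sub>R x. \<^bold>\<forall>\<^sub>R y. \<^bold>\<forall>\<^sub>R l. unit_interval x \<^bold>\<and> unit_interval y \<^bold>\<and> unit_interval l \<^bold>\<longrightarrow>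
        f \<^bold>\<cdot> (l \<^bold>* x \<^bold>+ (\<^bold>1 \<^bold>- l) \<^bold>* y) \<^bold>\<le> real_max (f \<^bold>\<cdot> x) (f \<^bold>\<cdot> y))"

text \<open>The constructive infimum: a lower bound that is approximated arbitrarily well by values.\<close>

definition is_inf :: "tm \<Rightarrow> (tm \<Rightarrow> form) \<Rightarrow> tm \<Rightarrow> form" where
  "is_inf f I m =
     ((\<^bold>\<forall>\<^sub>R x. I x \<^bold>\<longrightarrow> m \<^bold>\<le> f \<^bold>\<cdot> x) \<^bold>\<and>
      (\<^bold>\<forall>\<^sub>R \<epsilon>. \<^bold>0 \<^bold>< \<epsilon> \<^bold>\<longrightarrow> (\<^bold>\<exists>\<^sub>R x. I x \<^bold>\<and> f \<^bold>\<cdot> x \<^bold>< m \<^bold>+ \<epsilon>)))"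

text \<open>
  An interval is given by its end points and by the relations (strict or not) bounding it; the
  sub-intervals of [0,1] are the inhabited ones with end points in [0,1].
\<close>

definition interval ::
    "(tm \<Rightarrow> tm \<Rightarrow> form) \<Rightarrow> (tm \<Rightarrow> tm \<Rightarrow> form) \<Rightarrow> tm \<Rightarrow> tm \<Rightarrow> tm \<Rightarrow> form" where
  "interval L R a b x = (L a x \<^bold>\<and> R x b)"

definition inf_exists_if_inhabited :: "tm \<Rightarrow> (tm \<Rightarrow> form) \<Rightarrow> form" where
  "inf_exists_if_inhabited f I = ((\<^bold>\<exists>\<^sub>R x. I x) \<^bold>\<longrightarrow> (\<^bold>\<exists>\<^sub>R m. is_inf f I m))"

definition inf_exists_on_subintervals :: "tm \<Rightarrow> form" where
  "inf_exists_on_subintervals f =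
     (\<^bold>\<forall>\<^sub>R a. \<^bold>\<forall>\<^sub>R b. \<^bold>0 \<^bold>\<le> a \<^bold>\<and> b \<^bold>\<le> \<^bold>1 \<^bold>\<longrightarrow>
        inf_exists_if_inhabited f (interval (\<^bold>\<le>) (\<^bold>\<le>) a b) \<^bold>\<and>
        inf_exists_if_inhabited f (interval (\<^bold>\<le>) (\<^bold><) a b) \<^bold>\<and>
        inf_exists_if_inhabited f (interval (\<^bold><) (\<^bold>\<le>) a b) \<^bold>\<and>
        inf_exists_if_inhabited f (interval (\<^bold><) (\<^bold><) a b))"

definition has_discontinuity :: "tm \<Rightarrow> form" where
  "has_discontinuity f =
     (\<^bold>\<exists>\<^sub>R x. unit_interval x \<^bold>\<and>
        ex_of (NatT \<rightarrow> RealT) (\<lambda>s. (\<^bold>\<forall>\<^sub>N n. unit_interval (s \<^bold>\<cdot> n)) \<^bold>\<and> converges s x \<^bold>\<and>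
          (\<^bold>\<exists>\<^sub>R \<epsilon>. \<^bold>0 \<^bold>< \<epsilon> \<^bold>\<and> (\<^bold>\<forall>\<^sub>N n. \<epsilon> \<^bold>< real_abs (f \<^bold>\<cdot> (s \<^bold>\<cdot> n) \<^bold>- f \<^bold>\<cdot> x)))))"

definition WLPO :: form where
  "WLPO =
     all_of (NatT \<rightarrow> NatT) (\<lambda>a.
       (\<^bold>\<forall>\<^sub>N n. a \<^bold>\<cdot> n \<^bold>= \<^bold>0\<^sub>N \<^bold>\<or> a \<^bold>\<cdot> n \<^bold>= nat_suc \<^bold>0\<^sub>N) \<^bold>\<longrightarrow>
       (\<^bold>\<forall>\<^sub>N n. a \<^bold>\<cdot> n \<^bold>= \<^bold>0\<^sub>N) \<^bold>\<or> \<^bold>\<not> (\<^bold>\<forall>\<^sub>N n. a \<^bold>\<cdot> n \<^bold>= \<^bold>0\<^sub>N))"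

end

theory Submission
  imports Defs "HOL-Library.Countable"
begin

text \<open>
  Derivability is reduced to truth in \<^emph>\<open>worlds\<close>: deductively closed theories with the disjunction
  property and with witnesses.  A formula that belongs to every world containing \<open>\<Gamma>\<close> is derivable
  from \<open>\<Gamma>\<close>; inside a world, disjunctions and existential statements are decided, and \<open><\<close> is a strict
  weak order compatible with the ring operations.

  The mathematical argument: if \<open>f\<close> is positive and quasi-convex, then for each \<open>\<epsilon>\<close> the positive values
  of \<open>f\<close> at the points of an \<open>\<epsilon>\<close>-grid bound from below one of \<open>f u\<close>, \<open>f v\<close> whenever a grid point separates
  \<open>u\<close> and \<open>v\<close>; hence minimising sequences are Cauchy.  For the alternative about
  \<open>m = inf f\<close>, decide for each \<open>n\<close> whether \<open>n m < 1\<close> or \<open>0 < m\<close>.  In the first case let \<open>y n\<close> satisfy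
  \<open>n f (y n) < 1\<close>, in the second repeat the previous term.  The limit \<open>z\<close> has \<open>f z > 1/k\<close> for some \<open>k\<close>, so
  the decision at stage \<open>k\<close> tells whether \<open>0 < m\<close> or \<open>m = 0\<close>.  If \<open>m = 0\<close>, the limit \<open>x\<close> of a
  minimising sequence is a point of discontinuity.  To decide whether a binary sequence vanishes,
  follow such a sequence until the first 1 appears and stop there; with \<open>z\<close> the limit, \<open>f z < f x\<close> excludes that the
  binary sequence vanishes, and \<open>f z > f x / 2\<close> excludes a 1 at all late stages.
\<close>

text \<open>Two obstacles shape the proof. A world settles disjunctions and existential statements,
  but an implication, a negation or a universal statement has to be checked in every world that
  keeps one chosen formula. Hence the many formulas \<open>?H\<close>: each is the conjunction of
  the facts that must survive the passage to a larger world. Case distinctions in HOL about a fixed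
  world are harmless, since the conclusion is a statement about derivability. The other obstacle is
  that \<open>f\<close> need not be continuous, so small values at the terms of a sequence say
  nothing about the value at its limit. Only an eventually constant sequence passes a bound on,
  because its limit is one of its terms. This is why a sequence is stopped by repetition, and why
  positivity of \<open>f z\<close> carries information about stopping. Convergence itself must not
  depend on knowing whether the sequence stops: at each stage either the current value is small or a
  stop has been recorded, and either alternative yields the Cauchy estimate. Smallness is written
  \<open>n * f u < 1\<close>, which avoids division and makes sense at \<open>n = 0\<close>.\<close>

section \<open>Types and substitution for raw terms\<close>

primrec ty_of :: "trm \<Rightarrow> ty option" where
  "ty_of (Bnd i) = None"
| "ty_of (Par a \<tau>) = Some \<tau>"
| "ty_of (Con c) = Some (const_ty c)"
| "ty_of (App s t) =
     (case ty_of s of Some (\<sigma> \<rightarrow> \<tau>) \<Rightarrow> if ty_of t = Some \<sigma> then Some \<tau> else None | _ \<Rightarrow> None)"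

lemma ty_of_App:
  "ty_of (App s t) = Some \<tau> \<longleftrightarrow> (\<exists>\<sigma>. ty_of s = Some (\<sigma> \<rightarrow> \<tau>) \<and> ty_of t = Some \<sigma>)"
  by (auto split: option.splits ty.splits)

text \<open>With typing as a partial function, the side conditions of the quantifier rules become
  goals for the simplifier.\<close>

lemma has_ty_iff: "has_ty t \<tau> \<longleftrightarrow> ty_of t = Some \<tau>"
proof
  show "has_ty t \<tau> \<Longrightarrow> ty_of t = Some \<tau>"
    by (induction rule: has_ty.induct) simp_all
  show "ty_of t = Some \<tau> \<Longrightarrow> has_ty t \<tau>"
    by (induction t arbitrary: \<tau>) (auto simp: ty_of_App simp del: ty_of.simps(4) intro: has_ty.intros)
qed

text \<open>\<open>Bnd\<close> has no type, so a typed term contains no index that a substitution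
  could reach.\<close>

lemma subst_typed: "ty_of t = Some \<tau> \<Longrightarrow> subst_trm t \<theta> = t"
  by (induction t arbitrary: \<tau>) (auto simp: ty_of_App simp del: ty_of.simps(4))

lemma subst_trm_comp: "subst_trm (subst_trm t \<sigma>) \<theta> = subst_trm t (\<lambda>i. subst_trm (\<sigma> i) \<theta>)"
  by (induction t) auto

lemma under_binder_comp:
  "(\<lambda>i. subst_trm (under_binder \<sigma> i) (under_binder \<theta>)) = under_binder (\<lambda>i. subst_trm (\<sigma> i) \<theta>)"
  by (rule ext) (auto simp: under_binder_def subst_trm_comp split: nat.splits)

lemma subst_fm_comp: "subst_fm (subst_fm A \<sigma>) \<theta> = subst_fm A (\<lambda>i. subst_trm (\<sigma> i) \<theta>)"
  by (induction A arbitrary: \<sigma> \<theta>) (auto simp: subst_trm_comp under_binder_comp)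

definition lift_subst :: "nat \<Rightarrow> (nat \<Rightarrow> trm) \<Rightarrow> nat \<Rightarrow> trm" where
  "lift_subst k = under_binder ^^ k"

lemma lift_subst_0 [simp]: "lift_subst 0 \<theta> = \<theta>"
  by (simp add: lift_subst_def)

lemma lift_subst_Suc: "lift_subst (Suc k) \<theta> = under_binder (lift_subst k \<theta>)"
  by (simp add: lift_subst_def)

lemma lift_subst_less: "i < k \<Longrightarrow> lift_subst k \<theta> i = Bnd i"
  by (induction k arbitrary: i) (auto simp: lift_subst_Suc under_binder_def split: nat.splits)

text \<open>Each binder would shift the indices of the substituted term; a typed term has none, so
  it arrives unchanged at any depth.\<close>

lemma lift_subst_ge: "ty_of (\<theta> i) = Some \<tau> \<Longrightarrow> lift_subst k \<theta> (k + i) = \<theta> i"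
  by (induction k) (auto simp: lift_subst_Suc under_binder_def subst_typed)

section \<open>Substitution in formulas with named variables\<close>

definition cst :: "trm \<Rightarrow> tm" ("\<langle>_\<rangle>") where
  "\<langle>t\<rangle> = (\<lambda>d. t)"

lemma cst_apply [simp]: "\<langle>t\<rangle> d = t"
  by (simp add: cst_def)

text \<open>
  Substitution maps a formula with named variables to another one: \<open>s'\<close>, seen from depth \<open>k\<close>, is what
  becomes of \<open>s\<close>, seen from depth \<open>p + k\<close>, when \<open>\<theta>\<close> replaces the \<open>p\<close> outermost bound variables.  The
  simplifier proves these relations along the structure of a formula; variables bound at depth
  \<open>k\<close> are related at the depths above \<open>k\<close> only.
\<close>

definition rel_tm :: "nat \<Rightarrow> (nat \<Rightarrow> trm) \<Rightarrow> nat \<Rightarrow> tm \<Rightarrow> tm \<Rightarrow> bool" where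
  "rel_tm p \<theta> k s s' \<longleftrightarrow> subst_trm (s (p + k)) (lift_subst k \<theta>) = s' k"

definition rel_form :: "nat \<Rightarrow> (nat \<Rightarrow> trm) \<Rightarrow> nat \<Rightarrow> form \<Rightarrow> form \<Rightarrow> bool" where
  "rel_form p \<theta> k A A' \<longleftrightarrow> subst_fm (A (p + k)) (lift_subst k \<theta>) = A' k"

text \<open>A parametricity condition. The HOL type \<open>tm => form\<close> also contains
  functions that inspect their argument or the depth in ways no formula with a free variable does;
  for those, instantiating a quantifier would not amount to applying the function. All functions
  written with the given connectives satisfy it.\<close>

definition par :: "(tm \<Rightarrow> form) \<Rightarrow> bool" where
  "par F \<longleftrightarrow> (\<forall>p \<theta> s s'. (\<forall>j. rel_tm p \<theta> j s s') \<longrightarrow> rel_form p \<theta> 0 (F s) (F s'))"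

definition par2 :: "(tm \<Rightarrow> tm \<Rightarrow> form) \<Rightarrow> bool" where
  "par2 F \<longleftrightarrow> (\<forall>p \<theta> s s' t t'. (\<forall>j. rel_tm p \<theta> j s s') \<longrightarrow> (\<forall>j. rel_tm p \<theta> j t t') \<longrightarrow>
     rel_form p \<theta> 0 (F s t) (F s' t'))"

lemma parI [simp]:
  "(\<And>p \<theta> s s'. (\<And>j. rel_tm p \<theta> j s s') \<Longrightarrow> rel_form p \<theta> 0 (F s) (F s')) \<Longrightarrow> par F"
  by (simp add: par_def)

lemma par2I [simp]:
  "(\<And>p \<theta> s s' t t'. (\<And>j. rel_tm p \<theta> j s s') \<Longrightarrow> (\<And>j. rel_tm p \<theta> j t t') \<Longrightarrow>
     rel_form p \<theta> 0 (F s t) (F s' t')) \<Longrightarrow> par2 F"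
  by (simp add: par2_def)

lemma rel_cst [simp]: "ty_of t \<noteq> None \<Longrightarrow> rel_tm p \<theta> k \<langle>t\<rangle> \<langle>t\<rangle>"
  by (auto simp: rel_tm_def subst_typed)

lemma rel_const [simp]: "ty_of t \<noteq> None \<Longrightarrow> rel_tm p \<theta> k (\<lambda>_. t) (\<lambda>_. t)"
  using rel_cst[of t p \<theta> k] unfolding cst_def .

lemma rel_con [simp]: "rel_tm p \<theta> k (con c) (con c)"
  by (simp add: rel_tm_def con_def)

lemma rel_app [simp]:
  "rel_tm p \<theta> k s s' \<Longrightarrow> rel_tm p \<theta> k t t' \<Longrightarrow> rel_tm p \<theta> k (s \<^bold>\<cdot> t) (s' \<^bold>\<cdot> t')"
  by (simp add: rel_tm_def app_def)

lemma rel_fm [simp]: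
  "rel_form p \<theta> k \<^bold>\<bottom> \<^bold>\<bottom>"
  "rel_tm p \<theta> k s s' \<Longrightarrow> rel_tm p \<theta> k t t' \<Longrightarrow> rel_form p \<theta> k (s \<^bold>= t) (s' \<^bold>= t')"
  "rel_tm p \<theta> k s s' \<Longrightarrow> rel_tm p \<theta> k t t' \<Longrightarrow> rel_form p \<theta> k (s \<^bold>< t) (s' \<^bold>< t')"
  "rel_form p \<theta> k A A' \<Longrightarrow> rel_form p \<theta> k B B' \<Longrightarrow> rel_form p \<theta> k (A \<^bold>\<and> B) (A' \<^bold>\<and> B')"
  "rel_form p \<theta> k A A' \<Longrightarrow> rel_form p \<theta> k B B' \<Longrightarrow> rel_form p \<theta> k (A \<^bold>\<or> B) (A' \<^bold>\<or> B')"
  "rel_form p \<theta> k A A' \<Longrightarrow> rel_form p \<theta> k B B' \<Longrightarrow> rel_form p \<theta> k (A \<^bold>\<longrightarrow> B) (A' \<^bold>\<longrightarrow> B')"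
  by (simp_all add: rel_tm_def rel_form_def bot_def eq_fm_def less_fm_def conj_fm_def disj_fm_def imp_fm_def)

text \<open>Seen from depth \<open>p + j\<close> on the left and \<open>j\<close> on the right, both
  sides are the index \<open>j - Suc k\<close>. It is below \<open>j\<close>, so the lifted
  substitution fixes it.\<close>

lemma rel_bound_var:
  "k < j \<Longrightarrow> rel_tm p \<theta> j (\<lambda>e. Bnd (e - Suc (p + k))) (\<lambda>e. Bnd (e - Suc k))"
  by (simp add: rel_tm_def lift_subst_less)

lemma rel_quantifier [simp]:
  assumes "\<And>s s'. (\<And>j. k < j \<Longrightarrow> rel_tm p \<theta> j s s') \<Longrightarrow> rel_form p \<theta> (Suc k) (F s) (F' s')"
  shows "rel_form p \<theta> k (all_of \<tau> F) (all_of \<tau> F')" "rel_form p \<theta> k (ex_of \<tau> F) (ex_of \<tau> F')"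
  using assms[OF rel_bound_var] by (simp_all add: rel_form_def all_of_def ex_of_def lift_subst_Suc)

lemma rel_derived [simp]:
  "rel_form p \<theta> k A A' \<Longrightarrow> rel_form p \<theta> k (\<^bold>\<not> A) (\<^bold>\<not> A')"
  "rel_form p \<theta> k A A' \<Longrightarrow> rel_form p \<theta> k B B' \<Longrightarrow> rel_form p \<theta> k (A \<^bold>\<longleftrightarrow> B) (A' \<^bold>\<longleftrightarrow> B')"
  "rel_tm p \<theta> k s s' \<Longrightarrow> rel_tm p \<theta> k t t' \<Longrightarrow> rel_form p \<theta> k (s \<^bold>\<le> t) (s' \<^bold>\<le> t')"
  "rel_tm p \<theta> k s s' \<Longrightarrow> rel_form p \<theta> k (unit_interval s) (unit_interval s')"
  by (simp_all add: not_fm_def iff_fm_def le_fm_def unit_interval_def)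

lemma rel_nat_le [simp]:
  "(\<And>j. k \<le> j \<Longrightarrow> rel_tm p \<theta> j s s') \<Longrightarrow> (\<And>j. k \<le> j \<Longrightarrow> rel_tm p \<theta> j t t') \<Longrightarrow>
     rel_form p \<theta> k (s \<^bold>\<le>\<^sub>N t) (s' \<^bold>\<le>\<^sub>N t')"
  by (simp add: nat_le_def)

lemma rel_converges [simp]:
  "(\<And>j. k \<le> j \<Longrightarrow> rel_tm p \<theta> j s s') \<Longrightarrow> (\<And>j. k \<le> j \<Longrightarrow> rel_tm p \<theta> j t t') \<Longrightarrow>
     rel_form p \<theta> k (converges s t) (converges s' t')"
  by (simp add: converges_def)

lemma rel_cauchy [simp]:
  "(\<And>j. k \<le> j \<Longrightarrow> rel_tm p \<theta> j s s') \<Longrightarrow> rel_form p \<theta> k (cauchy s) (cauchy s')"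
  by (simp add: cauchy_def)

lemma rel_pred [simp]:
  "rel_tm p \<theta> k s s' \<Longrightarrow> rel_form p \<theta> k (pred1 A s) (pred1 A s')"
  "rel_tm p \<theta> k s s' \<Longrightarrow> rel_tm p \<theta> k t t' \<Longrightarrow> rel_form p \<theta> k (pred2 A s t) (pred2 A s' t')"
  by (simp_all add: rel_form_def rel_tm_def pred1_def pred2_def subst_fm_comp
      if_distrib[of "\<lambda>s. subst_trm s _"] cong: if_cong)

definition fm_of :: "(tm \<Rightarrow> form) \<Rightarrow> fm" where
  "fm_of F = F (\<lambda>e. Bnd (e - Suc 0)) (Suc 0)"

text \<open>At depth 2 the first argument becomes index 0 and the second index 1, the convention of
  \<open>pred2\<close>.\<close>

definition fm_of2 :: "(tm \<Rightarrow> tm \<Rightarrow> form) \<Rightarrow> fm" where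
  "fm_of2 F = F (\<lambda>e. Bnd (e - 2)) (\<lambda>e. Bnd (e - Suc 0)) 2"

lemma subst_fm_of:
  assumes "par F" "ty_of (\<theta> 0) = Some \<tau>"
  shows "subst_fm (fm_of F) \<theta> = F \<langle>\<theta> 0\<rangle> 0"
proof -
  have "rel_tm (Suc 0) \<theta> j (\<lambda>e. Bnd (e - Suc 0)) \<langle>\<theta> 0\<rangle>" for j
    using lift_subst_ge[of \<theta> 0 \<tau> j] assms(2) by (simp add: rel_tm_def)
  then have "rel_form (Suc 0) \<theta> 0 (F (\<lambda>e. Bnd (e - Suc 0))) (F \<langle>\<theta> 0\<rangle>)"
    using assms(1) unfolding par_def by blast
  then show ?thesis by (simp add: rel_form_def fm_of_def)
qed

lemma instantiate_fm_of:
  "par F \<Longrightarrow> ty_of t = Some \<tau> \<Longrightarrow> instantiate (fm_of F) t = F \<langle>t\<rangle> 0"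
  using subst_fm_of[of F "case_nat t Bnd"] by (simp add: instantiate_def)

lemma pred1_fm_of: "par F \<Longrightarrow> ty_of t = Some \<tau> \<Longrightarrow> pred1 (fm_of F) \<langle>t\<rangle> 0 = F \<langle>t\<rangle> 0"
  using subst_fm_of[of F "\<lambda>i. t"] by (simp add: pred1_def)

lemma pred2_fm_of:
  assumes "par2 F" "ty_of a = Some \<sigma>" "ty_of b = Some \<tau>"
  shows "pred2 (fm_of2 F) \<langle>a\<rangle> \<langle>b\<rangle> 0 = F \<langle>a\<rangle> \<langle>b\<rangle> 0"
proof -
  let ?\<theta> = "\<lambda>i::nat. if i = 0 then a else b"
  have "rel_tm 2 ?\<theta> j (\<lambda>e. Bnd (e - 2)) \<langle>a\<rangle>" for j
    using lift_subst_ge[of ?\<theta> 0 \<sigma> j] assms(2) by (simp add: rel_tm_def)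
  moreover have "rel_tm 2 ?\<theta> j (\<lambda>e. Bnd (e - Suc 0)) \<langle>b\<rangle>" for j
    using lift_subst_ge[of ?\<theta> 1 \<tau> j] assms(3) by (simp add: rel_tm_def)
  ultimately have "rel_form 2 ?\<theta> 0 (F (\<lambda>e. Bnd (e - 2)) (\<lambda>e. Bnd (e - Suc 0))) (F \<langle>a\<rangle> \<langle>b\<rangle>)"
    using assms(1) unfolding par2_def by blast
  then show ?thesis by (simp add: rel_form_def fm_of2_def pred2_def cong: if_cong)
qed

section \<open>Prime theories with witnesses\<close>

text \<open>Comparing contexts as sets covers permutation and contraction as well.\<close>

lemma weakening: "\<Gamma> \<^bold>\<turnstile> A \<Longrightarrow> set \<Gamma> \<subseteq> set \<Delta> \<Longrightarrow> \<Delta> \<^bold>\<turnstile> A"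
proof (induction arbitrary: \<Delta> rule: derivable.induct)
  case (OrE \<Gamma> A B C)
  then have "\<Delta> \<^bold>\<turnstile> FOr A B" "A # \<Delta> \<^bold>\<turnstile> C" "B # \<Delta> \<^bold>\<turnstile> C"
    by (simp_all add: subset_insertI2 insert_mono)
  then show ?case by (rule derivable.OrE)
next
  case (ImpI A \<Gamma> B)
  have "A # \<Delta> \<^bold>\<turnstile> B" by (rule ImpI.IH) (use ImpI.prems in auto)
  then show ?case by (rule derivable.ImpI)
next
  case (ExE \<Gamma> \<tau> A C)
  have "instantiate A (Par a \<tau>) # \<Delta> \<^bold>\<turnstile> C" for a
    by (rule ExE.IH(2)) (use ExE.prems in auto)
  then show ?case by (rule derivable.ExE[OF ExE.IH(1)[OF ExE.prems]])
next
  case (EqE \<Gamma> s t A)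
  then show ?case by (auto intro: derivable.EqE)
qed (auto intro: derivable.intros)

lemma cut: "\<Gamma> \<^bold>\<turnstile> A \<Longrightarrow> A # \<Gamma> \<^bold>\<turnstile> C \<Longrightarrow> \<Gamma> \<^bold>\<turnstile> C"
  using ImpE ImpI by blast

text \<open>These are the nodes of the canonical Kripke model of the calculus. Witnesses are
  parameters because these are what \<open>ExE\<close> ranges over.\<close>

definition world :: "fm set \<Rightarrow> bool" where
  "world T \<longleftrightarrow> (\<forall>\<Gamma> A. set \<Gamma> \<subseteq> T \<longrightarrow> (\<Gamma> \<^bold>\<turnstile> A) \<longrightarrow> A \<in> T) \<and> FBot \<notin> T \<and>
     (\<forall>A B. FOr A B \<in> T \<longrightarrow> A \<in> T \<or> B \<in> T) \<and>
     (\<forall>\<tau> A. FEx \<tau> A \<in> T \<longrightarrow> (\<exists>a. instantiate A (Par a \<tau>) \<in> T))"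

instance ty :: countable by countable_datatype
instance const :: countable by countable_datatype
instance trm :: countable by countable_datatype
instance fm :: countable by countable_datatype

text \<open>The parameter is selected by the property that matters, not deriving \<open>C\<close>,
  instead of by freshness; \<open>witnesses_avoid\<close> shows that one exists.\<close>

definition witnesses :: "fm \<Rightarrow> fm list \<Rightarrow> fm \<Rightarrow> fm list" where
  "witnesses C \<Gamma> A = (case A of
     FEx \<tau> B \<Rightarrow> [instantiate B (Par (SOME a. \<not> (instantiate B (Par a \<tau>) # A # \<Gamma> \<^bold>\<turnstile> C)) \<tau>)] | _ \<Rightarrow> [])"

text \<open>Every formula is examined once, at the stage given by its code, and accepted unless it
  would make \<open>C\<close> derivable. The union is thus maximal among the theories avoiding
  \<open>C\<close>, so that closure and primality need no stages of their own.\<close>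

primrec henkin :: "fm \<Rightarrow> fm list \<Rightarrow> nat \<Rightarrow> fm list" where
  "henkin C \<Gamma> 0 = \<Gamma>"
| "henkin C \<Gamma> (Suc n) =
     (let \<Delta> = henkin C \<Gamma> n; A = from_nat n
      in if A # \<Delta> \<^bold>\<turnstile> C then \<Delta> else witnesses C \<Delta> A @ A # \<Delta>)"

text \<open>The contrapositive of \<open>ExE\<close>: its premise ranges over all parameters, so if
  \<open>C\<close> is not derivable, the premise fails for some parameter.\<close>

lemma witnesses_avoid: "\<not> (A # \<Gamma> \<^bold>\<turnstile> C) \<Longrightarrow> \<not> (witnesses C \<Gamma> A @ A # \<Gamma> \<^bold>\<turnstile> C)"
proof (cases "\<exists>\<tau> B. A = FEx \<tau> B")
  case True
  then obtain \<tau> B where A: "A = FEx \<tau> B" by blast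
  assume n: "\<not> (A # \<Gamma> \<^bold>\<turnstile> C)"
  have "\<exists>a. \<not> (instantiate B (Par a \<tau>) # A # \<Gamma> \<^bold>\<turnstile> C)"
    using n ExE[of "A # \<Gamma>" \<tau> B C] Assm[of A "A # \<Gamma>"] A by auto
  from someI_ex[OF this] show ?thesis by (simp add: witnesses_def A)
qed (auto simp: witnesses_def split: fm.splits)

lemma henkin_avoid: "\<not> (\<Gamma> \<^bold>\<turnstile> C) \<Longrightarrow> \<not> (henkin C \<Gamma> n \<^bold>\<turnstile> C)"
  by (induction n) (auto simp: Let_def witnesses_avoid)

lemma henkin_mono: "m \<le> n \<Longrightarrow> set (henkin C \<Gamma> m) \<subseteq> set (henkin C \<Gamma> n)"
  by (rule lift_Suc_mono_le[of "\<lambda>n. set (henkin C \<Gamma> n)"]) (auto simp: Let_def)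

lemma henkin_finite:
  assumes "set \<Delta> \<subseteq> (\<Union>n. set (henkin C \<Gamma> n))"
  shows "\<exists>n. set \<Delta> \<subseteq> set (henkin C \<Gamma> n)"
  using assms
proof (induction \<Delta>)
  case (Cons A \<Delta>)
  then obtain m n where "set \<Delta> \<subseteq> set (henkin C \<Gamma> m)" "A \<in> set (henkin C \<Gamma> n)" by auto
  then have "set (A # \<Delta>) \<subseteq> set (henkin C \<Gamma> (max m n))"
    using henkin_mono[of m "max m n" C \<Gamma>] henkin_mono[of n "max m n" C \<Gamma>] by auto
  then show ?case by blast
qed auto

text \<open>Lindenbaum's argument for an intuitionistic calculus: the theory is made maximal with
  respect to not deriving \<open>C\<close>, not with respect to consistency, which would make it
  classical.\<close>

lemma prime_extension:
  assumes C: "\<not> (\<Gamma> \<^bold>\<turnstile> C)"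
  shows "\<exists>T. world T \<and> set \<Gamma> \<subseteq> T \<and> C \<notin> T"
proof -
  define T where "T = (\<Union>n. set (henkin C \<Gamma> n))"
  have avoid: "\<not> (\<Delta> \<^bold>\<turnstile> C)" if "set \<Delta> \<subseteq> T" for \<Delta>
    using henkin_finite[of \<Delta> C \<Gamma>] that weakening henkin_avoid[OF C] unfolding T_def by metis
  \<comment> \<open>Maximality: the only reason for rejecting \<open>A\<close> at its own stage is
    that it would yield \<open>C\<close>. Closure then follows by \<open>cut\<close> and primality
    by \<open>OrE\<close>.\<close>
  have notin: "\<exists>\<Delta>. set \<Delta> \<subseteq> T \<and> (A # \<Delta> \<^bold>\<turnstile> C)" if "A \<notin> T" for A
  proof (rule ccontr)
    assume "\<not> ?thesis"
    then have "\<not> (A # henkin C \<Gamma> (to_nat A) \<^bold>\<turnstile> C)" by (auto simp: T_def)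
    then have "A \<in> set (henkin C \<Gamma> (Suc (to_nat A)))" by (simp add: Let_def)
    with that show False by (auto simp: T_def simp del: henkin.simps)
  qed
  have closed: "A \<in> T" if d: "set \<Delta> \<subseteq> T" "\<Delta> \<^bold>\<turnstile> A" for \<Delta> A
  proof (rule ccontr)
    assume "A \<notin> T"
    then obtain \<Delta>' where d': "set \<Delta>' \<subseteq> T" "A # \<Delta>' \<^bold>\<turnstile> C" using notin by blast
    have "\<Delta> @ \<Delta>' \<^bold>\<turnstile> C"
      by (rule cut[of _ A]) (auto intro: weakening[OF d(2)] weakening[OF d'(2)])
    with avoid[of "\<Delta> @ \<Delta>'"] d d' show False by auto
  qed
  have prime: "A \<in> T \<or> B \<in> T" if "FOr A B \<in> T" for A B
  proof (rule ccontr)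
    assume "\<not> ?thesis"
    then obtain \<Delta> \<Delta>' where d: "set \<Delta> \<subseteq> T" "A # \<Delta> \<^bold>\<turnstile> C" "set \<Delta>' \<subseteq> T" "B # \<Delta>' \<^bold>\<turnstile> C"
      using notin by meson
    have "FOr A B # \<Delta> @ \<Delta>' \<^bold>\<turnstile> C"
      by (rule OrE[of _ A B])
        (auto intro: Assm weakening[OF d(2)] weakening[OF d(4)])
    with avoid[of "FOr A B # \<Delta> @ \<Delta>'"] d that show False by auto
  qed
  \<comment> \<open>A member of \<open>T\<close> is also acceptable at the stage of its code, and
    its witness is added there.\<close>
  have wit: "\<exists>a. instantiate A (Par a \<tau>) \<in> T" if "FEx \<tau> A \<in> T" for \<tau> A
  proof -
    let ?n = "to_nat (FEx \<tau> A)"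
    have "\<not> (FEx \<tau> A # henkin C \<Gamma> ?n \<^bold>\<turnstile> C)"
      using that by (intro avoid) (auto simp: T_def)
    then have "\<exists>a. instantiate A (Par a \<tau>) \<in> set (henkin C \<Gamma> (Suc ?n))"
      by (auto simp: Let_def witnesses_def)
    then show ?thesis by (auto simp: T_def simp del: henkin.simps)
  qed
  have "FBot \<notin> T" "C \<notin> T"
    using avoid[of "[FBot]"] avoid[of "[C]"] BotE[OF Assm] Assm[of C "[C]"] by fastforce+
  moreover have "set \<Gamma> \<subseteq> T"
    unfolding T_def by (rule UN_upper[of 0, THEN order_trans[rotated]]) auto
  ultimately show ?thesis
    using closed prime wit unfolding world_def by blast
qed

lemma completeness: "(\<And>T. world T \<Longrightarrow> set \<Gamma> \<subseteq> T \<Longrightarrow> C \<in> T) \<Longrightarrow> \<Gamma> \<^bold>\<turnstile> C"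
  using prime_extension by blast

section \<open>Truth in a world\<close>

definition holds :: "fm set \<Rightarrow> form \<Rightarrow> bool" (infix "\<tturnstile>" 9) where
  "(T \<tturnstile> A) \<longleftrightarrow> A 0 \<in> T"

lemma world_closed: "world T \<Longrightarrow> set \<Gamma> \<subseteq> T \<Longrightarrow> \<Gamma> \<^bold>\<turnstile> A \<Longrightarrow> A \<in> T"
  unfolding world_def by blast

lemma world_closed1: "world T \<Longrightarrow> A \<in> T \<Longrightarrow> [A] \<^bold>\<turnstile> B \<Longrightarrow> B \<in> T"
  using world_closed[of T "[A]"] by simp

lemma world_closed2: "world T \<Longrightarrow> A \<in> T \<Longrightarrow> B \<in> T \<Longrightarrow> [A, B] \<^bold>\<turnstile> C \<Longrightarrow> C \<in> T"
  using world_closed[of T "[A, B]"] by simp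

lemma world_axiom: "world T \<Longrightarrow> bish_axiom A \<Longrightarrow> T \<tturnstile> A"
  using world_closed[of T "[]"] by (simp add: holds_def Axiom)

lemma world_mp:
  assumes "world T" "T \<tturnstile> A \<^bold>\<longrightarrow> B" "T \<tturnstile> A"
  shows "T \<tturnstile> B"
proof -
  have "[FImp (A 0) (B 0), A 0] \<^bold>\<turnstile> B 0" by (rule ImpE[of _ "A 0"]; rule Assm; simp)
  then show ?thesis using assms world_closed2[of T "FImp (A 0) (B 0)" "A 0" "B 0"] by (simp add: holds_def imp_fm_def)
qed

lemma world_bot [simp]: "world T \<Longrightarrow> \<not> (T \<tturnstile> \<^bold>\<bottom>)"
  by (simp add: holds_def bot_def world_def)

lemma world_not: "world T \<Longrightarrow> T \<tturnstile> \<^bold>\<not> A \<Longrightarrow> \<not> (T \<tturnstile> A)"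
  using world_mp[of T A "\<^bold>\<bottom>"] by (auto simp: not_fm_def)

lemma world_conj [simp]:
  assumes "world T"
  shows "(T \<tturnstile> A \<^bold>\<and> B) \<longleftrightarrow> (T \<tturnstile> A) \<and> (T \<tturnstile> B)"
proof -
  have "[FAnd (A 0) (B 0)] \<^bold>\<turnstile> A 0" by (rule AndE1[of _ _ "B 0"]) (simp add: Assm)
  moreover have "[FAnd (A 0) (B 0)] \<^bold>\<turnstile> B 0" by (rule AndE2[of _ "A 0"]) (simp add: Assm)
  moreover have "[A 0, B 0] \<^bold>\<turnstile> FAnd (A 0) (B 0)" by (simp add: AndI Assm)
  ultimately show ?thesis
    using world_closed1[OF assms] world_closed2[OF assms] unfolding holds_def conj_fm_def by blast
qed

lemma world_disj [simp]:
  assumes "world T"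
  shows "(T \<tturnstile> A \<^bold>\<or> B) \<longleftrightarrow> (T \<tturnstile> A) \<or> (T \<tturnstile> B)"
proof -
  have "[A 0] \<^bold>\<turnstile> FOr (A 0) (B 0)" "[B 0] \<^bold>\<turnstile> FOr (A 0) (B 0)"
    by (simp_all add: OrI1 OrI2 Assm)
  moreover have "FOr (A 0) (B 0) \<in> T \<Longrightarrow> A 0 \<in> T \<or> B 0 \<in> T"
    using assms by (simp add: world_def)
  ultimately show ?thesis
    using world_closed1[OF assms] unfolding holds_def disj_fm_def by blast
qed

lemma all_of_eq: "all_of \<tau> F 0 = FAll \<tau> (fm_of F)" and ex_of_eq: "ex_of \<tau> F 0 = FEx \<tau> (fm_of F)"
  by (simp_all add: all_of_def ex_of_def fm_of_def)

text \<open>Only elimination can be read off from a single world; introduction is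
  \<open>world_allI\<close>.\<close>

lemma world_all:
  assumes "world T" "T \<tturnstile> all_of \<tau> F" "par F" "ty_of t = Some \<tau>"
  shows "T \<tturnstile> F \<langle>t\<rangle>"
proof -
  have "FAll \<tau> (fm_of F) \<in> T" using assms by (simp add: holds_def all_of_eq)
  then have "instantiate (fm_of F) t \<in> T"
    by (rule world_closed1[OF assms(1)]) (rule AllE[of _ \<tau>], rule Assm, simp_all add: has_ty_iff assms)
  then show ?thesis using assms by (simp add: instantiate_fm_of holds_def)
qed

lemma world_ex:
  assumes "world T" "par F"
  shows "(T \<tturnstile> ex_of \<tau> F) \<longleftrightarrow> (\<exists>t. ty_of t = Some \<tau> \<and> (T \<tturnstile> F \<langle>t\<rangle>))"
proof
  assume "T \<tturnstile> ex_of \<tau> F"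
  then obtain a where "instantiate (fm_of F) (Par a \<tau>) \<in> T"
    using assms(1) unfolding holds_def ex_of_eq world_def by blast
  then show "\<exists>t. ty_of t = Some \<tau> \<and> (T \<tturnstile> F \<langle>t\<rangle>)"
    using assms(2) by (intro exI[of _ "Par a \<tau>"]) (simp add: instantiate_fm_of holds_def)
next
  assume "\<exists>t. ty_of t = Some \<tau> \<and> (T \<tturnstile> F \<langle>t\<rangle>)"
  then obtain t where t: "ty_of t = Some \<tau>" "instantiate (fm_of F) t \<in> T"
    using assms(2) by (auto simp: holds_def instantiate_fm_of)
  have "FEx \<tau> (fm_of F) \<in> T"
    by (rule world_closed1[OF assms(1) t(2)]) (rule ExI[of _ _ t], rule Assm, simp_all add: has_ty_iff t)
  then show "T \<tturnstile> ex_of \<tau> F" by (simp add: holds_def ex_of_eq)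
qed

lemma world_exI:
  "world T \<Longrightarrow> T \<tturnstile> F \<langle>t\<rangle> \<Longrightarrow> ty_of t = Some \<tau> \<Longrightarrow> par F \<Longrightarrow> T \<tturnstile> ex_of \<tau> F"
  by (auto simp: world_ex simp del: parI)

lemma world_exE:
  assumes "world T" "T \<tturnstile> ex_of \<tau> F" "par F"
  obtains t where "ty_of t = Some \<tau>" "T \<tturnstile> F \<langle>t\<rangle>"
  using assms by (auto simp: world_ex simp del: parI)

text \<open>
  A conclusion that is an implication, a negation or a universal statement is not decided by the
  world; it holds if it holds in all worlds that contain one formula \<open>H\<close> of the given world.
\<close>

lemma world_allI:
  assumes T: "world T" and H: "T \<tturnstile> H" and F: "par F"
    and step: "\<And>T' t. world T' \<Longrightarrow> T' \<tturnstile> H \<Longrightarrow> ty_of t = Some \<tau> \<Longrightarrow> T' \<tturnstile> F \<langle>t\<rangle>"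
  shows "T \<tturnstile> all_of \<tau> F"
proof -
  have "[H 0] \<^bold>\<turnstile> instantiate (fm_of F) (Par a \<tau>)" for a
    by (rule completeness) (use step[of _ "Par a \<tau>"] F in \<open>simp add: instantiate_fm_of holds_def\<close>)
  then have "[H 0] \<^bold>\<turnstile> FAll \<tau> (fm_of F)" by (rule AllI)
  then show ?thesis using world_closed1[OF T] H by (simp add: holds_def all_of_eq)
qed

lemma world_impI:
  assumes T: "world T" and H: "T \<tturnstile> H"
    and step: "\<And>T'. world T' \<Longrightarrow> T' \<tturnstile> H \<Longrightarrow> T' \<tturnstile> A \<Longrightarrow> T' \<tturnstile> B"
  shows "T \<tturnstile> A \<^bold>\<longrightarrow> B"
proof -
  have "[A 0, H 0] \<^bold>\<turnstile> B 0"
    by (rule completeness) (use step in \<open>simp add: holds_def\<close>)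
  then have "[H 0] \<^bold>\<turnstile> FImp (A 0) (B 0)" by (rule ImpI)
  then show ?thesis using world_closed1[OF T] H by (simp add: holds_def imp_fm_def)
qed

lemma world_notI:
  assumes T: "world T" and H: "T \<tturnstile> H"
    and step: "\<And>T'. world T' \<Longrightarrow> T' \<tturnstile> H \<Longrightarrow> T' \<tturnstile> A \<Longrightarrow> False"
  shows "T \<tturnstile> \<^bold>\<not> A"
  unfolding not_fm_def by (rule world_impI[OF T H]) (use step in blast)

lemma world_refl: "world T \<Longrightarrow> s 0 = t 0 \<Longrightarrow> T \<tturnstile> s \<^bold>= t"
  using world_closed[of T "[]" "FEq (t 0) (t 0)"] by (simp add: holds_def eq_fm_def EqI)

lemma world_subst:
  assumes "world T" "T \<tturnstile> \<langle>s\<rangle> \<^bold>= \<langle>t\<rangle>" "T \<tturnstile> F \<langle>s\<rangle>" "par F" "ty_of s = Some \<tau>" "ty_of t = Some \<tau>"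
  shows "T \<tturnstile> F \<langle>t\<rangle>"
proof -
  have "FEq s t \<in> T" "instantiate (fm_of F) s \<in> T"
    using assms by (simp_all add: holds_def eq_fm_def instantiate_fm_of)
  then have "instantiate (fm_of F) t \<in> T"
    by (rule world_closed2[OF assms(1)]) (rule EqE[of _ s t]; rule Assm; simp)
  then show ?thesis using assms by (simp add: holds_def instantiate_fm_of)
qed

lemma world_sym:
  assumes "world T" "T \<tturnstile> \<langle>s\<rangle> \<^bold>= \<langle>t\<rangle>" "ty_of s = Some \<tau>" "ty_of t = Some \<tau>"
  shows "T \<tturnstile> \<langle>t\<rangle> \<^bold>= \<langle>s\<rangle>"
  by (rule world_subst[OF assms(1,2), of "\<lambda>x. x \<^bold>= \<langle>s\<rangle>" \<tau>]) (use assms in \<open>simp_all add: world_refl\<close>)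

lemma world_trans:
  assumes "world T" "T \<tturnstile> \<langle>s\<rangle> \<^bold>= \<langle>t\<rangle>" "T \<tturnstile> \<langle>t\<rangle> \<^bold>= \<langle>u\<rangle>"
    "ty_of s = Some \<tau>" "ty_of t = Some \<tau>" "ty_of u = Some \<tau>"
  shows "T \<tturnstile> \<langle>s\<rangle> \<^bold>= \<langle>u\<rangle>"
  by (rule world_subst[OF assms(1,3), of "\<lambda>x. \<langle>s\<rangle> \<^bold>= x" \<tau>]) (use assms in \<open>simp_all\<close>)

lemma world_cong:
  assumes "world T" "T \<tturnstile> \<langle>s\<rangle> \<^bold>= \<langle>t\<rangle>" "ty_of f = Some (\<sigma> \<rightarrow> \<tau>)" "ty_of s = Some \<sigma>" "ty_of t = Some \<sigma>"
  shows "T \<tturnstile> \<langle>App f s\<rangle> \<^bold>= \<langle>App f t\<rangle>"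
proof -
  have "T \<tturnstile> \<langle>App f s\<rangle> \<^bold>= \<langle>f\<rangle> \<^bold>\<cdot> \<langle>t\<rangle>"
    by (rule world_subst[OF assms(1,2), of "\<lambda>x. \<langle>App f s\<rangle> \<^bold>= \<langle>f\<rangle> \<^bold>\<cdot> x" \<sigma>])
      (use assms in \<open>simp_all add: world_refl\<close>, simp add: world_refl app_def)
  then show ?thesis by (simp add: holds_def eq_fm_def app_def)
qed

text \<open>Every formula is evaluated at depth 0, where closed terms can be written without binders.\<close>

lemma holds_eq: "(T \<tturnstile> s \<^bold>= t) \<longleftrightarrow> (T \<tturnstile> \<langle>s 0\<rangle> \<^bold>= \<langle>t 0\<rangle>)"
  by (simp add: holds_def eq_fm_def)

lemma holds_less: "(T \<tturnstile> s \<^bold>< t) \<longleftrightarrow> (T \<tturnstile> \<langle>s 0\<rangle> \<^bold>< \<langle>t 0\<rangle>)"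
  by (simp add: holds_def less_fm_def)

lemma cst_app [simp]: "\<langle>s\<rangle> \<^bold>\<cdot> \<langle>t\<rangle> = \<langle>App s t\<rangle>" and cst_con: "con c = \<langle>Con c\<rangle>"
  by (simp_all add: cst_def app_def con_def)

lemma con_app [simp]: "con c \<^bold>\<cdot> \<langle>t\<rangle> = \<langle>App (Con c) t\<rangle>" "\<langle>t\<rangle> \<^bold>\<cdot> con c = \<langle>App t (Con c)\<rangle>"
   "con c \<^bold>\<cdot> con d = \<langle>App (Con c) (Con d)\<rangle>"
  by (simp_all add: cst_def app_def con_def)

section \<open>Induction and choice in a world\<close>

text \<open>The base case concerns the given world only. The step is required in every world with
  \<open>H\<close>, because in the induction axiom it is a universally quantified
  implication.\<close>

lemma world_induct:
  assumes T: "world T" and H: "T \<tturnstile> H" and F: "par F" and base: "T \<tturnstile> F \<langle>Con CNZero\<rangle>"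
    and step: "\<And>T' n. world T' \<Longrightarrow> T' \<tturnstile> H \<Longrightarrow> ty_of n = Some NatT \<Longrightarrow> T' \<tturnstile> F \<langle>n\<rangle> \<Longrightarrow>
      T' \<tturnstile> F \<langle>App (Con CNSuc) n\<rangle>"
    and n: "ty_of n = Some NatT"
  shows "T \<tturnstile> F \<langle>n\<rangle>"
proof -
  let ?A = "fm_of F"
  have p: "(T' \<tturnstile> pred1 ?A \<langle>t\<rangle>) \<longleftrightarrow> (T' \<tturnstile> F \<langle>t\<rangle>)" if "ty_of t = Some NatT" for t T'
    using that F by (simp add: holds_def pred1_fm_of)
  have "T \<tturnstile> \<^bold>\<forall>\<^sub>N n. pred1 ?A n \<^bold>\<longrightarrow> pred1 ?A (nat_suc n)"
  proof (rule world_allI[OF T H])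
    fix T' t assume *: "world T'" "T' \<tturnstile> H" "ty_of t = Some NatT"
    show "T' \<tturnstile> pred1 ?A \<langle>t\<rangle> \<^bold>\<longrightarrow> pred1 ?A (nat_suc \<langle>t\<rangle>)"
      by (rule world_impI[OF *(1,2)]) (use * step p in simp)
  qed simp
  moreover have "T \<tturnstile> pred1 ?A \<^bold>0\<^sub>N" using base p by (simp add: cst_con)
  ultimately have "T \<tturnstile> \<^bold>\<forall>\<^sub>N n. pred1 ?A n"
    using world_mp[OF T world_axiom[OF T induction[of ?A]]] T by simp
  then have "T \<tturnstile> pred1 ?A \<langle>n\<rangle>" by (rule world_all[OF T _ _ n]) simp
  then show ?thesis by (simp only: p[OF n])
qed

text \<open>Totality is a universal premise of the axiom, hence \<open>step\<close> in all worlds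
  with \<open>H\<close>; the chosen function is a term obtained in the given world.\<close>

lemma world_choice:
  assumes T: "world T" and H: "T \<tturnstile> H" and P: "par2 P"
    and step: "\<And>T' n. world T' \<Longrightarrow> T' \<tturnstile> H \<Longrightarrow> ty_of n = Some NatT \<Longrightarrow>
      \<exists>y. ty_of y = Some \<sigma> \<and> (T' \<tturnstile> P \<langle>n\<rangle> \<langle>y\<rangle>)"
  obtains g where "ty_of g = Some (NatT \<rightarrow> \<sigma>)" "T \<tturnstile> \<^bold>\<forall>\<^sub>N n. P n (\<langle>g\<rangle> \<^bold>\<cdot> n)"
proof -
  let ?A = "fm_of2 P"
  have p: "(T' \<tturnstile> pred2 ?A \<langle>s\<rangle> \<langle>t\<rangle>) \<longleftrightarrow> (T' \<tturnstile> P \<langle>s\<rangle> \<langle>t\<rangle>)"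
    if "ty_of s = Some NatT" "ty_of t = Some \<sigma>" for s t T'
    using that P by (simp add: holds_def pred2_fm_of)
  have "T \<tturnstile> \<^bold>\<forall>\<^sub>N n. ex_of \<sigma> (\<lambda>y. pred2 ?A n y)"
  proof (rule world_allI[OF T H])
    fix T' t assume *: "world T'" "T' \<tturnstile> H" "ty_of t = Some NatT"
    then obtain y where y: "ty_of y = Some \<sigma>" "T' \<tturnstile> P \<langle>t\<rangle> \<langle>y\<rangle>" using step by blast
    show "T' \<tturnstile> ex_of \<sigma> (\<lambda>y. pred2 ?A \<langle>t\<rangle> y)"
      by (rule world_exI[OF *(1) _ y(1)]) (use y * p in simp_all)
  qed simp
  then have "T \<tturnstile> ex_of (NatT \<rightarrow> \<sigma>) (\<lambda>g. \<^bold>\<forall>\<^sub>N n. pred2 ?A n (g \<^bold>\<cdot> n))"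
    using world_mp[OF T world_axiom[OF T countable_choice[of \<sigma> ?A]]] by simp
  then obtain g where g: "ty_of g = Some (NatT \<rightarrow> \<sigma>)" "T \<tturnstile> \<^bold>\<forall>\<^sub>N n. pred2 ?A n (\<langle>g\<rangle> \<^bold>\<cdot> n)"
    using T by (auto simp: world_ex)
  have "par (\<lambda>n. P n (\<langle>g\<rangle> \<^bold>\<cdot> n))" using P g(1) by (simp add: par2_def)
  then have "T \<tturnstile> \<^bold>\<forall>\<^sub>N n. P n (\<langle>g\<rangle> \<^bold>\<cdot> n)"
    by (rule world_allI[OF T g(2)]) (use world_all[OF _ _ _ , of _ NatT "\<lambda>n. pred2 ?A n (\<langle>g\<rangle> \<^bold>\<cdot> n)"] g p in simp)
  with g(1) that show thesis by blast
qed

lemma world_dependent_choice: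
  assumes T: "world T" and H: "T \<tturnstile> H" and F: "par F" and P: "par2 P"
    and step: "\<And>T' x. world T' \<Longrightarrow> T' \<tturnstile> H \<Longrightarrow> ty_of x = Some \<sigma> \<Longrightarrow> T' \<tturnstile> F \<langle>x\<rangle> \<Longrightarrow>
      \<exists>y. ty_of y = Some \<sigma> \<and> (T' \<tturnstile> F \<langle>y\<rangle>) \<and> (T' \<tturnstile> P \<langle>x\<rangle> \<langle>y\<rangle>)"
    and x: "ty_of x = Some \<sigma>" "T \<tturnstile> F \<langle>x\<rangle>"
  obtains g where "ty_of g = Some (NatT \<rightarrow> \<sigma>)" "T \<tturnstile> \<langle>g\<rangle> \<^bold>\<cdot> \<^bold>0\<^sub>N \<^bold>= \<langle>x\<rangle>"
    "T \<tturnstile> \<^bold>\<forall>\<^sub>N n. F (\<langle>g\<rangle> \<^bold>\<cdot> n)" "T \<tturnstile> \<^bold>\<forall>\<^sub>N n. P (\<langle>g\<rangle> \<^bold>\<cdot> n) (\<langle>g\<rangle> \<^bold>\<cdot> nat_suc n)"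
proof -
  let ?A = "fm_of F" let ?B = "fm_of2 P"
  have p: "(T' \<tturnstile> pred1 ?A \<langle>t\<rangle>) \<longleftrightarrow> (T' \<tturnstile> F \<langle>t\<rangle>)" if "ty_of t = Some \<sigma>" for t T'
    using that F by (simp add: holds_def pred1_fm_of)
  have q: "(T' \<tturnstile> pred2 ?B \<langle>s\<rangle> \<langle>t\<rangle>) \<longleftrightarrow> (T' \<tturnstile> P \<langle>s\<rangle> \<langle>t\<rangle>)"
    if "ty_of s = Some \<sigma>" "ty_of t = Some \<sigma>" for s t T'
    using that P by (simp add: holds_def pred2_fm_of)
  have "T \<tturnstile> all_of \<sigma> (\<lambda>x. pred1 ?A x \<^bold>\<longrightarrow> ex_of \<sigma> (\<lambda>y. pred1 ?A y \<^bold>\<and> pred2 ?B x y))"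
  proof (rule world_allI[OF T H])
    fix T' t assume *: "world T'" "T' \<tturnstile> H" "ty_of t = Some \<sigma>"
    show "T' \<tturnstile> pred1 ?A \<langle>t\<rangle> \<^bold>\<longrightarrow> ex_of \<sigma> (\<lambda>y. pred1 ?A y \<^bold>\<and> pred2 ?B \<langle>t\<rangle> y)"
    proof (rule world_impI[OF *(1,2)])
      fix T'' assume **: "world T''" "T'' \<tturnstile> H" "T'' \<tturnstile> pred1 ?A \<langle>t\<rangle>"
      then obtain y where y: "ty_of y = Some \<sigma>" "T'' \<tturnstile> F \<langle>y\<rangle>" "T'' \<tturnstile> P \<langle>t\<rangle> \<langle>y\<rangle>"
        using step[of T'' t] * p by blast
      show "T'' \<tturnstile> ex_of \<sigma> (\<lambda>y. pred1 ?A y \<^bold>\<and> pred2 ?B \<langle>t\<rangle> y)"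
        by (rule world_exI[OF **(1) _ y(1)]) (use y * ** p q in simp_all)
    qed
  qed simp
  then have "T \<tturnstile> all_of \<sigma> (\<lambda>x. pred1 ?A x \<^bold>\<longrightarrow>
         ex_of (NatT \<rightarrow> \<sigma>) (\<lambda>g. g \<^bold>\<cdot> \<^bold>0\<^sub>N \<^bold>= x \<^bold>\<and>
           (\<^bold>\<forall>\<^sub>N n. pred1 ?A (g \<^bold>\<cdot> n) \<^bold>\<and> pred2 ?B (g \<^bold>\<cdot> n) (g \<^bold>\<cdot> nat_suc n))))"
    using world_mp[OF T world_axiom[OF T dependent_choice[of \<sigma> ?A ?B]]] by simp
  from world_all[OF T this _ x(1)] have "T \<tturnstile> pred1 ?A \<langle>x\<rangle> \<^bold>\<longrightarrow> ex_of (NatT \<rightarrow> \<sigma>) (\<lambda>g. g \<^bold>\<cdot> \<^bold>0\<^sub>N \<^bold>= \<langle>x\<rangle> \<^bold>\<and>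
      (\<^bold>\<forall>\<^sub>N n. pred1 ?A (g \<^bold>\<cdot> n) \<^bold>\<and> pred2 ?B (g \<^bold>\<cdot> n) (g \<^bold>\<cdot> nat_suc n)))" by simp
  from world_mp[OF T this] p x have "T \<tturnstile> ex_of (NatT \<rightarrow> \<sigma>) (\<lambda>g. g \<^bold>\<cdot> \<^bold>0\<^sub>N \<^bold>= \<langle>x\<rangle> \<^bold>\<and>
      (\<^bold>\<forall>\<^sub>N n. pred1 ?A (g \<^bold>\<cdot> n) \<^bold>\<and> pred2 ?B (g \<^bold>\<cdot> n) (g \<^bold>\<cdot> nat_suc n)))" by blast
  from world_exE[OF T this] x(1) obtain g where g: "ty_of g = Some (NatT \<rightarrow> \<sigma>)"
    "T \<tturnstile> \<langle>g\<rangle> \<^bold>\<cdot> \<^bold>0\<^sub>N \<^bold>= \<langle>x\<rangle> \<^bold>\<and> (\<^bold>\<forall>\<^sub>N n. pred1 ?A (\<langle>g\<rangle> \<^bold>\<cdot> n) \<^bold>\<and> pred2 ?B (\<langle>g\<rangle> \<^bold>\<cdot> n) (\<langle>g\<rangle> \<^bold>\<cdot> nat_suc n))"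
    by auto
  then have g: "ty_of g = Some (NatT \<rightarrow> \<sigma>)" "T \<tturnstile> \<langle>g\<rangle> \<^bold>\<cdot> \<^bold>0\<^sub>N \<^bold>= \<langle>x\<rangle>"
    "T \<tturnstile> \<^bold>\<forall>\<^sub>N n. pred1 ?A (\<langle>g\<rangle> \<^bold>\<cdot> n) \<^bold>\<and> pred2 ?B (\<langle>g\<rangle> \<^bold>\<cdot> n) (\<langle>g\<rangle> \<^bold>\<cdot> nat_suc n)"
    using T by simp_all
  have *: "(T' \<tturnstile> pred1 ?A \<langle>App g n\<rangle>) \<and> (T' \<tturnstile> pred2 ?B \<langle>App g n\<rangle> \<langle>App g (App (Con CNSuc) n)\<rangle>)"
    if "world T'" "T' \<tturnstile> \<^bold>\<forall>\<^sub>N n. pred1 ?A (\<langle>g\<rangle> \<^bold>\<cdot> n) \<^bold>\<and> pred2 ?B (\<langle>g\<rangle> \<^bold>\<cdot> n) (\<langle>g\<rangle> \<^bold>\<cdot> nat_suc n)"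
      "ty_of n = Some NatT" for T' n
    using world_all[OF that(1,2) _ that(3)] that g(1) by simp
  have "par (\<lambda>n. F (\<langle>g\<rangle> \<^bold>\<cdot> n))" using F g(1) by (simp add: par_def)
  then have "T \<tturnstile> \<^bold>\<forall>\<^sub>N n. F (\<langle>g\<rangle> \<^bold>\<cdot> n)"
    by (rule world_allI[OF T g(3)]) (use * p g in simp)
  moreover have "par (\<lambda>n. P (\<langle>g\<rangle> \<^bold>\<cdot> n) (\<langle>g\<rangle> \<^bold>\<cdot> nat_suc n))" using P g(1) by (simp add: par2_def)
  then have "T \<tturnstile> \<^bold>\<forall>\<^sub>N n. P (\<langle>g\<rangle> \<^bold>\<cdot> n) (\<langle>g\<rangle> \<^bold>\<cdot> nat_suc n)"
    by (rule world_allI[OF T g(3)]) (use * q g in simp)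
  ultimately show thesis using that g by blast
qed

section \<open>Terms for real numbers\<close>

lemma world_cong2:
  assumes "world T" "T \<tturnstile> \<langle>s\<rangle> \<^bold>= \<langle>s'\<rangle>" "T \<tturnstile> \<langle>t\<rangle> \<^bold>= \<langle>t'\<rangle>" "ty_of f = Some (\<sigma> \<rightarrow> \<tau> \<rightarrow> \<rho>)"
    "ty_of s = Some \<sigma>" "ty_of s' = Some \<sigma>" "ty_of t = Some \<tau>" "ty_of t' = Some \<tau>"
  shows "T \<tturnstile> \<langle>App (App f s) t\<rangle> \<^bold>= \<langle>App (App f s') t'\<rangle>"
proof -
  have "T \<tturnstile> \<langle>App (App f s) t\<rangle> \<^bold>= \<langle>App (App f s') t\<rangle>"
    using world_subst[OF assms(1,2), of "\<lambda>x. \<langle>App (App f s) t\<rangle> \<^bold>= \<langle>f\<rangle> \<^bold>\<cdot> x \<^bold>\<cdot> \<langle>t\<rangle>" \<sigma>] assms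
    by (simp add: world_refl)
  moreover have "T \<tturnstile> \<langle>App (App f s') t\<rangle> \<^bold>= \<langle>App (App f s') t'\<rangle>"
    by (rule world_cong) (use assms in simp_all)
  ultimately show ?thesis
    by (rule world_trans[OF assms(1)]) (use assms in simp_all)
qed

abbreviation "tadd s t \<equiv> App (App (Con CRAdd) s) t"
abbreviation "tneg s \<equiv> App (Con CRNeg) s"
abbreviation "tmul s t \<equiv> App (App (Con CRMul) s) t"
abbreviation "tmax s t \<equiv> App (App (Con CRMax) s) t"

abbreviation is_real :: "trm \<Rightarrow> bool" where "is_real t \<equiv> ty_of t = Some RealT"
abbreviation is_nat :: "trm \<Rightarrow> bool" where "is_nat t \<equiv> ty_of t = Some NatT"

text \<open>
  Real terms are identified when they are equal in all worlds; then identities of commutative rings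
  are proved by the simplifier.  The type is not an instance of \<open>comm_ring_1\<close>: the law
  \<open>0 \<noteq> 1\<close> would be the consistency of the formal system.
\<close>

definition real_eq :: "trm \<Rightarrow> trm \<Rightarrow> bool" where
  "real_eq s t \<longleftrightarrow> is_real s \<and> is_real t \<and> (\<forall>T. world T \<longrightarrow> (T \<tturnstile> \<langle>s\<rangle> \<^bold>= \<langle>t\<rangle>))"

lemma real_eq_refl: "is_real s \<Longrightarrow> real_eq s s"
  by (simp add: real_eq_def world_refl)

quotient_type rt = trm / partial: real_eq
proof (rule part_equivpI)
  show "\<exists>s. real_eq s s" using real_eq_refl[of "Con CRZero"] by auto
  show "symp real_eq" unfolding symp_def real_eq_def using world_sym by blast
  show "transp real_eq" unfolding transp_def real_eq_def using world_trans by blast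
qed

abbreviation rv :: "trm \<Rightarrow> rt" where "rv \<equiv> abs_rt"

lemma rv_eq_iff: "is_real s \<Longrightarrow> is_real t \<Longrightarrow> rv s = rv t \<longleftrightarrow> real_eq s t"
  using Quotient3_rel[OF Quotient3_rt, of s t] real_eq_refl by auto

lemma rv_cases:
  obtains s where "is_real s" "x = rv s"
  by (induction x rule: rt.abs_induct) (auto simp: real_eq_def)

lemma real_eq_cong:
  assumes "real_eq s s'" "real_eq t t'"
  shows "real_eq (tneg s) (tneg s')" "real_eq (tadd s t) (tadd s' t')" "real_eq (tmul s t) (tmul s' t')"
  using assms unfolding real_eq_def
  by (auto intro!: world_cong2 world_cong)

lemma world_axiom1:
  assumes "world T" "bish_axiom (all_of \<tau> F)" "par F" "ty_of s = Some \<tau>"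
  shows "T \<tturnstile> F \<langle>s\<rangle>"
  by (rule world_all[OF assms(1) world_axiom[OF assms(1,2)] assms(3,4)])

lemma world_axiom2:
  assumes "world T" "bish_axiom (all_of \<sigma> (\<lambda>x. all_of \<tau> (F x)))" "ty_of s = Some \<sigma>" "ty_of t = Some \<tau>"
    "par (\<lambda>x. all_of \<tau> (F x))" "par (F \<langle>s\<rangle>)"
  shows "T \<tturnstile> F \<langle>s\<rangle> \<langle>t\<rangle>"
  by (rule world_all[OF assms(1) world_axiom1[OF assms(1,2,5,3)] assms(6,4)])

lemma world_axiom3:
  assumes "world T" "bish_axiom (all_of \<sigma> (\<lambda>x. all_of \<tau> (\<lambda>y. all_of \<rho> (F x y))))"
    "ty_of s = Some \<sigma>" "ty_of t = Some \<tau>" "ty_of u = Some \<rho>"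
    "par (\<lambda>x. all_of \<tau> (\<lambda>y. all_of \<rho> (F x y)))" "par (\<lambda>y. all_of \<rho> (F \<langle>s\<rangle> y))" "par (F \<langle>s\<rangle> \<langle>t\<rangle>)"
  shows "T \<tturnstile> F \<langle>s\<rangle> \<langle>t\<rangle> \<langle>u\<rangle>"
  by (rule world_all[OF assms(1) world_axiom2[OF assms(1,2,3,4,6,7)] assms(8,5)])

instantiation rt :: "{comm_ring, comm_monoid_mult}"
begin

lift_definition zero_rt :: rt is "Con CRZero" by (simp add: real_eq_refl)
lift_definition one_rt :: rt is "Con CROne" by (simp add: real_eq_refl)
lift_definition plus_rt :: "rt \<Rightarrow> rt \<Rightarrow> rt" is tadd by (rule real_eq_cong)
lift_definition times_rt :: "rt \<Rightarrow> rt \<Rightarrow> rt" is tmul by (rule real_eq_cong)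
lift_definition uminus_rt :: "rt \<Rightarrow> rt" is tneg by (rule real_eq_cong)
definition minus_rt :: "rt \<Rightarrow> rt \<Rightarrow> rt" where "x - y = x + - y" for x :: rt

lemma rv_simps:
  "0 = rv (Con CRZero)" "1 = rv (Con CROne)"
  "is_real s \<Longrightarrow> is_real t \<Longrightarrow> rv s + rv t = rv (tadd s t)"
  "is_real s \<Longrightarrow> is_real t \<Longrightarrow> rv s * rv t = rv (tmul s t)"
  "is_real s \<Longrightarrow> - rv s = rv (tneg s)"
  by (simp_all add: zero_rt_def one_rt_def plus_rt.abs_eq times_rt.abs_eq uminus_rt.abs_eq real_eq_refl)

instance
proof
  fix a b c :: rt
  obtain r s t where ty: "is_real r" "is_real s" "is_real t" and [simp]: "a = rv r" "b = rv s" "c = rv t"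
    by (metis rv_cases)
  note simps = rv_simps rv_eq_iff real_eq_def ty
  show "a + b + c = a + (b + c)"
    using world_axiom3[OF _ add_assoc ty] by (simp add: simps)
  show "a + b = b + a"
    using world_axiom2[OF _ add_commute ty(1,2)] by (simp add: simps)
  show "0 + a = a"
    using world_axiom1[OF _ add_zero _ ty(1)] world_axiom2[OF _ add_commute _ ty(1), of _ "Con CRZero"]
      world_trans[of _ "tadd (Con CRZero) r" "tadd r (Con CRZero)" r] by (simp add: simps)
  show "- a + a = 0"
    using world_axiom1[OF _ add_neg _ ty(1)] world_axiom2[OF _ add_commute _ ty(1), of _ "tneg r"]
      world_trans[of _ "tadd (tneg r) r" "tadd r (tneg r)" "Con CRZero"] ty by (simp add: simps cst_con)
  show "a - b = a + - b" by (simp add: minus_rt_def)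
  show "a * b * c = a * (b * c)"
    using world_axiom3[OF _ mul_assoc ty] by (simp add: simps)
  show comm: "a * b = b * a" for a b :: rt
    using world_axiom2[OF _ mul_commute] by (cases a rule: rv_cases; cases b rule: rv_cases) (simp add: simps)
  have one: "a * 1 = a" 
    using world_axiom1[OF _ mul_one _ ty(1)] by (simp add: simps)
  then show "1 * a = a" by (simp only: comm[of 1])
  have d: "c * (a + b) = c * a + c * b"
    using world_axiom3[OF _ distrib ty(3,1,2)] by (simp add: simps)
  then show "(a + b) * c = a * c + b * c" by (simp only: comm[of _ c])
qed

end

lemmas rv_ops = rv_simps[symmetric]

section \<open>Order and equality of reals in one world\<close>

text \<open>The conjunct \<open>world T\<close> makes the relation independent of representatives,
  since \<open>real_eq\<close> says nothing about sets of formulas that are not worlds.\<close>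

lift_definition lt :: "fm set \<Rightarrow> rt \<Rightarrow> rt \<Rightarrow> bool" is "\<lambda>T s t. world T \<and> (T \<tturnstile> \<langle>s\<rangle> \<^bold>< \<langle>t\<rangle>)"
proof -
  fix T s s' t t'
  have *: "T \<tturnstile> \<langle>s'\<rangle> \<^bold>< \<langle>t'\<rangle>" if "world T" "T \<tturnstile> \<langle>s\<rangle> \<^bold>< \<langle>t\<rangle>" "real_eq s s'" "real_eq t t'" for s s' t t'
  proof -
    have "T \<tturnstile> \<langle>s'\<rangle> \<^bold>< \<langle>t\<rangle>"
      by (rule world_subst[of T s s' "\<lambda>x. x \<^bold>< \<langle>t\<rangle>" RealT]) (use that in \<open>auto simp: real_eq_def\<close>)
    then show ?thesis
      by (intro world_subst[of T t t' "\<lambda>x. \<langle>s'\<rangle> \<^bold>< x" RealT]) (use that in \<open>auto simp: real_eq_def\<close>)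
  qed
  assume "real_eq s s'" "real_eq t t'"
  moreover from this have "real_eq s' s" "real_eq t' t"
    unfolding real_eq_def using world_sym by blast+
  ultimately show "(world T \<and> (T \<tturnstile> \<langle>s\<rangle> \<^bold>< \<langle>t\<rangle>)) = (world T \<and> (T \<tturnstile> \<langle>s'\<rangle> \<^bold>< \<langle>t'\<rangle>))"
    using * by blast
qed

lemma lt_rv: "world T \<Longrightarrow> is_real s \<Longrightarrow> is_real t \<Longrightarrow> lt T (rv s) (rv t) \<longleftrightarrow> (T \<tturnstile> \<langle>s\<rangle> \<^bold>< \<langle>t\<rangle>)"
  by (simp add: lt.abs_eq real_eq_refl)

lemma holds_less_iff:
  "world T \<Longrightarrow> is_real (s 0) \<Longrightarrow> is_real (t 0) \<Longrightarrow> (T \<tturnstile> s \<^bold>< t) \<longleftrightarrow> lt T (rv (s 0)) (rv (t 0))"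
  by (simp add: lt_rv holds_less[of T s t])

text \<open>
  This is implied by the truth of the formula \<open>x \<le> y\<close> in \<open>T\<close>, but does not imply it: the formula
  \<open>y < x\<close> may be true in larger worlds.
\<close>

definition le :: "fm set \<Rightarrow> rt \<Rightarrow> rt \<Rightarrow> bool" where
  "le T x y \<longleftrightarrow> \<not> lt T y x"

context
  fixes T
  assumes T: "world T"
begin

lemma lt_asym: "lt T x y \<Longrightarrow> le T x y"
proof -
  obtain s t where [simp]: "x = rv s" "is_real s" "y = rv t" "is_real t" by (metis rv_cases)
  have "\<not> (T \<tturnstile> \<langle>s\<rangle> \<^bold>< \<langle>t\<rangle> \<^bold>\<and> \<langle>t\<rangle> \<^bold>< \<langle>s\<rangle>)"
    by (rule world_not[OF T world_axiom2[OF T less_asym]]) simp_all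
  then show "lt T x y \<Longrightarrow> le T x y" using T by (simp add: le_def lt_rv)
qed

lemma lt_cotrans: "lt T x y \<Longrightarrow> lt T x z \<or> lt T z y"
proof -
  obtain s t u where [simp]: "x = rv s" "is_real s" "y = rv t" "is_real t" "z = rv u" "is_real u"
    by (metis rv_cases)
  have "T \<tturnstile> \<langle>s\<rangle> \<^bold>< \<langle>t\<rangle> \<^bold>\<longrightarrow> \<langle>s\<rangle> \<^bold>< \<langle>u\<rangle> \<^bold>\<or> \<langle>u\<rangle> \<^bold>< \<langle>t\<rangle>"
    by (rule world_axiom3[OF T less_cotrans]) simp_all
  from world_mp[OF T this] show "lt T x y \<Longrightarrow> lt T x z \<or> lt T z y" using T by (simp add: lt_rv)
qed

lemma lt_add: "lt T x y \<Longrightarrow> lt T (x + z) (y + z)"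
proof -
  obtain s t u where [simp]: "x = rv s" "is_real s" "y = rv t" "is_real t" "z = rv u" "is_real u"
    by (metis rv_cases)
  have "T \<tturnstile> \<langle>s\<rangle> \<^bold>< \<langle>t\<rangle> \<^bold>\<longrightarrow> \<langle>s\<rangle> \<^bold>+ \<langle>u\<rangle> \<^bold>< \<langle>t\<rangle> \<^bold>+ \<langle>u\<rangle>"
    by (rule world_axiom3[OF T less_add]) simp_all
  from world_mp[OF T this] show "lt T x y \<Longrightarrow> lt T (x + z) (y + z)" using T by (simp add: lt_rv rv_simps)
qed

lemma lt_mul: "lt T 0 x \<Longrightarrow> lt T 0 y \<Longrightarrow> lt T 0 (x * y)"
proof -
  obtain s t where [simp]: "x = rv s" "is_real s" "y = rv t" "is_real t" by (metis rv_cases)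
  have "T \<tturnstile> \<^bold>0 \<^bold>< \<langle>s\<rangle> \<^bold>\<and> \<^bold>0 \<^bold>< \<langle>t\<rangle> \<^bold>\<longrightarrow> \<^bold>0 \<^bold>< \<langle>s\<rangle> \<^bold>* \<langle>t\<rangle>"
    by (rule world_axiom2[OF T mul_pos]) simp_all
  from world_mp[OF T this] show "lt T 0 x \<Longrightarrow> lt T 0 y \<Longrightarrow> lt T 0 (x * y)"
    using T by (simp add: lt_rv rv_simps cst_con)
qed

lemma lt_zero_one: "lt T 0 1"
  using world_axiom[OF T zero_less_one] T by (simp add: lt_rv rv_simps cst_con)

lemma lt_irrefl: "\<not> lt T x x"
  using lt_asym[of x x] by (auto simp: le_def)

lemma lt_trans: "lt T x y \<Longrightarrow> lt T y z \<Longrightarrow> lt T x z"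
  using lt_cotrans[of x y z] lt_asym[of y z] by (auto simp: le_def)

lemma le_lt_trans: "le T x y \<Longrightarrow> lt T y z \<Longrightarrow> lt T x z"
  using lt_cotrans[of y z x] by (auto simp: le_def)

lemma lt_le_trans: "lt T x y \<Longrightarrow> le T y z \<Longrightarrow> lt T x z"
  using lt_cotrans[of x y z] by (auto simp: le_def)

lemma le_trans: "le T x y \<Longrightarrow> le T y z \<Longrightarrow> le T x z"
  using lt_cotrans[of z x y] by (auto simp: le_def)

lemma lt_iff_diff: "lt T x y \<longleftrightarrow> lt T 0 (y - x)"
  using lt_add[of x y "- x"] lt_add[of 0 "y - x" x] by auto

lemma le_iff_diff: "le T x y \<longleftrightarrow> le T 0 (y - x)"
  using lt_iff_diff[of y x] lt_iff_diff[of "y - x" 0] by (simp add: le_def)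

lemma ltD: "lt T x y \<Longrightarrow> lt T 0 (y - x)" and leD: "le T x y \<Longrightarrow> le T 0 (y - x)"
  using lt_iff_diff le_iff_diff by blast+

lemma ltI: "lt T 0 z \<Longrightarrow> z = y - x \<Longrightarrow> lt T x y" and leI: "le T 0 z \<Longrightarrow> z = y - x \<Longrightarrow> le T x y"
  using lt_iff_diff le_iff_diff by blast+

lemma le_refl: "le T x x"
  using lt_irrefl by (simp add: le_def)

lemma lt_imp_le: "lt T x y \<Longrightarrow> le T x y"
  by (rule lt_asym)

lemma pos_add: "lt T 0 x \<Longrightarrow> lt T 0 y \<Longrightarrow> lt T 0 (x + y)"
  using lt_add[of 0 x y] lt_trans by auto

lemma pos_add_nonneg: "lt T 0 x \<Longrightarrow> le T 0 y \<Longrightarrow> lt T 0 (x + y)"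
  using lt_add[of 0 x y] le_lt_trans by auto

lemma pos_add_cases: "lt T 0 (x + y) \<Longrightarrow> lt T 0 x \<or> lt T 0 y"
  using lt_cotrans[of 0 "x + y" x] lt_iff_diff[of x "x + y"] by auto

lemma pos_double: "lt T 0 (x + x) \<longleftrightarrow> lt T 0 x"
  using pos_add pos_add_cases by blast

end

text \<open>Equality in one world, as opposed to HOL equality on \<open>rt\<close>, which means
  equality in all worlds. Inverses and limits satisfy their equations only in worlds where the
  relevant hypotheses hold.\<close>

lift_definition eqr :: "fm set \<Rightarrow> rt \<Rightarrow> rt \<Rightarrow> bool" is "\<lambda>T s t. world T \<and> (T \<tturnstile> \<langle>s\<rangle> \<^bold>= \<langle>t\<rangle>)"
  unfolding real_eq_def using world_sym world_trans by meson

lemma eqr_rv: "world T \<Longrightarrow> is_real s \<Longrightarrow> is_real t \<Longrightarrow> eqr T (rv s) (rv t) \<longleftrightarrow> (T \<tturnstile> \<langle>s\<rangle> \<^bold>= \<langle>t\<rangle>)"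
  by (simp add: eqr.abs_eq real_eq_refl)

lemma holds_eqr_iff:
  "world T \<Longrightarrow> is_real (s 0) \<Longrightarrow> is_real (t 0) \<Longrightarrow> (T \<tturnstile> s \<^bold>= t) \<longleftrightarrow> eqr T (rv (s 0)) (rv (t 0))"
  by (simp add: eqr_rv holds_eq[of T s t])

lemmas ev = holds_less_iff holds_eqr_iff cst_con rv_ops

lemma rv_diff [simp]: "is_real s \<Longrightarrow> is_real t \<Longrightarrow> rv (tadd s (tneg t)) = rv s - rv t"
  by (simp add: rv_ops)

context
  fixes T
  assumes T: "world T"
begin

lemma eqr_sym: "eqr T x y \<Longrightarrow> eqr T y x"
proof -
  obtain s t where [simp]: "x = rv s" "is_real s" "y = rv t" "is_real t" by (metis rv_cases)
  show "eqr T x y \<Longrightarrow> eqr T y x" using world_sym[OF T, of s t] T by (simp add: eqr_rv)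
qed

lemma eqr_mul: "eqr T x y \<Longrightarrow> eqr T (z * x) (z * y)"
proof -
  obtain s t u where [simp]: "x = rv s" "is_real s" "y = rv t" "is_real t" "z = rv u" "is_real u"
    by (metis rv_cases)
  show "eqr T x y \<Longrightarrow> eqr T (z * x) (z * y)"
    using world_cong[OF T, of s t "App (Con CRMul) u"] T by (simp add: eqr_rv rv_simps)
qed

lemma eqr_le: "eqr T x y \<Longrightarrow> le T x y"
proof -
  obtain s t where [simp]: "x = rv s" "is_real s" "y = rv t" "is_real t" by (metis rv_cases)
  assume "eqr T x y"
  then have e: "T \<tturnstile> \<langle>s\<rangle> \<^bold>= \<langle>t\<rangle>" using T by (simp add: eqr_rv)
  have "T \<tturnstile> \<langle>t\<rangle> \<^bold>< \<langle>t\<rangle>" if "T \<tturnstile> \<langle>t\<rangle> \<^bold>< \<langle>s\<rangle>"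
    by (rule world_subst[OF T e, of "\<lambda>x. \<langle>t\<rangle> \<^bold>< x"]) (use that in simp_all)
  then show "le T x y" using T lt_irrefl[OF T, of y] by (auto simp: le_def lt_rv)
qed

lemma holds_leD: "T \<tturnstile> s \<^bold>\<le> t \<Longrightarrow> is_real (s 0) \<Longrightarrow> is_real (t 0) \<Longrightarrow> le T (rv (s 0)) (rv (t 0))"
  using world_not[OF T, of "t \<^bold>< s"] T by (simp add: le_fm_def le_def holds_less_iff)

lemma holds_leI:
  assumes "T \<tturnstile> H" "\<And>T'. world T' \<Longrightarrow> T' \<tturnstile> H \<Longrightarrow> le T' (rv (s 0)) (rv (t 0))"
    "is_real (s 0)" "is_real (t 0)"
  shows "T \<tturnstile> s \<^bold>\<le> t"
  unfolding le_fm_def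
  by (rule world_notI[OF T assms(1)]) (use assms in \<open>auto simp: le_def holds_less_iff\<close>)

text \<open>The premise of the tightness axiom is a negation, so neither strict inequality may hold
  in any world with \<open>H\<close>; excluding them in \<open>T\<close> alone would not
  suffice.\<close>

lemma tight: 
  assumes "T \<tturnstile> H" "is_real s" "is_real t"
    "\<And>T'. world T' \<Longrightarrow> T' \<tturnstile> H \<Longrightarrow> le T' (rv s) (rv t)"
    "\<And>T'. world T' \<Longrightarrow> T' \<tturnstile> H \<Longrightarrow> le T' (rv t) (rv s)"
  shows "T \<tturnstile> \<langle>s\<rangle> \<^bold>= \<langle>t\<rangle>"
proof -
  have "T \<tturnstile> \<^bold>\<not> (\<langle>s\<rangle> \<^bold>< \<langle>t\<rangle> \<^bold>\<or> \<langle>t\<rangle> \<^bold>< \<langle>s\<rangle>)"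
    by (rule world_notI[OF T assms(1)]) (use assms in \<open>auto simp: le_def lt_rv\<close>)
  moreover have "T \<tturnstile> \<^bold>\<not> (\<langle>s\<rangle> \<^bold>< \<langle>t\<rangle> \<^bold>\<or> \<langle>t\<rangle> \<^bold>< \<langle>s\<rangle>) \<^bold>\<longrightarrow> \<langle>s\<rangle> \<^bold>= \<langle>t\<rangle>"
    by (rule world_axiom2[OF T less_tight]) (use assms in simp_all)
  ultimately show ?thesis using world_mp[OF T] by blast
qed

abbreviation (input) "rnat n \<equiv> rv (App (Con CROfNat) n)"

lemma rnat_0: "eqr T (rnat (Con CNZero)) 0"
  using world_axiom[OF T of_nat_zero] T by (simp add: ev)

lemma rnat_Suc: "is_nat n \<Longrightarrow> eqr T (rnat (App (Con CNSuc) n)) (rnat n + 1)"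
  using world_axiom1[OF T of_nat_suc, of n] T by (simp add: ev)

lemma archimedes: obtains n where "is_nat n" "lt T x (rnat n)"
proof -
  obtain s where [simp]: "x = rv s" "is_real s" by (metis rv_cases)
  have "T \<tturnstile> \<^bold>\<exists>\<^sub>N n. \<langle>s\<rangle> \<^bold>< real_of n"
    by (rule world_axiom1[OF T archimedean]) simp_all
  then obtain n where "is_nat n" "T \<tturnstile> \<langle>s\<rangle> \<^bold>< real_of \<langle>n\<rangle>"
    by (rule world_exE[OF T]) simp_all
  with that T show thesis by (simp add: ev)
qed

lemma less_max_iff:
  assumes "is_real s" "is_real t"
  shows "lt T z (rv (tmax s t)) \<longleftrightarrow> lt T z (rv s) \<or> lt T z (rv t)"
proof -
  obtain u where [simp]: "z = rv u" "is_real u" by (metis rv_cases)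
  have "T \<tturnstile> \<langle>u\<rangle> \<^bold>< real_max \<langle>s\<rangle> \<langle>t\<rangle> \<^bold>\<longleftrightarrow> \<langle>u\<rangle> \<^bold>< \<langle>s\<rangle> \<^bold>\<or> \<langle>u\<rangle> \<^bold>< \<langle>t\<rangle>"
    by (rule world_axiom3[OF T less_max]) (use assms in simp_all)
  then show ?thesis
    using T assms world_mp[OF T, of "\<langle>u\<rangle> \<^bold>< \<langle>tmax s t\<rangle>" "\<langle>u\<rangle> \<^bold>< \<langle>s\<rangle> \<^bold>\<or> \<langle>u\<rangle> \<^bold>< \<langle>t\<rangle>"]
      world_mp[OF T, of "\<langle>u\<rangle> \<^bold>< \<langle>s\<rangle> \<^bold>\<or> \<langle>u\<rangle> \<^bold>< \<langle>t\<rangle>" "\<langle>u\<rangle> \<^bold>< \<langle>tmax s t\<rangle>"]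
    by (auto simp: iff_fm_def lt_rv)
qed

text \<open>The axiom determines the maximum by what lies below it. If both arguments were smaller
  than the maximum, applying the axiom to each would give \<open>s < t\<close> and
  \<open>t < s\<close>; so one argument is at least the maximum.\<close>

lemma max_less_iff:
  assumes "is_real s" "is_real t"
  shows "lt T (rv (tmax s t)) z \<longleftrightarrow> lt T (rv s) z \<and> lt T (rv t) z"
proof
  have "le T (rv s) (rv (tmax s t))" "le T (rv t) (rv (tmax s t))"
    using less_max_iff[OF assms, of "rv (tmax s t)"] lt_irrefl[OF T] by (auto simp: le_def)
  then show "lt T (rv (tmax s t)) z \<Longrightarrow> lt T (rv s) z \<and> lt T (rv t) z"
    using le_lt_trans[OF T] by blast
next
  assume a: "lt T (rv s) z \<and> lt T (rv t) z"
  have "\<not> lt T (rv s) (rv (tmax s t)) \<or> \<not> lt T (rv t) (rv (tmax s t))"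
    using less_max_iff[OF assms] lt_irrefl[OF T] lt_asym[OF T] by (auto simp: le_def)
  then show "lt T (rv (tmax s t)) z" using a le_lt_trans[OF T] by (auto simp: le_def)
qed

lemma eqr_inverse:
  assumes "lt T 0 (rv x)" "is_real x"
  obtains w where "is_real w" "eqr T (rv x * rv w) 1"
proof -
  have "T \<tturnstile> \<langle>x\<rangle> \<^bold>< \<^bold>0 \<^bold>\<or> \<^bold>0 \<^bold>< \<langle>x\<rangle> \<^bold>\<longrightarrow> (\<^bold>\<exists>\<^sub>R y. \<langle>x\<rangle> \<^bold>* y \<^bold>= \<^bold>1)"
    by (rule world_axiom1[OF T inverse]) (use assms in simp_all)
  from world_mp[OF T this] have "T \<tturnstile> \<^bold>\<exists>\<^sub>R y. \<langle>x\<rangle> \<^bold>* y \<^bold>= \<^bold>1"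
    using assms T by (simp add: ev)
  then obtain w where "is_real w" "T \<tturnstile> \<langle>x\<rangle> \<^bold>* \<langle>w\<rangle> \<^bold>= \<^bold>1"
    by (rule world_exE[OF T]) (use assms in simp_all)
  with that T assms show thesis by (simp add: ev)
qed

end

text \<open>The formula carried to larger worlds when no hypothesis is to be kept.\<close>

definition verum :: form where "verum = (\<^bold>\<bottom> \<^bold>\<longrightarrow> \<^bold>\<bottom>)"

lemma holds_verum: "world T \<Longrightarrow> T \<tturnstile> verum"
  using world_closed[of T "[]" "FImp FBot FBot"]
  by (simp add: holds_def verum_def imp_fm_def bot_def ImpI Assm)

section \<open>Signs of inverses and products\<close>

lemma eqr_mul_zero: "world T \<Longrightarrow> eqr T x 0 \<Longrightarrow> eqr T (x * y) 0"
  using eqr_mul[of T x 0 y] by (simp add: mult.commute)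

text \<open>Induction on \<open>n\<close>: a positive sum \<open>n w + w\<close> has a positive
  summand. This special cancellation law precedes \<open>pos_mulD\<close>, which rests on inverses
  being positive.\<close>

lemma rnat_mul_pos:
  assumes T: "world T" and n: "is_nat n" and w: "is_real w" and pos: "lt T 0 (rnat n * rv w)"
  shows "lt T 0 (rv w)"
proof -
  have "T \<tturnstile> \<^bold>0 \<^bold>< real_of \<langle>n\<rangle> \<^bold>* \<langle>w\<rangle> \<^bold>\<longrightarrow> \<^bold>0 \<^bold>< \<langle>w\<rangle>"
  proof (rule world_induct[OF T holds_verum[OF T], of "\<lambda>n. \<^bold>0 \<^bold>< real_of n \<^bold>* \<langle>w\<rangle> \<^bold>\<longrightarrow> \<^bold>0 \<^bold>< \<langle>w\<rangle>"])
    show "T \<tturnstile> \<^bold>0 \<^bold>< real_of \<langle>Con CNZero\<rangle> \<^bold>* \<langle>w\<rangle> \<^bold>\<longrightarrow> \<^bold>0 \<^bold>< \<langle>w\<rangle>"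
    proof (rule world_impI[OF T holds_verum[OF T]])
      fix T' assume T': "world T'" "T' \<tturnstile> \<^bold>0 \<^bold>< real_of \<langle>Con CNZero\<rangle> \<^bold>* \<langle>w\<rangle>"
      then have "lt T' 0 (rnat (Con CNZero) * rv w)" using w by (simp add: ev)
      moreover have "le T' (rnat (Con CNZero) * rv w) 0"
        by (intro eqr_le eqr_mul_zero rnat_0 T'(1))
      ultimately show "T' \<tturnstile> \<^bold>0 \<^bold>< \<langle>w\<rangle>" by (simp add: le_def)
    qed
  next
    fix T' n
    assume T': "world T'" "is_nat n" "T' \<tturnstile> \<^bold>0 \<^bold>< real_of \<langle>n\<rangle> \<^bold>* \<langle>w\<rangle> \<^bold>\<longrightarrow> \<^bold>0 \<^bold>< \<langle>w\<rangle>"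
    show "T' \<tturnstile> \<^bold>0 \<^bold>< real_of \<langle>App (Con CNSuc) n\<rangle> \<^bold>* \<langle>w\<rangle> \<^bold>\<longrightarrow> \<^bold>0 \<^bold>< \<langle>w\<rangle>"
    proof (rule world_impI[OF T'(1,3)])
      fix T'' assume *: "world T''" "T'' \<tturnstile> \<^bold>0 \<^bold>< real_of \<langle>n\<rangle> \<^bold>* \<langle>w\<rangle> \<^bold>\<longrightarrow> \<^bold>0 \<^bold>< \<langle>w\<rangle>"
        "T'' \<tturnstile> \<^bold>0 \<^bold>< real_of \<langle>App (Con CNSuc) n\<rangle> \<^bold>* \<langle>w\<rangle>"
      then have "lt T'' 0 (rnat (App (Con CNSuc) n) * rv w)" using T'(2) w by (simp add: ev)
      moreover have "le T'' (rnat (App (Con CNSuc) n) * rv w) (rnat n * rv w + rv w)"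
        using eqr_le[OF *(1) eqr_mul[OF *(1) rnat_Suc[OF *(1) T'(2)], of "rv w"]]
        by (simp add: algebra_simps)
      ultimately have "lt T'' 0 (rnat n * rv w) \<or> lt T'' 0 (rv w)"
        using *(1) lt_le_trans pos_add_cases by blast
      then show "T'' \<tturnstile> \<^bold>0 \<^bold>< \<langle>w\<rangle>"
        using world_mp[OF *(1,2)] *(1) T'(2) w by (auto simp: ev)
    qed
  qed (use assms in simp_all)
  from world_mp[OF T this] show ?thesis using assms by (simp add: ev)
qed

text \<open>
  The inverse of \<open>x > 0\<close> is not negative and, by tightness, not non-positive; for \<open>x < n\<close> this gives
  \<open>n w \<ge> x w = 1\<close>, and a positive multiple of \<open>w\<close> makes \<open>w\<close> positive.
\<close>

lemma inverse_pos:
  assumes T: "world T" and ty: "is_real x" "is_real w" and pos: "lt T 0 (rv x)" and inv: "eqr T (rv x * rv w) 1"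
  shows "lt T 0 (rv w)"
proof -
  obtain n where n: "is_nat n" "lt T (rv x) (rnat n)" using archimedes[OF T] by blast
  define H where "H = (\<^bold>0 \<^bold>< \<langle>x\<rangle> \<^bold>\<and> \<langle>x\<rangle> \<^bold>* \<langle>w\<rangle> \<^bold>= \<^bold>1 \<^bold>\<and> \<langle>x\<rangle> \<^bold>< real_of \<langle>n\<rangle>)"
  have H: "(T' \<tturnstile> H) \<longleftrightarrow> lt T' 0 (rv x) \<and> eqr T' (rv x * rv w) 1 \<and> lt T' (rv x) (rnat n)" if "world T'" for T'
    using that ty n by (simp add: H_def ev)
  have nonneg: "le T' 0 (rv w)" if T': "world T'" "T' \<tturnstile> H" for T'
  proof (rule ccontr)
    assume "\<not> ?thesis"
    then have "lt T' 0 (- rv w)" using ltD[OF T'(1), of "rv w" 0] by (simp add: le_def)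
    then have "lt T' 0 (rv x * - rv w)" using lt_mul[OF T'(1)] H T' by blast
    moreover have "le T' 1 (rv x * rv w)" using eqr_le eqr_sym H T' by blast
    ultimately have "lt T' 0 (- 1)"
      using pos_add_nonneg[OF T'(1) _ leD[OF T'(1)], of "rv x * - rv w" 1 "rv x * rv w"] by simp
    then show False using pos_add[OF T'(1) _ lt_zero_one[OF T'(1)], of "-1"] lt_irrefl[OF T'(1)] by simp
  qed
  have "le T' 1 (rnat n * rv w)" if T': "world T'" "T' \<tturnstile> H" for T'
  proof (rule ccontr)
    assume "\<not> ?thesis"
    then have less: "lt T' (rnat n * rv w) 1" by (simp add: le_def)
    let ?H = "H \<^bold>\<and> real_of \<langle>n\<rangle> \<^bold>* \<langle>w\<rangle> \<^bold>< \<^bold>1"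
    have h: "T' \<tturnstile> ?H" using T' less ty n by (simp add: ev)
    have z: "le T'' (rv w) 0" if T'': "world T''" "T'' \<tturnstile> ?H" for T''
    proof (rule ccontr)
      assume "\<not> ?thesis"
      then have w: "lt T'' 0 (rv w)" by (simp add: le_def)
      have h: "lt T'' (rv x) (rnat n)" "lt T'' (rnat n * rv w) 1" "le T'' 1 (rv x * rv w)"
        using T'' H ty n eqr_le[OF T''(1) eqr_sym] by (simp_all add: ev)
      \<comment> \<open>The three summands cancel to 0. Most order arguments below have this form: a
        sum of positive and non-negative terms that the ring laws identify with the desired
        difference or with 0.\<close>
      have "lt T'' 0 ((rnat n - rv x) * rv w + (1 - rnat n * rv w) + (rv x * rv w - 1))"
        using T'' h w by (intro pos_add_nonneg pos_add lt_mul ltD leD)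
      then show False using lt_irrefl[OF T''(1), of 0] by (simp add: algebra_simps)
    qed
    \<comment> \<open>Under the assumption \<open>n w < 1\<close>, the inverse is both non-negative
      and non-positive in all worlds that keep the hypotheses; but \<open>w = 0\<close> contradicts
      \<open>x w = 1\<close>.\<close>
    have "T' \<tturnstile> \<langle>w\<rangle> \<^bold>= \<langle>Con CRZero\<rangle>"
      by (rule tight[OF T'(1) h]) (use ty z nonneg in \<open>simp_all add: ev\<close>)
    then have "eqr T' (rv w * rv x) 0" using T' ty by (intro eqr_mul_zero) (simp_all add: ev)
    moreover have "eqr T' 1 (rv w * rv x)" using H T' eqr_sym by (simp add: mult.commute)
    ultimately have "le T' 1 0" using eqr_le[OF T'(1)] le_trans[OF T'(1)] by blast
    then show False using lt_zero_one[OF T'(1)] by (simp add: le_def)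
  qed
  moreover have "T \<tturnstile> H" using H T pos inv n by simp
  ultimately have "T \<tturnstile> \<^bold>1 \<^bold>\<le> real_of \<langle>n\<rangle> \<^bold>* \<langle>w\<rangle>"
    by (intro holds_leI[OF T, of H]) (simp_all add: ev ty n)
  from holds_leD[OF T this] have "le T 1 (rnat n * rv w)" using ty n by (simp add: ev)
  then show ?thesis
    using rnat_mul_pos[OF T n(1) ty(2)] lt_le_trans[OF T lt_zero_one[OF T]] by blast
qed

lemma inverse_ex:
  assumes T: "world T" and x: "lt T 0 (rv x)" "is_real x"
  obtains w where "is_real w" "lt T 0 (rv w)" "eqr T (rv x * rv w) 1"
  using eqr_inverse[OF T x] inverse_pos[OF T x(2)] x by blast

text \<open>
  If \<open>- x y > 0\<close> and \<open>- M < y < M\<close>, then \<open>x\<close> cannot lie between \<open>x y / M\<close> and \<open>- x y / M\<close>.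
\<close>

lemma nonzero_factor:
  assumes T: "world T" and neg: "lt T 0 (- (x * y))"
  shows "lt T 0 x \<or> lt T 0 (- x)"
proof (rule ccontr)
  assume contra: "\<not> ?thesis"
  \<comment> \<open>A strict bound for the absolute value of \<open>y\<close>, positive in either
    case. The case distinction is about truth in the world \<open>T\<close>.\<close>
  define M where "M = (if lt T 0 y then 1 + y else 1 - y)"
  have one: "lt T 0 1" using lt_zero_one[OF T] .
  have M: "lt T 0 M" "lt T 0 (M - y)" "lt T 0 (M + y)"
  proof -
    have "le T 0 (- y)" if "\<not> lt T 0 y" using that leD[OF T, of y 0] by (simp add: le_def)
    then have "lt T 0 (1 + (- y))" "lt T 0 (1 + (- y) + (- y))" if "\<not> lt T 0 y"
      using that one T by (metis pos_add_nonneg)+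
    then show "lt T 0 M" "lt T 0 (M - y)" "lt T 0 (M + y)"
      using one pos_add[OF T] by (auto simp: M_def algebra_simps)
  qed
  obtain m where m: "M = rv m" "is_real m" by (metis rv_cases)
  obtain v where v: "is_real v" "lt T 0 (rv v)" "eqr T (M * rv v) 1"
    using inverse_ex[OF T, of m] M m by metis
  define e where "e = - (x * y) * rv v"
  have e: "lt T 0 e" unfolding e_def by (rule lt_mul[OF T neg v(2)])
  have "lt T x e" "lt T (- x) e"
    using contra lt_cotrans[OF T e, of x] lt_cotrans[OF T e, of "- x"] by auto
  then have "lt T 0 (e - x)" "lt T 0 (e + x)" using ltD[OF T] by (metis diff_minus_eq_add)+
  \<comment> \<open>The products combine to \<open>2 (e M + x y)\<close>, and
    \<open>e M = - (x y)\<close> by the choice of \<open>e\<close>, so a positive number would be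
    zero.\<close>
  then have "lt T 0 ((e + x) * (M + y) + (e - x) * (M - y))"
    using pos_add[OF T lt_mul[OF T _ M(3)] lt_mul[OF T _ M(2)]] by blast
  then have "lt T 0 ((e * M + x * y) + (e * M + x * y))" by (simp add: algebra_simps)
  then have "lt T 0 (e * M + x * y)" using pos_double[OF T] by blast
  moreover have "eqr T (e * M) (- (x * y))"
    using eqr_mul[OF T v(3), of "- (x * y)"] by (simp add: e_def algebra_simps)
  ultimately have "lt T 0 ((e * M + x * y) + (- (x * y) - e * M))"
    using pos_add_nonneg[OF T _ leD[OF T eqr_le[OF T]]] by blast
  then show False using lt_irrefl[OF T] by simp
qed

text \<open>Here \<open>le\<close> only denies the opposite strict inequality, so the signs of the
  factors are unknown. A negative product would make each factor nonzero by
  \<open>nonzero_factor\<close>, hence positive, and then the product would be positive.\<close>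

lemma nonneg_mul:
  assumes T: "world T" and x: "le T 0 x" and y: "le T 0 y"
  shows "le T 0 (x * y)"
proof (rule ccontr)
  assume "\<not> ?thesis"
  then have neg: "lt T 0 (- (x * y))" using ltD[OF T, of "x * y" 0] by (simp add: le_def)
  have "\<not> lt T 0 (- x)" "\<not> lt T 0 (- y)"
    using x y lt_iff_diff[OF T, of x 0] lt_iff_diff[OF T, of y 0] by (simp_all add: le_def)
  then have "lt T 0 x" "lt T 0 y"
    using nonzero_factor[OF T neg] nonzero_factor[OF T, of y x] neg by (simp_all add: mult.commute)
  then have "lt T 0 (x * y + - (x * y))" using pos_add[OF T lt_mul[OF T] neg] by blast
  then show False using lt_irrefl[OF T] by simp
qed

text \<open>Otherwise \<open>x * - y\<close> would be non-negative, and adding it to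
  \<open>x * y\<close> would make 0 positive.\<close>

lemma pos_mulD:
  assumes T: "world T" and x: "le T 0 x" and xy: "lt T 0 (x * y)"
  shows "lt T 0 y"
proof (rule ccontr)
  assume "\<not> ?thesis"
  then have "le T 0 (- y)" using leD[OF T, of y 0] by (simp add: le_def)
  then have "lt T 0 (x * y + x * - y)" using pos_add_nonneg[OF T xy nonneg_mul[OF T x]] by blast
  then show False using lt_irrefl[OF T] by simp
qed

section \<open>Rules for bounded quantifiers and natural numbers\<close>

lemma world_all_impI:
  assumes "world T" "T \<tturnstile> H" "par A" "par B"
    "\<And>T' x. world T' \<Longrightarrow> T' \<tturnstile> H \<Longrightarrow> ty_of x = Some \<tau> \<Longrightarrow> T' \<tturnstile> A \<langle>x\<rangle> \<Longrightarrow> T' \<tturnstile> B \<langle>x\<rangle>"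
  shows "T \<tturnstile> all_of \<tau> (\<lambda>x. A x \<^bold>\<longrightarrow> B x)"
proof (rule world_allI[OF assms(1,2)])
  show "par (\<lambda>x. A x \<^bold>\<longrightarrow> B x)" using assms(3,4) by (simp add: par_def)
  show "T' \<tturnstile> A \<langle>x\<rangle> \<^bold>\<longrightarrow> B \<langle>x\<rangle>" if "world T'" "T' \<tturnstile> H" "ty_of x = Some \<tau>" for T' x
    by (rule world_impI[of T' "H"]) (use assms(5) that in auto)
qed

lemma world_all_impD:
  assumes "world T" "T \<tturnstile> all_of \<tau> (\<lambda>x. A x \<^bold>\<longrightarrow> B x)" "T \<tturnstile> A \<langle>t\<rangle>" "ty_of t = Some \<tau>"
    "par (\<lambda>x. A x \<^bold>\<longrightarrow> B x)"
  shows "T \<tturnstile> B \<langle>t\<rangle>"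
  using world_mp[OF assms(1) world_all[OF assms(1,2,5,4)] assms(3)] .

lemma world_all2_impI:
  assumes "world T" "T \<tturnstile> H"
    "\<And>T' x y. world T' \<Longrightarrow> T' \<tturnstile> H \<Longrightarrow> ty_of x = Some \<sigma> \<Longrightarrow> ty_of y = Some \<tau> \<Longrightarrow> T' \<tturnstile> A \<langle>x\<rangle> \<langle>y\<rangle> \<Longrightarrow>
      T' \<tturnstile> B \<langle>x\<rangle> \<langle>y\<rangle>"
    "par (\<lambda>x. all_of \<tau> (\<lambda>y. A x y \<^bold>\<longrightarrow> B x y))"
    "\<And>x. ty_of x = Some \<sigma> \<Longrightarrow> par (A \<langle>x\<rangle>)" "\<And>x. ty_of x = Some \<sigma> \<Longrightarrow> par (B \<langle>x\<rangle>)"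
  shows "T \<tturnstile> all_of \<sigma> (\<lambda>x. all_of \<tau> (\<lambda>y. A x y \<^bold>\<longrightarrow> B x y))"
proof (rule world_allI[OF assms(1,2,4)])
  show "T' \<tturnstile> all_of \<tau> (\<lambda>y. A \<langle>x\<rangle> y \<^bold>\<longrightarrow> B \<langle>x\<rangle> y)" if "world T'" "T' \<tturnstile> H" "ty_of x = Some \<sigma>" for T' x
    by (rule world_all_impI[OF that(1,2) assms(5,6)[OF that(3)]]) (rule assms(3)[OF _ _ that(3)])
qed

lemma world_all2_impD:
  assumes "world T" "T \<tturnstile> all_of \<sigma> (\<lambda>x. all_of \<tau> (\<lambda>y. A x y \<^bold>\<longrightarrow> B x y))" "T \<tturnstile> A \<langle>s\<rangle> \<langle>t\<rangle>"
    "ty_of s = Some \<sigma>" "ty_of t = Some \<tau>"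
    "par (\<lambda>x. all_of \<tau> (\<lambda>y. A x y \<^bold>\<longrightarrow> B x y))" "par (\<lambda>y. A \<langle>s\<rangle> y \<^bold>\<longrightarrow> B \<langle>s\<rangle> y)"
  shows "T \<tturnstile> B \<langle>s\<rangle> \<langle>t\<rangle>"
  by (rule world_all_impD[OF assms(1) world_all[OF assms(1,2,6,4)] assms(3,5,7)])

abbreviation "tsuc n \<equiv> App (Con CNSuc) n"
abbreviation "tplus m n \<equiv> App (App (Con CNAdd) m) n"
abbreviation "tsub s t \<equiv> tadd s (tneg t)"

section \<open>Addition and order of the natural numbers\<close>

context
  fixes T
  assumes T: "world T"
begin

lemma plus_zero: "is_nat m \<Longrightarrow> T \<tturnstile> \<langle>tplus m (Con CNZero)\<rangle> \<^bold>= \<langle>m\<rangle>"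
  using world_axiom1[OF T nat_add_zero, of m] by simp

lemma plus_suc: "is_nat m \<Longrightarrow> is_nat n \<Longrightarrow> T \<tturnstile> \<langle>tplus m (tsuc n)\<rangle> \<^bold>= \<langle>tsuc (tplus m n)\<rangle>"
  using world_axiom2[OF T nat_add_suc, of m n] by simp

end

lemma zero_plus:
  assumes T: "world T" and n: "is_nat n"
  shows "T \<tturnstile> \<langle>tplus (Con CNZero) n\<rangle> \<^bold>= \<langle>n\<rangle>"
proof -
  have "T \<tturnstile> \<^bold>0\<^sub>N \<^bold>+\<^sub>N \<langle>n\<rangle> \<^bold>= \<langle>n\<rangle>"
  proof (rule world_induct[OF T holds_verum[OF T], of "\<lambda>n. \<^bold>0\<^sub>N \<^bold>+\<^sub>N n \<^bold>= n"])
    show "T \<tturnstile> \<^bold>0\<^sub>N \<^bold>+\<^sub>N \<langle>Con CNZero\<rangle> \<^bold>= \<langle>Con CNZero\<rangle>" using plus_zero[OF T] by (simp add: cst_con)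
  next
    fix T' n assume *: "world T'" "is_nat n" "T' \<tturnstile> \<^bold>0\<^sub>N \<^bold>+\<^sub>N \<langle>n\<rangle> \<^bold>= \<langle>n\<rangle>"
    then have "T' \<tturnstile> \<langle>tsuc (tplus (Con CNZero) n)\<rangle> \<^bold>= \<langle>tsuc n\<rangle>"
      by (intro world_cong[of _ _ _ _ NatT NatT]) (simp_all add: cst_con)
    then show "T' \<tturnstile> \<^bold>0\<^sub>N \<^bold>+\<^sub>N \<langle>tsuc n\<rangle> \<^bold>= \<langle>tsuc n\<rangle>"
      using world_trans[OF *(1) plus_suc[OF *(1), of "Con CNZero" n], of "tsuc n" NatT] *(2) by (simp add: cst_con)
  qed (use n in simp_all)
  then show ?thesis by (simp add: cst_con)
qed

lemma suc_plus:
  assumes T: "world T" and m: "is_nat m" and n: "is_nat n"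
  shows "T \<tturnstile> \<langle>tplus (tsuc m) n\<rangle> \<^bold>= \<langle>tsuc (tplus m n)\<rangle>"
proof -
  have "T \<tturnstile> \<langle>tsuc m\<rangle> \<^bold>+\<^sub>N \<langle>n\<rangle> \<^bold>= nat_suc (\<langle>m\<rangle> \<^bold>+\<^sub>N \<langle>n\<rangle>)"
  proof (rule world_induct[OF T holds_verum[OF T], of "\<lambda>n. \<langle>tsuc m\<rangle> \<^bold>+\<^sub>N n \<^bold>= nat_suc (\<langle>m\<rangle> \<^bold>+\<^sub>N n)"])
    have "T \<tturnstile> \<langle>tsuc m\<rangle> \<^bold>= \<langle>tsuc (tplus m (Con CNZero))\<rangle>"
      by (rule world_cong[OF T world_sym[OF T plus_zero[OF T]]]) (use m in simp_all)
    from world_trans[OF T plus_zero[OF T] this] m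
    show "T \<tturnstile> \<langle>tsuc m\<rangle> \<^bold>+\<^sub>N \<langle>Con CNZero\<rangle> \<^bold>= nat_suc (\<langle>m\<rangle> \<^bold>+\<^sub>N \<langle>Con CNZero\<rangle>)" by simp
  next
    fix T' n assume *: "world T'" "is_nat n" "T' \<tturnstile> \<langle>tsuc m\<rangle> \<^bold>+\<^sub>N \<langle>n\<rangle> \<^bold>= nat_suc (\<langle>m\<rangle> \<^bold>+\<^sub>N \<langle>n\<rangle>)"
    have "T' \<tturnstile> \<langle>tsuc (tplus (tsuc m) n)\<rangle> \<^bold>= \<langle>tsuc (tsuc (tplus m n))\<rangle>"
      by (rule world_cong[OF *(1), of _ _ _ NatT NatT]) (use *(2,3) m in simp_all)
    moreover have "T' \<tturnstile> \<langle>tsuc (tsuc (tplus m n))\<rangle> \<^bold>= \<langle>tsuc (tplus m (tsuc n))\<rangle>"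
      by (rule world_cong[OF *(1) world_sym[OF *(1) plus_suc[OF *(1)]]]) (use *(2) m in simp_all)
    ultimately have "T' \<tturnstile> \<langle>tsuc (tplus (tsuc m) n)\<rangle> \<^bold>= \<langle>tsuc (tplus m (tsuc n))\<rangle>"
      by (rule world_trans[OF *(1)]) (use *(2) m in simp_all)
    from world_trans[OF *(1) plus_suc[OF *(1)] this]
    show "T' \<tturnstile> \<langle>tsuc m\<rangle> \<^bold>+\<^sub>N \<langle>tsuc n\<rangle> \<^bold>= nat_suc (\<langle>m\<rangle> \<^bold>+\<^sub>N \<langle>tsuc n\<rangle>)" using *(2) m by simp
  qed (use m n in simp_all)
  then show ?thesis by simp
qed

lemma plus_commute:
  assumes T: "world T" and m: "is_nat m" and n: "is_nat n"
  shows "T \<tturnstile> \<langle>tplus m n\<rangle> \<^bold>= \<langle>tplus n m\<rangle>"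
proof -
  have "T \<tturnstile> \<langle>m\<rangle> \<^bold>+\<^sub>N \<langle>n\<rangle> \<^bold>= \<langle>n\<rangle> \<^bold>+\<^sub>N \<langle>m\<rangle>"
  proof (rule world_induct[OF T holds_verum[OF T], of "\<lambda>n. \<langle>m\<rangle> \<^bold>+\<^sub>N n \<^bold>= n \<^bold>+\<^sub>N \<langle>m\<rangle>"])
    show "T \<tturnstile> \<langle>m\<rangle> \<^bold>+\<^sub>N \<langle>Con CNZero\<rangle> \<^bold>= \<langle>Con CNZero\<rangle> \<^bold>+\<^sub>N \<langle>m\<rangle>"
      using world_trans[OF T plus_zero[OF T m] world_sym[OF T zero_plus[OF T m]]] m by simp
  next
    fix T' n assume *: "world T'" "is_nat n" "T' \<tturnstile> \<langle>m\<rangle> \<^bold>+\<^sub>N \<langle>n\<rangle> \<^bold>= \<langle>n\<rangle> \<^bold>+\<^sub>N \<langle>m\<rangle>"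
    have "T' \<tturnstile> \<langle>tsuc (tplus m n)\<rangle> \<^bold>= \<langle>tsuc (tplus n m)\<rangle>"
      by (rule world_cong[OF *(1), of _ _ _ NatT NatT]) (use *(2,3) m in simp_all)
    from world_trans[OF *(1) this world_sym[OF *(1) suc_plus[OF *(1,2) m]]]
    have "T' \<tturnstile> \<langle>tsuc (tplus m n)\<rangle> \<^bold>= \<langle>tplus (tsuc n) m\<rangle>" using *(2) m by simp
    from world_trans[OF *(1) plus_suc[OF *(1) m *(2)] this]
    show "T' \<tturnstile> \<langle>m\<rangle> \<^bold>+\<^sub>N \<langle>tsuc n\<rangle> \<^bold>= \<langle>tsuc n\<rangle> \<^bold>+\<^sub>N \<langle>m\<rangle>" using *(2) m by simp
  qed (use m n in simp_all)
  then show ?thesis by simp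
qed

lemma nat_le_iff:
  assumes "world T" "is_nat m" "is_nat n"
  shows "(T \<tturnstile> \<langle>m\<rangle> \<^bold>\<le>\<^sub>N \<langle>n\<rangle>) \<longleftrightarrow> (\<exists>k. is_nat k \<and> (T \<tturnstile> \<langle>n\<rangle> \<^bold>= \<langle>tplus m k\<rangle>))"
  unfolding nat_le_def by (subst world_ex) (use assms in simp_all)

lemma nat_le_plus:
  assumes "world T" "is_nat m" "is_nat n"
  shows "T \<tturnstile> \<langle>m\<rangle> \<^bold>\<le>\<^sub>N \<langle>tplus m n\<rangle>" "T \<tturnstile> \<langle>n\<rangle> \<^bold>\<le>\<^sub>N \<langle>tplus m n\<rangle>"
proof -
  have "T \<tturnstile> \<langle>tplus m n\<rangle> \<^bold>= \<langle>tplus m n\<rangle>" using assms by (simp add: world_refl)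
  then show "T \<tturnstile> \<langle>m\<rangle> \<^bold>\<le>\<^sub>N \<langle>tplus m n\<rangle>" using assms nat_le_iff[of T m "tplus m n"] by auto
  show "T \<tturnstile> \<langle>n\<rangle> \<^bold>\<le>\<^sub>N \<langle>tplus m n\<rangle>"
    using plus_commute[of T m n] assms nat_le_iff[of T n "tplus m n"] by auto
qed

lemma nat_le_refl: "world T \<Longrightarrow> is_nat n \<Longrightarrow> T \<tturnstile> \<langle>n\<rangle> \<^bold>\<le>\<^sub>N \<langle>n\<rangle>"
  using world_sym[OF _ plus_zero, of T n NatT] by (auto simp: nat_le_iff intro!: exI[of _ "Con CNZero"])

lemma nat_zero_le: "world T \<Longrightarrow> is_nat n \<Longrightarrow> T \<tturnstile> \<langle>Con CNZero\<rangle> \<^bold>\<le>\<^sub>N \<langle>n\<rangle>"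
  using world_sym[OF _ zero_plus, of T n NatT] by (auto simp: nat_le_iff intro!: exI[of _ "n"])

lemma nat_le_suc:
  assumes "world T" "is_nat m" "is_nat n" "T \<tturnstile> \<langle>m\<rangle> \<^bold>\<le>\<^sub>N \<langle>n\<rangle>"
  shows "T \<tturnstile> \<langle>m\<rangle> \<^bold>\<le>\<^sub>N \<langle>tsuc n\<rangle>"
proof -
  obtain k where k: "is_nat k" "T \<tturnstile> \<langle>n\<rangle> \<^bold>= \<langle>tplus m k\<rangle>" using assms by (auto simp: nat_le_iff)
  have "T \<tturnstile> \<langle>tsuc n\<rangle> \<^bold>= \<langle>tsuc (tplus m k)\<rangle>"
    by (rule world_cong[OF assms(1) k(2)]) (use assms k in simp_all)
  from world_trans[OF assms(1) this world_sym[OF assms(1) plus_suc[OF assms(1)]]]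
  have "T \<tturnstile> \<langle>tsuc n\<rangle> \<^bold>= \<langle>tplus m (tsuc k)\<rangle>" using assms k by simp
  then show ?thesis using assms k by (auto simp: nat_le_iff intro!: exI[of _ "tsuc k"])
qed

text \<open>By the definition of the order, \<open>n\<close> equals \<open>k + j\<close> for some
  \<open>j\<close>, and the induction runs over \<open>j\<close>.\<close>

lemma world_induct_from:
  assumes T: "world T" and H: "T \<tturnstile> H" and F: "par F" and k: "is_nat k" and base: "T \<tturnstile> F \<langle>k\<rangle>"
    and step: "\<And>T' n. world T' \<Longrightarrow> T' \<tturnstile> H \<Longrightarrow> is_nat n \<Longrightarrow> T' \<tturnstile> \<langle>k\<rangle> \<^bold>\<le>\<^sub>N \<langle>n\<rangle> \<Longrightarrow> T' \<tturnstile> F \<langle>n\<rangle> \<Longrightarrow>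
      T' \<tturnstile> F \<langle>tsuc n\<rangle>"
    and n: "is_nat n" and le: "T \<tturnstile> \<langle>k\<rangle> \<^bold>\<le>\<^sub>N \<langle>n\<rangle>"
  shows "T \<tturnstile> F \<langle>n\<rangle>"
proof -
  obtain j where j: "is_nat j" "T \<tturnstile> \<langle>n\<rangle> \<^bold>= \<langle>tplus k j\<rangle>" using le nat_le_iff[OF T k n] by blast
  have "T \<tturnstile> F (\<langle>k\<rangle> \<^bold>+\<^sub>N \<langle>j\<rangle>)"
  proof (rule world_induct[OF T H, of "\<lambda>j. F (\<langle>k\<rangle> \<^bold>+\<^sub>N j)"])
    show "par (\<lambda>j. F (\<langle>k\<rangle> \<^bold>+\<^sub>N j))" using F k by (simp add: par_def)
    have "T \<tturnstile> F \<langle>tplus k (Con CNZero)\<rangle>"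
      by (rule world_subst[OF T world_sym[OF T plus_zero[OF T k]] base F]) (use k in simp_all)
    then show "T \<tturnstile> F (\<langle>k\<rangle> \<^bold>+\<^sub>N \<langle>Con CNZero\<rangle>)" by simp
  next
    fix T' i assume *: "world T'" "T' \<tturnstile> H" "is_nat i" "T' \<tturnstile> F (\<langle>k\<rangle> \<^bold>+\<^sub>N \<langle>i\<rangle>)"
    then have "T' \<tturnstile> F \<langle>tsuc (tplus k i)\<rangle>"
      using nat_le_plus[OF *(1) k *(3)] k by (intro step) simp_all
    moreover have "T' \<tturnstile> \<langle>tsuc (tplus k i)\<rangle> \<^bold>= \<langle>tplus k (tsuc i)\<rangle>"
      using world_sym[OF *(1) plus_suc[OF *(1) k *(3)]] k * by simp
    ultimately have "T' \<tturnstile> F \<langle>tplus k (tsuc i)\<rangle>"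
      using world_subst[OF *(1) _ _ F] k * by simp
    then show "T' \<tturnstile> F (\<langle>k\<rangle> \<^bold>+\<^sub>N \<langle>tsuc i\<rangle>)" by simp
  qed (use j in simp_all)
  then have "T \<tturnstile> F \<langle>tplus k j\<rangle>" by simp
  moreover have "T \<tturnstile> \<langle>tplus k j\<rangle> \<^bold>= \<langle>n\<rangle>" using world_sym[OF T j(2)] k j n by simp
  ultimately show ?thesis using world_subst[OF T _ _ F] k j n by simp
qed

lemma rnat_mono:
  assumes T: "world T" and k: "is_nat k" and n: "is_nat n" and le: "T \<tturnstile> \<langle>k\<rangle> \<^bold>\<le>\<^sub>N \<langle>n\<rangle>"
  shows "le T (rnat k) (rnat n)"
proof -
  have "T \<tturnstile> real_of \<langle>k\<rangle> \<^bold>\<le> real_of \<langle>n\<rangle>"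
  proof (rule world_induct_from[OF T holds_verum[OF T] _ k _ _ n le, of "\<lambda>n. real_of \<langle>k\<rangle> \<^bold>\<le> real_of n"])
    show "T \<tturnstile> real_of \<langle>k\<rangle> \<^bold>\<le> real_of \<langle>k\<rangle>"
      by (rule holds_leI[OF T holds_verum[OF T]]) (use k le_refl in simp_all)
  next
    fix T' n assume *: "world T'" "is_nat n" "T' \<tturnstile> real_of \<langle>k\<rangle> \<^bold>\<le> real_of \<langle>n\<rangle>"
    show "T' \<tturnstile> real_of \<langle>k\<rangle> \<^bold>\<le> real_of \<langle>tsuc n\<rangle>"
    proof (rule holds_leI[OF *(1,3)])
      fix T'' assume **: "world T''" "T'' \<tturnstile> real_of \<langle>k\<rangle> \<^bold>\<le> real_of \<langle>n\<rangle>"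
      have "le T'' (rnat k) (rnat n)" using holds_leD[OF **] k * by simp
      moreover have "le T'' (rnat n) (rnat n + 1)"
        by (rule leI[OF **(1), of 1]) (use lt_imp_le[OF **(1) lt_zero_one[OF **(1)]] in simp_all)
      moreover have "le T'' (rnat n + 1) (rnat (tsuc n))"
        using eqr_le[OF **(1) eqr_sym[OF **(1) rnat_Suc[OF **(1) *(2)]]] .
      ultimately show "le T'' (rv (real_of \<langle>k\<rangle> 0)) (rv (real_of \<langle>tsuc n\<rangle> 0))"
        using le_trans[OF **(1)] by (simp only: app_def con_def cst_apply)
    qed (use k * in simp_all)
  qed (use k in simp_all)
  from holds_leD[OF T this] k n show ?thesis by simp
qed

lemma rnat_nonneg:
  assumes T: "world T" and n: "is_nat n"
  shows "le T 0 (rnat n)"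
  using le_trans[OF T eqr_le[OF T eqr_sym[OF T rnat_0[OF T]]] rnat_mono[OF T _ n nat_zero_le[OF T n]]] by simp

lemma nat_suc_neq_zero: "world T \<Longrightarrow> is_nat n \<Longrightarrow> \<not> (T \<tturnstile> \<langle>tsuc n\<rangle> \<^bold>= \<langle>Con CNZero\<rangle>)"
  using world_not[OF _ world_axiom1[OF _ suc_not_zero, of T n]] by (simp add: cst_con)

lemma nat_suc_eqD:
  assumes "world T" "is_nat m" "is_nat n" "T \<tturnstile> \<langle>tsuc m\<rangle> \<^bold>= \<langle>tsuc n\<rangle>"
  shows "T \<tturnstile> \<langle>m\<rangle> \<^bold>= \<langle>n\<rangle>"
proof -
  have "T \<tturnstile> nat_suc \<langle>m\<rangle> \<^bold>= nat_suc \<langle>n\<rangle> \<^bold>\<longrightarrow> \<langle>m\<rangle> \<^bold>= \<langle>n\<rangle>"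
    by (rule world_axiom2[OF assms(1) suc_inject]) (use assms in simp_all)
  from world_mp[OF assms(1) this] assms show ?thesis by simp
qed

lemma nat_cases:
  assumes T: "world T" and n: "is_nat n"
  shows "(T \<tturnstile> \<langle>n\<rangle> \<^bold>= \<langle>Con CNZero\<rangle>) \<or> (\<exists>m. is_nat m \<and> (T \<tturnstile> \<langle>n\<rangle> \<^bold>= \<langle>tsuc m\<rangle>))"
proof -
  have "T \<tturnstile> \<langle>n\<rangle> \<^bold>= \<^bold>0\<^sub>N \<^bold>\<or> (\<^bold>\<exists>\<^sub>N m. \<langle>n\<rangle> \<^bold>= nat_suc m)"
  proof (rule world_induct[OF T holds_verum[OF T], of "\<lambda>n. n \<^bold>= \<^bold>0\<^sub>N \<^bold>\<or> (\<^bold>\<exists>\<^sub>N m. n \<^bold>= nat_suc m)"])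
    show "T \<tturnstile> \<langle>Con CNZero\<rangle> \<^bold>= \<^bold>0\<^sub>N \<^bold>\<or> (\<^bold>\<exists>\<^sub>N m. \<langle>Con CNZero\<rangle> \<^bold>= nat_suc m)"
      using T by (simp add: cst_con world_refl)
  next
    fix T' n assume *: "world T'" "is_nat n"
    show "T' \<tturnstile> \<langle>tsuc n\<rangle> \<^bold>= \<^bold>0\<^sub>N \<^bold>\<or> (\<^bold>\<exists>\<^sub>N m. \<langle>tsuc n\<rangle> \<^bold>= nat_suc m)"
      using world_exI[OF *(1), of "\<lambda>m. \<langle>tsuc n\<rangle> \<^bold>= nat_suc m" n NatT] * by (simp add: world_refl)
  qed (use n in simp_all)
  then have "(T \<tturnstile> \<langle>n\<rangle> \<^bold>= \<^bold>0\<^sub>N) \<or> (T \<tturnstile> \<^bold>\<exists>\<^sub>N m. \<langle>n\<rangle> \<^bold>= nat_suc m)" using T by simp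
  then show ?thesis
    using world_ex[OF T, of "\<lambda>m. \<langle>n\<rangle> \<^bold>= nat_suc m" NatT] n by (simp add: cst_con)
qed

section \<open>Quasi-convex functions\<close>

abbreviation is_fun :: "trm \<Rightarrow> bool" where "is_fun f \<equiv> ty_of f = Some (RealT \<rightarrow> RealT)"

definition pos_qc :: "tm \<Rightarrow> form" where
  "pos_qc f = (positive_valued f \<^bold>\<and> quasi_convex f)"

lemma rel_pos_qc [simp]:
  "(\<And>j. k \<le> j \<Longrightarrow> rel_tm p \<theta> j s s') \<Longrightarrow> rel_form p \<theta> k (pos_qc s) (pos_qc s')"
  by (simp add: pos_qc_def positive_valued_def quasi_convex_def)

lemma unit_intervalD:
  assumes "world T" "T \<tturnstile> unit_interval \<langle>x\<rangle>" "is_real x"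
  shows "le T 0 (rv x)" "le T (rv x) 1"
  using assms holds_leD[of T "\<^bold>0" "\<langle>x\<rangle>"] holds_leD[of T "\<langle>x\<rangle>" "\<^bold>1"]
  by (simp_all add: unit_interval_def ev)

lemma unit_intervalI:
  assumes "world T" "T \<tturnstile> H" "is_real x"
    "\<And>T'. world T' \<Longrightarrow> T' \<tturnstile> H \<Longrightarrow> le T' 0 (rv x)" "\<And>T'. world T' \<Longrightarrow> T' \<tturnstile> H \<Longrightarrow> le T' (rv x) 1"
  shows "T \<tturnstile> unit_interval \<langle>x\<rangle>"
  using assms holds_leI[of T H "\<^bold>0" "\<langle>x\<rangle>"] holds_leI[of T H "\<langle>x\<rangle>" "\<^bold>1"]
  by (simp add: unit_interval_def ev)

lemma unit_intervalI_strict: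
  assumes "world T" "is_real x" "lt T 0 (rv x)" "lt T (rv x) 1"
  shows "T \<tturnstile> unit_interval \<langle>x\<rangle>"
  by (rule unit_intervalI[of T "\<^bold>0 \<^bold>< \<langle>x\<rangle> \<^bold>\<and> \<langle>x\<rangle> \<^bold>< \<^bold>1"]) (use assms lt_imp_le in \<open>auto simp: ev\<close>)

lemma positive_valuedD:
  assumes "world T" "T \<tturnstile> pos_qc \<langle>f\<rangle>" "T \<tturnstile> unit_interval \<langle>x\<rangle>" "is_fun f" "is_real x"
  shows "lt T 0 (rv (App f x))"
proof -
  have "T \<tturnstile> \<^bold>\<forall>\<^sub>R x. unit_interval x \<^bold>\<longrightarrow> \<^bold>0 \<^bold>< \<langle>f\<rangle> \<^bold>\<cdot> x"
    using assms by (simp add: pos_qc_def positive_valued_def)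
  from world_all_impD[OF assms(1) this assms(3)] show ?thesis using assms by (simp add: ev)
qed

lemma quasi_convexD:
  assumes "world T" "T \<tturnstile> pos_qc \<langle>f\<rangle>" "is_fun f" "is_real x" "is_real y" "is_real l"
    "T \<tturnstile> unit_interval \<langle>x\<rangle>" "T \<tturnstile> unit_interval \<langle>y\<rangle>" "T \<tturnstile> unit_interval \<langle>l\<rangle>"
  shows "le T (rv (App f (tadd (tmul l x) (tmul (tsub (Con CROne) l) y)))) (rv (tmax (App f x) (App f y)))"
proof -
  have 1: "T \<tturnstile> \<^bold>\<forall>\<^sub>R x. \<^bold>\<forall>\<^sub>R y. \<^bold>\<forall>\<^sub>R l. unit_interval x \<^bold>\<and> unit_interval y \<^bold>\<and> unit_interval l \<^bold>\<longrightarrow>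
        \<langle>f\<rangle> \<^bold>\<cdot> (l \<^bold>* x \<^bold>+ (\<^bold>1 \<^bold>- l) \<^bold>* y) \<^bold>\<le> real_max (\<langle>f\<rangle> \<^bold>\<cdot> x) (\<langle>f\<rangle> \<^bold>\<cdot> y)"
    using assms by (simp add: pos_qc_def quasi_convex_def)
  have 2: "T \<tturnstile> \<^bold>\<forall>\<^sub>R y. \<^bold>\<forall>\<^sub>R l. unit_interval \<langle>x\<rangle> \<^bold>\<and> unit_interval y \<^bold>\<and> unit_interval l \<^bold>\<longrightarrow>
        \<langle>f\<rangle> \<^bold>\<cdot> (l \<^bold>* \<langle>x\<rangle> \<^bold>+ (\<^bold>1 \<^bold>- l) \<^bold>* y) \<^bold>\<le> real_max (\<langle>f\<rangle> \<^bold>\<cdot> \<langle>x\<rangle>) (\<langle>f\<rangle> \<^bold>\<cdot> y)"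
    by (rule world_all[OF assms(1) 1]) (use assms in simp_all)
  have 3: "T \<tturnstile> \<^bold>\<forall>\<^sub>R l. unit_interval \<langle>x\<rangle> \<^bold>\<and> unit_interval \<langle>y\<rangle> \<^bold>\<and> unit_interval l \<^bold>\<longrightarrow>
        \<langle>f\<rangle> \<^bold>\<cdot> (l \<^bold>* \<langle>x\<rangle> \<^bold>+ (\<^bold>1 \<^bold>- l) \<^bold>* \<langle>y\<rangle>) \<^bold>\<le> real_max (\<langle>f\<rangle> \<^bold>\<cdot> \<langle>x\<rangle>) (\<langle>f\<rangle> \<^bold>\<cdot> \<langle>y\<rangle>)"
    by (rule world_all[OF assms(1) 2]) (use assms in simp_all)
  have "T \<tturnstile> \<langle>f\<rangle> \<^bold>\<cdot> (\<langle>l\<rangle> \<^bold>* \<langle>x\<rangle> \<^bold>+ (\<^bold>1 \<^bold>- \<langle>l\<rangle>) \<^bold>* \<langle>y\<rangle>) \<^bold>\<le> real_max (\<langle>f\<rangle> \<^bold>\<cdot> \<langle>x\<rangle>) (\<langle>f\<rangle> \<^bold>\<cdot> \<langle>y\<rangle>)"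
    by (rule world_all_impD[OF assms(1) 3]) (use assms in simp_all)
  from holds_leD[OF assms(1) this] show ?thesis using assms by (simp add: cst_con)
qed

lemma fun_cong_rv:
  assumes "world T" "is_fun f" "is_real s" "is_real t" "eqr T (rv s) (rv t)"
  shows "eqr T (rv (App f s)) (rv (App f t))"
  using world_cong[of T s t f RealT RealT] assms by (simp add: eqr_rv)

lemma eqr_add:
  assumes T: "world T" and "eqr T x y"
  shows "eqr T (z + x) (z + y)"
proof -
  obtain s t u where "x = rv s" "is_real s" "y = rv t" "is_real t" "z = rv u" "is_real u"
    by (metis rv_cases)
  then show ?thesis
    using world_cong[OF T, of s t "App (Con CRAdd) u"] assms by (simp add: eqr_rv rv_simps)
qed

text \<open>Quasi-convexity speaks about convex combinations. A point strictly between
  \<open>u\<close> and \<open>v\<close> is one, because \<open>v - u\<close> is then positive and so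
  invertible.\<close>

lemma quasi_convex_between:
  assumes T: "world T" and f: "T \<tturnstile> pos_qc \<langle>f\<rangle>" "is_fun f" and ty: "is_real u" "is_real v" "is_real t"
    and unit: "T \<tturnstile> unit_interval \<langle>u\<rangle>" "T \<tturnstile> unit_interval \<langle>v\<rangle>"
    and less: "lt T (rv u) (rv t)" "lt T (rv t) (rv v)" and c: "lt T (rv (App f u)) c" "lt T (rv (App f v)) c"
  shows "lt T (rv (App f t)) c"
proof -
  have uv: "lt T 0 (rv v - rv u)" using ltD[OF T lt_trans[OF T less]] .
  obtain w where w: "is_real w" "lt T 0 (rv w)" "eqr T ((rv v - rv u) * rv w) 1"
    using inverse_ex[OF T, of "tsub v u"] uv ty by auto
  \<comment> \<open>The weight of \<open>u\<close> in \<open>t\<close>, namely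
    \<open>(v - t) / (v - u)\<close>; it lies strictly between 0 and 1.\<close>
  define l where "l = tmul (tsub v t) w"
  have l: "is_real l" "rv l = (rv v - rv t) * rv w" using ty w by (simp_all add: l_def rv_ops)
  have l0: "lt T 0 (rv l)" unfolding l by (rule lt_mul[OF T ltD[OF T less(2)] w(2)])
  have "lt T 0 ((rv t - rv u) * rv w)" by (rule lt_mul[OF T ltD[OF T less(1)] w(2)])
  then have "lt T (rv l) ((rv v - rv u) * rv w)"
    by (rule ltI[OF T]) (simp add: l algebra_simps)
  then have l1: "lt T (rv l) 1" using lt_le_trans[OF T _ eqr_le[OF T w(3)]] by blast
  define a where "a = tadd (tmul l u) (tmul (tsub (Con CROne) l) v)"
  have a: "is_real a" "rv a = rv l * rv u + (1 - rv l) * rv v"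
    using ty l(1) by (simp_all add: a_def ev)
  have at: "eqr T (rv a) (rv t)"
  proof -
    \<comment> \<open>By the ring laws \<open>a\<close> is \<open>v + b\<close>. Replacing
      \<open>(v - u) w\<close> by 1 turns this into \<open>t\<close>, but only in the sense of
      \<open>eqr T\<close>, since \<open>w\<close> is an inverse in \<open>T\<close>;
      \<open>f\<close> is therefore transported by \<open>fun_cong_rv\<close>.\<close>
    define b where "b = - (rv v - rv t) * ((rv v - rv u) * rv w)"
    have "eqr T b (- (rv v - rv t) * 1)" unfolding b_def by (rule eqr_mul[OF T w(3)])
    then have "eqr T (rv v + b) (rv v + - (rv v - rv t) * 1)" by (rule eqr_add[OF T])
    then show ?thesis by (simp add: b_def a l algebra_simps)
  qed
  have "le T (rv (App f a)) (rv (tmax (App f u) (App f v)))"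
    unfolding a_def using quasi_convexD[OF T f ty(1,2) l(1) unit unit_intervalI_strict[OF T l(1) l0 l1]] .
  moreover have "lt T (rv (tmax (App f u) (App f v))) c"
    using max_less_iff[OF T] c f ty by simp
  moreover have "le T (rv (App f t)) (rv (App f a))"
    using eqr_le[OF T eqr_sym[OF T fun_cong_rv[OF T f(2) a(1) ty(3) at]]] .
  ultimately show ?thesis using le_lt_trans[OF T] by blast
qed

section \<open>Absolute values, minima and clamping to the unit interval\<close>

lemma abs_less_iff:
  assumes "world T" "is_real x"
  shows "lt T (rv (tmax x (tneg x))) e \<longleftrightarrow> lt T (rv x) e \<and> lt T (- rv x) e"
  using max_less_iff[of T x "tneg x" e] assms by (simp add: ev)

text \<open>The minimum is \<open>- max (- a) (- b)\<close>. Its comparison property belongs to the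
  term and so holds in all worlds, which lets the minimum be used under a universal statement proved
  later.\<close>

lemma min_ex:
  assumes "world T" "is_real a" "is_real b" "lt T 0 (rv a)" "lt T 0 (rv b)"
  obtains m where "is_real m" "lt T 0 (rv m)"
    "\<And>T' x. world T' \<Longrightarrow> lt T' x (rv m) \<Longrightarrow> lt T' x (rv a) \<and> lt T' x (rv b)"
proof
  let ?m = "tneg (tmax (tneg a) (tneg b))"
  show "is_real ?m" using assms by simp
  have *: "lt T' x (rv ?m) \<longleftrightarrow> lt T' x (rv a) \<and> lt T' x (rv b)" if T': "world T'" for T' x
  proof -
    have "lt T' x (- y) \<longleftrightarrow> lt T' y (- x)" for x y
      using lt_iff_diff[OF T', of x "- y"] lt_iff_diff[OF T', of y "- x"] minus_diff_commute[of y x] by simp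
    from this[of x "rv (tmax (tneg a) (tneg b))"] this[of x "- rv a"] this[of x "- rv b"]
    show ?thesis using max_less_iff[OF T', of "tneg a" "tneg b" "- x"] assms by (simp add: ev)
  qed
  show "lt T 0 (rv ?m)" using * assms by blast
  show "lt T' x (rv a) \<and> lt T' x (rv b)" if "world T'" "lt T' x (rv ?m)" for T' x
    using that * by blast
qed


text \<open>The term is \<open>min 1 s\<close>, written with the available maximum. It keeps grid
  points to the right of 1 inside the interval on which \<open>f\<close> is known to be
  positive.\<close>

lemma clamp_unit:
  assumes "world T" "is_real s" "T \<tturnstile> \<^bold>0 \<^bold>\<le> \<langle>s\<rangle>"
  shows "T \<tturnstile> unit_interval \<langle>tsub (Con CROne) (tmax (Con CRZero) (tsub (Con CROne) s))\<rangle>" (is "_ \<tturnstile> unit_interval \<langle>?c\<rangle>")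
proof (rule unit_intervalI[OF assms(1,3)])
  fix T' assume T': "world T'" "T' \<tturnstile> \<^bold>0 \<^bold>\<le> \<langle>s\<rangle>"
  let ?m = "rv (tmax (Con CRZero) (tsub (Con CROne) s))"
  have c: "rv ?c = 1 - ?m" using assms by (simp add: ev)
  have "le T' 0 (rv s)" using holds_leD[OF T'] assms(2) by (simp add: ev)
  then have "\<not> lt T' 1 (1 - rv s)" using lt_iff_diff[OF T'(1), of 1 "1 - rv s"] lt_iff_diff[OF T'(1), of "rv s" 0]
    by (simp add: le_def)
  then have "le T' ?m 1"
    using less_max_iff[OF T'(1), of "Con CRZero" "tsub (Con CROne) s" 1] lt_asym[OF T'(1) lt_zero_one[OF T'(1)]] assms(2)
    by (auto simp: le_def ev)
  then show "le T' 0 (rv ?c)" unfolding c by (rule leD[OF T'(1)])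
  have "le T' 0 ?m"
    using max_less_iff[OF T'(1), of "Con CRZero" "tsub (Con CROne) s" 0] lt_irrefl[OF T'(1)] assms(2)
    by (auto simp: le_def ev)
  then show "le T' (rv ?c) 1" unfolding c by (rule leI[OF T'(1)]) simp
qed (use assms in simp)

text \<open>Clamping preserves separation: if \<open>s\<close> lies strictly between two points of
  the unit interval, so does \<open>min 1 s\<close>.\<close>

lemma clamp_between:
  fixes s
  defines "c \<equiv> tsub (Con CROne) (tmax (Con CRZero) (tsub (Con CROne) s))"
  assumes T: "world T" and s: "is_real s"
  shows "lt T x (rv s) \<Longrightarrow> lt T x 1 \<Longrightarrow> lt T x (rv c)" "lt T (rv s) x \<Longrightarrow> lt T (rv c) x"
proof -
  let ?m = "rv (tmax (Con CRZero) (tsub (Con CROne) s))"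
  have c: "rv c = 1 - ?m" using s by (simp add: c_def ev)
  have m: "lt T ?m z \<longleftrightarrow> lt T 0 z \<and> lt T (1 - rv s) z" "lt T z ?m \<longleftrightarrow> lt T z 0 \<or> lt T z (1 - rv s)" for z
    using max_less_iff[OF T, of "Con CRZero" "tsub (Con CROne) s" z]
      less_max_iff[OF T, of "Con CRZero" "tsub (Con CROne) s" z] s by (simp_all add: ev)
  have d: "lt T a (1 - b) \<longleftrightarrow> lt T b (1 - a)" "lt T (1 - b) a \<longleftrightarrow> lt T (1 - a) b"
      "lt T (1 - a) (1 - b) \<longleftrightarrow> lt T b a" for a b
    using lt_iff_diff[OF T, of a "1 - b"] lt_iff_diff[OF T, of b "1 - a"]
      lt_iff_diff[OF T, of "1 - b" a] lt_iff_diff[OF T, of "1 - a" b]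
      lt_iff_diff[OF T, of "1 - a" "1 - b"] lt_iff_diff[OF T, of b a] by (simp_all add: algebra_simps)
  show "lt T x (rv s) \<Longrightarrow> lt T x 1 \<Longrightarrow> lt T x (rv c)"
    unfolding c using d(1)[of x ?m] m(1)[of "1 - x"] d(3)[of "rv s" x] d(1)[of x 0] by simp
  show "lt T (rv s) x \<Longrightarrow> lt T (rv c) x"
    unfolding c using d(2)[of ?m x] m(2)[of "1 - x"] d(3)[of x "rv s"] by simp
qed

text \<open>
  The low points of \<open>f\<close> to the left of the grid point \<open>n r\<close> have no low points more than \<open>2 r\<close> to
  their right: the value of \<open>f\<close> at a grid point between them bounds one of the two from below.
\<close>

definition gap :: "tm \<Rightarrow> tm \<Rightarrow> tm \<Rightarrow> tm \<Rightarrow> tm \<Rightarrow> tm \<Rightarrow> form" where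
  "gap f r n h u v = (unit_interval u \<^bold>\<and> unit_interval v \<^bold>\<and> u \<^bold>< real_of n \<^bold>* r \<^bold>\<and> u \<^bold>+ r \<^bold>+ r \<^bold>< v \<^bold>\<and>
     f \<^bold>\<cdot> u \<^bold>< h \<^bold>\<and> f \<^bold>\<cdot> v \<^bold>< h)"

lemma rel_gap [simp]:
  "rel_tm p \<theta> k f f' \<Longrightarrow> rel_tm p \<theta> k r r' \<Longrightarrow> rel_tm p \<theta> k n n' \<Longrightarrow> rel_tm p \<theta> k h h' \<Longrightarrow> rel_tm p \<theta> k u u' \<Longrightarrow>
   rel_tm p \<theta> k v v' \<Longrightarrow> rel_form p \<theta> k (gap f r n h u v) (gap f' r' n' h' u' v')"
  by (simp add: gap_def)

text \<open>Induction over the grid points, with \<open>h\<close> lowered at each one to the value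
  of \<open>f\<close> there if that is smaller. Finitely many positive values leave \<open>h\<close>
  positive although \<open>f\<close> may have no positive lower bound. A gap of two grid steps is
  required because the position of \<open>u\<close> relative to a grid point is decided only up to
  an overlap of one step.\<close>

lemma no_gap:
  assumes T: "world T" and f: "T \<tturnstile> pos_qc \<langle>f\<rangle>" "is_fun f" and r: "lt T 0 (rv r)" "is_real r" and n: "is_nat n"
  obtains h where "is_real h" "lt T 0 (rv h)" "T \<tturnstile> \<^bold>\<forall>\<^sub>R u. \<^bold>\<forall>\<^sub>R v. gap \<langle>f\<rangle> \<langle>r\<rangle> \<langle>n\<rangle> \<langle>h\<rangle> u v \<^bold>\<longrightarrow> \<^bold>\<bottom>"
proof -
  let ?F = "\<lambda>n. \<^bold>\<exists>\<^sub>R h. \<^bold>0 \<^bold>< h \<^bold>\<and> (\<^bold>\<forall>\<^sub>R u. \<^bold>\<forall>\<^sub>R v. gap \<langle>f\<rangle> \<langle>r\<rangle> n h u v \<^bold>\<longrightarrow> \<^bold>\<bottom>)"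
  let ?H = "pos_qc \<langle>f\<rangle> \<^bold>\<and> \<^bold>0 \<^bold>< \<langle>r\<rangle>"
  have H: "(T' \<tturnstile> ?H) \<longleftrightarrow> (T' \<tturnstile> pos_qc \<langle>f\<rangle>) \<and> lt T' 0 (rv r)" if "world T'" for T'
    using that r by (simp add: ev)
  have gapD: "(T' \<tturnstile> gap \<langle>f\<rangle> \<langle>r\<rangle> \<langle>n\<rangle> \<langle>h\<rangle> \<langle>u\<rangle> \<langle>v\<rangle>) \<longleftrightarrow> (T' \<tturnstile> unit_interval \<langle>u\<rangle>) \<and> (T' \<tturnstile> unit_interval \<langle>v\<rangle>) \<and>
    lt T' (rv u) (rnat n * rv r) \<and> lt T' (rv u + rv r + rv r) (rv v) \<and> lt T' (rv (App f u)) (rv h) \<and> lt T' (rv (App f v)) (rv h)"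
    if "world T'" "is_nat n" "is_real h" "is_real u" "is_real v" for T' n h u v
    using that f r by (simp add: gap_def ev)
  have "T \<tturnstile> ?F \<langle>n\<rangle>"
  proof (rule world_induct[OF T _ _ _ _ n, of ?H ?F])
    show "T \<tturnstile> ?H" using T f r by (simp add: ev)
    show "par ?F" using f r by simp
    \<comment> \<open>No point of the unit interval lies to the left of 0, so any positive
      \<open>h\<close> serves; 1 is taken.\<close>
    show "T \<tturnstile> ?F \<langle>Con CNZero\<rangle>"
    proof (rule world_exI[OF T, of _ "Con CROne"])
      have "T \<tturnstile> \<^bold>\<forall>\<^sub>R u. \<^bold>\<forall>\<^sub>R v. gap \<langle>f\<rangle> \<langle>r\<rangle> \<langle>Con CNZero\<rangle> \<langle>Con CROne\<rangle> u v \<^bold>\<longrightarrow> \<^bold>\<bottom>"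
      proof (rule world_all2_impI[OF T holds_verum[OF T]])
        fix u T'' v
        assume u: "is_real u" and *: "world T''" "is_real v" "T'' \<tturnstile> gap \<langle>f\<rangle> \<langle>r\<rangle> \<langle>Con CNZero\<rangle> \<langle>Con CROne\<rangle> \<langle>u\<rangle> \<langle>v\<rangle>"
        have l: "le T'' (rnat (Con CNZero) * rv r) 0" by (intro eqr_le eqr_mul_zero rnat_0 *(1))
        have g: "T'' \<tturnstile> unit_interval \<langle>u\<rangle>" "lt T'' (rv u) (rnat (Con CNZero) * rv r)"
          using gapD[OF *(1) _ _ u *(2), of "Con CNZero" "Con CROne"] *(3) by simp_all
        have "le T'' 0 (rv u)" by (rule unit_intervalD(1)[OF *(1) g(1) u])
        with lt_le_trans[OF *(1) g(2) l] show "T'' \<tturnstile> \<^bold>\<bottom>" by (simp add: le_def)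
      qed (use f r in simp_all)
      then show "T \<tturnstile> \<^bold>0 \<^bold>< \<langle>Con CROne\<rangle> \<^bold>\<and> (\<^bold>\<forall>\<^sub>R u. \<^bold>\<forall>\<^sub>R v. gap \<langle>f\<rangle> \<langle>r\<rangle> \<langle>Con CNZero\<rangle> \<langle>Con CROne\<rangle> u v \<^bold>\<longrightarrow> \<^bold>\<bottom>)"
        using T lt_zero_one by (simp add: ev)
    qed (use f r in simp_all)
  next
    fix T' n
    assume T': "world T'" and H': "T' \<tturnstile> ?H" and n: "is_nat n" and IH: "T' \<tturnstile> ?F \<langle>n\<rangle>"
    obtain h where h: "is_real h" "T' \<tturnstile> \<^bold>0 \<^bold>< \<langle>h\<rangle> \<^bold>\<and> (\<^bold>\<forall>\<^sub>R u. \<^bold>\<forall>\<^sub>R v. gap \<langle>f\<rangle> \<langle>r\<rangle> \<langle>n\<rangle> \<langle>h\<rangle> u v \<^bold>\<longrightarrow> \<^bold>\<bottom>)"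
      by (rule world_exE[OF T' IH]) (use f r n in simp_all)
    then have h: "is_real h" "lt T' 0 (rv h)" "T' \<tturnstile> \<^bold>\<forall>\<^sub>R u. \<^bold>\<forall>\<^sub>R v. gap \<langle>f\<rangle> \<langle>r\<rangle> \<langle>n\<rangle> \<langle>h\<rangle> u v \<^bold>\<longrightarrow> \<^bold>\<bottom>"
      using T' by (simp_all add: ev)
    \<comment> \<open>The new grid point \<open>(n + 1) r\<close>, with its clamped version
      \<open>c\<close>.\<close>
    define s where "s = tmul (App (Con CROfNat) (tsuc n)) r"
    define c where "c = tsub (Con CROne) (tmax (Con CRZero) (tsub (Con CROne) s))"
    have s: "is_real s" and c: "is_real c" using n r by (simp_all add: s_def c_def)
    have "le T'' 0 (rv s)" if "world T''" "T'' \<tturnstile> ?H" for T''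
      using nonneg_mul[OF that(1) rnat_nonneg lt_imp_le] H that n r by (simp add: s_def rv_ops)
    then have "T' \<tturnstile> \<^bold>0 \<^bold>\<le> \<langle>s\<rangle>"
      by (intro holds_leI[OF T' H']) (simp_all add: s ev)
    then have cu: "T' \<tturnstile> unit_interval \<langle>c\<rangle>" unfolding c_def by (rule clamp_unit[OF T' s])
    have fc: "lt T' 0 (rv (App f c))"
      by (rule positive_valuedD[OF T' _ cu f(2) c]) (use H H' T' in blast)
    \<comment> \<open>The new threshold is the minimum of the old one and
      \<open>f c\<close>.\<close>
    obtain m where m: "is_real m" "lt T' 0 (rv m)"
      "\<And>T' x. world T' \<Longrightarrow> lt T' x (rv m) \<Longrightarrow> lt T' x (rv h) \<and> lt T' x (rv (App f c))"
      by (rule min_ex[OF T' h(1) _ h(2) fc]) (use f c in simp_all)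
    let ?H' = "?H \<^bold>\<and> (\<^bold>\<forall>\<^sub>R u. \<^bold>\<forall>\<^sub>R v. gap \<langle>f\<rangle> \<langle>r\<rangle> \<langle>n\<rangle> \<langle>h\<rangle> u v \<^bold>\<longrightarrow> \<^bold>\<bottom>)"
    have "T' \<tturnstile> \<^bold>\<forall>\<^sub>R u. \<^bold>\<forall>\<^sub>R v. gap \<langle>f\<rangle> \<langle>r\<rangle> \<langle>tsuc n\<rangle> \<langle>m\<rangle> u v \<^bold>\<longrightarrow> \<^bold>\<bottom>"
    proof (rule world_all2_impI[OF T'])
      show "T' \<tturnstile> ?H'" using T' H' h(3) by simp
      fix u T2 v
      assume u: "is_real u" and *: "world T2" "T2 \<tturnstile> ?H'" "is_real v"
        and "T2 \<tturnstile> gap \<langle>f\<rangle> \<langle>r\<rangle> \<langle>tsuc n\<rangle> \<langle>m\<rangle> \<langle>u\<rangle> \<langle>v\<rangle>"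
      then have g: "T2 \<tturnstile> unit_interval \<langle>u\<rangle>" "T2 \<tturnstile> unit_interval \<langle>v\<rangle>"
        "lt T2 (rv u) (rv s)" "lt T2 (rv u + rv r + rv r) (rv v)"
        "lt T2 (rv (App f u)) (rv m)" "lt T2 (rv (App f v)) (rv m)"
        using gapD[OF *(1), of "tsuc n" m u v] n m(1) r by (simp_all add: s_def ev)
      have H2: "T2 \<tturnstile> pos_qc \<langle>f\<rangle>" "lt T2 0 (rv r)" "T2 \<tturnstile> \<^bold>\<forall>\<^sub>R u. \<^bold>\<forall>\<^sub>R v. gap \<langle>f\<rangle> \<langle>r\<rangle> \<langle>n\<rangle> \<langle>h\<rangle> u v \<^bold>\<longrightarrow> \<^bold>\<bottom>"
        using * r by (simp_all add: ev)
      \<comment> \<open>Cotransitivity places \<open>u\<close> left of \<open>n r\<close>, where the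
        induction hypothesis applies, or right of \<open>n r - r\<close>.\<close>
      have "lt T2 (rnat n * rv r - rv r) (rnat n * rv r)"
        by (rule ltI[OF *(1) H2(2)]) simp
      then consider "lt T2 (rv u) (rnat n * rv r)" | "lt T2 (rnat n * rv r - rv r) (rv u)"
        using lt_cotrans[OF *(1)] by blast
      then show "T2 \<tturnstile> \<^bold>\<bottom>"
      proof cases
        case 1
        have 3: "T2 \<tturnstile> gap \<langle>f\<rangle> \<langle>r\<rangle> \<langle>n\<rangle> \<langle>h\<rangle> \<langle>u\<rangle> \<langle>v\<rangle>"
          using gapD[OF *(1) n h(1) u *(3)] g 1 m(3)[OF *(1)] by blast
        show ?thesis
          by (rule world_all2_impD[OF *(1) H2(3) 3]) (use f r n h u * in simp_all)
      next
        case 2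
        have "eqr T2 (rv r * rnat (tsuc n)) (rv r * (rnat n + 1))"
          by (rule eqr_mul[OF *(1) rnat_Suc[OF *(1) n]])
        then have "le T2 (rv s) (rnat n * rv r + rv r)"
          using eqr_le[OF *(1)] n r by (simp add: s_def ev algebra_simps)
        \<comment> \<open>Here \<open>n r + r < u + 2 r < v\<close>: this uses up both steps of the
          gap and puts the new grid point between \<open>u\<close> and \<open>v\<close>.\<close>
        moreover have "lt T2 (rnat n * rv r + rv r) (rv v)"
          by (rule ltI[OF *(1) pos_add[OF *(1) ltD[OF *(1) 2] ltD[OF *(1) g(4)]]]) (simp add: algebra_simps)
        ultimately have sv: "lt T2 (rv s) (rv v)" by (rule le_lt_trans[OF *(1)])
        have "lt T2 (rv u) 1"
          using lt_le_trans[OF *(1) lt_trans[OF *(1) g(3) sv] unit_intervalD(2)[OF *(1) g(2) *(3)]] .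
        then have "lt T2 (rv u) (rv c)" "lt T2 (rv c) (rv v)"
          unfolding c_def using clamp_between[OF *(1) s] g(3) sv by blast+
        \<comment> \<open>Both \<open>f u\<close> and \<open>f v\<close> are below \<open>m\<close>,
          hence below \<open>f c\<close>; quasi-convexity then bounds \<open>f c\<close> by itself,
          strictly.\<close>
        then have "lt T2 (rv (App f c)) (rv (App f c))"
          using quasi_convex_between[OF *(1) H2(1) f(2) u *(3) c g(1,2)] m(3)[OF *(1)] g(5,6) by blast
        then show ?thesis using lt_irrefl[OF *(1)] by blast
      qed
    qed (use f r n m in simp_all)
    then have "T' \<tturnstile> \<^bold>0 \<^bold>< \<langle>m\<rangle> \<^bold>\<and> (\<^bold>\<forall>\<^sub>R u. \<^bold>\<forall>\<^sub>R v. gap \<langle>f\<rangle> \<langle>r\<rangle> \<langle>tsuc n\<rangle> \<langle>m\<rangle> u v \<^bold>\<longrightarrow> \<^bold>\<bottom>)"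
      using m T' by (simp add: ev)
    then show "T' \<tturnstile> ?F \<langle>tsuc n\<rangle>"
      by (rule world_exI[OF T' _ m(1)]) (use f r n in simp)
  qed
  then obtain h where "is_real h" "T \<tturnstile> \<^bold>0 \<^bold>< \<langle>h\<rangle> \<^bold>\<and> (\<^bold>\<forall>\<^sub>R u. \<^bold>\<forall>\<^sub>R v. gap \<langle>f\<rangle> \<langle>r\<rangle> \<langle>n\<rangle> \<langle>h\<rangle> u v \<^bold>\<longrightarrow> \<^bold>\<bottom>)"
    by (rule world_exE[OF T]) (use f r n in simp_all)
  then show thesis using that T by (simp add: ev)
qed

section \<open>Clustering of the points with small values\<close>

definition low :: "tm \<Rightarrow> tm \<Rightarrow> tm \<Rightarrow> form" where
  "low f h u = (unit_interval u \<^bold>\<and> f \<^bold>\<cdot> u \<^bold>< h)"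

definition modulus :: "tm \<Rightarrow> tm \<Rightarrow> tm \<Rightarrow> form" where
  "modulus f h e = (\<^bold>\<forall>\<^sub>R u. \<^bold>\<forall>\<^sub>R v. low f h u \<^bold>\<and> low f h v \<^bold>\<longrightarrow> real_abs (u \<^bold>- v) \<^bold>< e)"

text \<open>This describes the limit of a minimising sequence without mentioning the sequence, so
  that limits of different sequences can be compared. It says nothing about the value at
  \<open>z\<close>.\<close>

definition concentrates :: "tm \<Rightarrow> tm \<Rightarrow> form" where
  "concentrates f z =
     (\<^bold>\<forall>\<^sub>R e. \<^bold>0 \<^bold>< e \<^bold>\<longrightarrow> (\<^bold>\<exists>\<^sub>R h. \<^bold>0 \<^bold>< h \<^bold>\<and> (\<^bold>\<forall>\<^sub>R u. low f h u \<^bold>\<longrightarrow> real_abs (u \<^bold>- z) \<^bold>< e)))"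

lemma rel_low [simp]:
  "rel_tm p \<theta> k f f' \<Longrightarrow> rel_tm p \<theta> k h h' \<Longrightarrow> rel_tm p \<theta> k u u' \<Longrightarrow> rel_form p \<theta> k (low f h u) (low f' h' u')"
  by (simp add: low_def)

lemma rel_modulus [simp]:
  "(\<And>j. k \<le> j \<Longrightarrow> rel_tm p \<theta> j f f') \<Longrightarrow> (\<And>j. k \<le> j \<Longrightarrow> rel_tm p \<theta> j h h') \<Longrightarrow>
   (\<And>j. k \<le> j \<Longrightarrow> rel_tm p \<theta> j e e') \<Longrightarrow> rel_form p \<theta> k (modulus f h e) (modulus f' h' e')"
  by (simp add: modulus_def)

lemma rel_concentrates [simp]:
  "(\<And>j. k \<le> j \<Longrightarrow> rel_tm p \<theta> j f f') \<Longrightarrow> (\<And>j. k \<le> j \<Longrightarrow> rel_tm p \<theta> j z z') \<Longrightarrow>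
   rel_form p \<theta> k (concentrates f z) (concentrates f' z')"
  by (simp add: concentrates_def)

lemma holds_low:
  assumes "world T" "is_fun f" "is_real h" "is_real u"
  shows "(T \<tturnstile> low \<langle>f\<rangle> \<langle>h\<rangle> \<langle>u\<rangle>) \<longleftrightarrow> (T \<tturnstile> unit_interval \<langle>u\<rangle>) \<and> lt T (rv (App f u)) (rv h)"
  using assms by (simp add: low_def ev)

lemma holds_abs_diff:
  assumes "world T" "is_real u" "is_real v" "is_real e"
  shows "(T \<tturnstile> real_abs (\<langle>u\<rangle> \<^bold>- \<langle>v\<rangle>) \<^bold>< \<langle>e\<rangle>) \<longleftrightarrow> lt T (rv u - rv v) (rv e) \<and> lt T (rv v - rv u) (rv e)"
  using assms abs_less_iff[of T "tsub u v" "rv e"] by (simp add: ev)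

text \<open>A third of \<open>e\<close> serves; a half would not make the second inequality
  strict.\<close>

lemma fraction_ex:
  assumes T: "world T" and e: "is_real e" "lt T 0 (rv e)"
  obtains r where "is_real r" "lt T 0 (rv r)" "lt T (rv r + rv r) (rv e)"
proof -
  let ?t = "tadd (tadd (Con CROne) (Con CROne)) (Con CROne)"
  have t: "rv ?t = 1 + 1 + 1" by (simp add: ev)
  have "lt T 0 (rv ?t)" unfolding t by (intro pos_add[OF T] lt_zero_one[OF T])
  then obtain w where w: "is_real w" "lt T 0 (rv w)" "eqr T (rv ?t * rv w) 1"
    using inverse_ex[OF T, of ?t] by auto
  let ?r = "tmul e w"
  have r: "is_real ?r" "rv ?r = rv e * rv w" using e w by (simp_all add: ev)
  have pos: "lt T 0 (rv ?r)" unfolding r by (rule lt_mul[OF T e(2) w(2)])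
  have "eqr T (rv e * (rv ?t * rv w)) (rv e * 1)" by (rule eqr_mul[OF T w(3)])
  then have "le T (rv ?r + rv ?r + rv ?r) (rv e)" using eqr_le[OF T] by (simp add: t r algebra_simps)
  moreover have "lt T (rv ?r + rv ?r) (rv ?r + rv ?r + rv ?r)" by (rule ltI[OF T pos]) simp
  ultimately show thesis using that[OF r(1) pos] lt_le_trans[OF T] by blast
qed

lemma archimedes_mul:
  assumes T: "world T" and h: "is_real h" "lt T 0 (rv h)"
  obtains k where "is_nat k" "lt T 1 (rnat k * rv h)"
proof -
  obtain w where w: "is_real w" "lt T 0 (rv w)" "eqr T (rv h * rv w) 1" by (rule inverse_ex[OF T h(2,1)])
  obtain k where k: "is_nat k" "lt T (rv w) (rnat k)" by (rule archimedes[OF T])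
  have "lt T (rv h * rv w) (rnat k * rv h)"
    by (rule ltI[OF T lt_mul[OF T ltD[OF T k(2)] h(2)]]) (simp add: algebra_simps)
  then have "lt T 1 (rnat k * rv h)" using le_lt_trans[OF T eqr_le[OF T eqr_sym[OF T w(3)]]] by blast
  with k that show thesis by blast
qed

text \<open>From \<open>k x < 1 < k h\<close> the factor \<open>k\<close> is cancelled by
  \<open>pos_mulD\<close>, for which its being non-negative suffices.\<close>

lemma small_of_mul_less:
  assumes T: "world T" and k: "is_nat k" "lt T 1 (rnat k * h)" and x: "lt T (rnat k * x) 1"
  shows "lt T x h"
proof -
  have "lt T 0 (rnat k * (h - x))"
    using ltD[OF T lt_trans[OF T x k(2)]] by (simp add: algebra_simps)
  then show ?thesis using pos_mulD[OF T rnat_nonneg[OF T k(1)]] ltI[OF T] by blast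
qed

text \<open>Once the grid reaches beyond 1, every \<open>u\<close> in the unit interval is left of
  its last point. Then \<open>no_gap\<close> forbids low points at a distance above
  \<open>2 r\<close>, and \<open>2 r < e\<close>.\<close>

lemma modulus_ex:
  assumes T: "world T" and f: "T \<tturnstile> pos_qc \<langle>f\<rangle>" "is_fun f" and e: "is_real e" "lt T 0 (rv e)"
  obtains h where "is_real h" "lt T 0 (rv h)" "T \<tturnstile> modulus \<langle>f\<rangle> \<langle>h\<rangle> \<langle>e\<rangle>"
proof -
  obtain r where r: "is_real r" "lt T 0 (rv r)" "lt T (rv r + rv r) (rv e)" by (rule fraction_ex[OF T e])
  obtain k where k: "is_nat k" "lt T 1 (rnat k * rv r)" by (rule archimedes_mul[OF T r(1,2)])
  obtain h where h: "is_real h" "lt T 0 (rv h)" "T \<tturnstile> \<^bold>\<forall>\<^sub>R u. \<^bold>\<forall>\<^sub>R v. gap \<langle>f\<rangle> \<langle>r\<rangle> \<langle>k\<rangle> \<langle>h\<rangle> u v \<^bold>\<longrightarrow> \<^bold>\<bottom>"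
    by (rule no_gap[OF T f r(2,1) k(1)])
  let ?G = "\<^bold>\<forall>\<^sub>R u. \<^bold>\<forall>\<^sub>R v. gap \<langle>f\<rangle> \<langle>r\<rangle> \<langle>k\<rangle> \<langle>h\<rangle> u v \<^bold>\<longrightarrow> \<^bold>\<bottom>"
  let ?H = "?G \<^bold>\<and> \<^bold>1 \<^bold>< real_of \<langle>k\<rangle> \<^bold>* \<langle>r\<rangle> \<^bold>\<and> \<langle>r\<rangle> \<^bold>+ \<langle>r\<rangle> \<^bold>< \<langle>e\<rangle>"
  have "T \<tturnstile> modulus \<langle>f\<rangle> \<langle>h\<rangle> \<langle>e\<rangle>"
    unfolding modulus_def
  proof (rule world_all2_impI[OF T])
    show "T \<tturnstile> ?H" using T e r k h by (simp add: ev)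
    fix T' u v
    assume T': "world T'" and H: "T' \<tturnstile> ?H" and uv: "is_real u" "is_real v"
      and "T' \<tturnstile> low \<langle>f\<rangle> \<langle>h\<rangle> \<langle>u\<rangle> \<^bold>\<and> low \<langle>f\<rangle> \<langle>h\<rangle> \<langle>v\<rangle>"
    then have low: "T' \<tturnstile> low \<langle>f\<rangle> \<langle>h\<rangle> \<langle>u\<rangle>" "T' \<tturnstile> low \<langle>f\<rangle> \<langle>h\<rangle> \<langle>v\<rangle>" by simp_all
    have G: "T' \<tturnstile> ?G" and kr: "lt T' 1 (rnat k * rv r)" and re: "lt T' (rv r + rv r) (rv e)"
      using T' H e r k by (simp_all add: ev)
    have le: "lt T' (rv v - rv u) (rv e)"
      if "is_real u" "is_real v" "T' \<tturnstile> low \<langle>f\<rangle> \<langle>h\<rangle> \<langle>u\<rangle>" "T' \<tturnstile> low \<langle>f\<rangle> \<langle>h\<rangle> \<langle>v\<rangle>" for u v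
    proof -
      have u: "T' \<tturnstile> unit_interval \<langle>u\<rangle>" using holds_low[OF T' f(2) h(1)] that by blast
      have "le T' (rv v) (rv u + rv r + rv r)"
      proof (rule ccontr)
        assume "\<not> ?thesis"
        then have "T' \<tturnstile> gap \<langle>f\<rangle> \<langle>r\<rangle> \<langle>k\<rangle> \<langle>h\<rangle> \<langle>u\<rangle> \<langle>v\<rangle>"
          using that holds_low[OF T' f(2) h(1)] le_lt_trans[OF T' unit_intervalD(2)[OF T' u] kr] f r k h T'
          by (simp add: gap_def ev le_def)
        then have "T' \<tturnstile> \<^bold>\<bottom>"
          by (rule world_all2_impD[OF T' G]) (use that f r k h in simp_all)
        then show False using T' by simp
      qed
      then have "lt T' 0 ((rv e - (rv r + rv r)) + ((rv u + rv r + rv r) - rv v))"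
        using pos_add_nonneg[OF T' ltD[OF T' re] leD[OF T']] by blast
      then show ?thesis by (rule ltI[OF T']) (simp add: algebra_simps)
    qed
    show "T' \<tturnstile> real_abs (\<langle>u\<rangle> \<^bold>- \<langle>v\<rangle>) \<^bold>< \<langle>e\<rangle>"
      using le low uv holds_abs_diff[OF T' uv e(1)] by blast
  qed (use f h e in simp_all)
  with h that show thesis by blast
qed

lemma modulusD:
  assumes "world T" "T \<tturnstile> modulus \<langle>f\<rangle> \<langle>h\<rangle> \<langle>e\<rangle>" "is_fun f" "is_real h" "is_real e" "is_real u" "is_real v"
    "T \<tturnstile> low \<langle>f\<rangle> \<langle>h\<rangle> \<langle>u\<rangle>" "T \<tturnstile> low \<langle>f\<rangle> \<langle>h\<rangle> \<langle>v\<rangle>"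
  shows "T \<tturnstile> real_abs (\<langle>u\<rangle> \<^bold>- \<langle>v\<rangle>) \<^bold>< \<langle>e\<rangle>"
proof -
  have 1: "T \<tturnstile> \<^bold>\<forall>\<^sub>R u. \<^bold>\<forall>\<^sub>R v. low \<langle>f\<rangle> \<langle>h\<rangle> u \<^bold>\<and> low \<langle>f\<rangle> \<langle>h\<rangle> v \<^bold>\<longrightarrow> real_abs (u \<^bold>- v) \<^bold>< \<langle>e\<rangle>"
    using assms by (simp add: modulus_def)
  have 2: "T \<tturnstile> low \<langle>f\<rangle> \<langle>h\<rangle> \<langle>u\<rangle> \<^bold>\<and> low \<langle>f\<rangle> \<langle>h\<rangle> \<langle>v\<rangle>" using assms by simp
  show ?thesis
    by (rule world_all2_impD[OF assms(1) 1 2]) (use assms in simp_all)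
qed

section \<open>Minimising sequences that may stop\<close>

text \<open>
  The values of \<open>a\<close> control a minimising sequence \<open>y\<close>: where \<open>a n = 0\<close>, a point with \<open>n f (y n) < 1\<close> is
  chosen, elsewhere \<open>y n\<close> repeats its predecessor.
\<close>

definition dead :: "tm \<Rightarrow> form" where
  "dead a = (\<^bold>\<exists>\<^sub>N n. \<^bold>\<not> (a \<^bold>\<cdot> n \<^bold>= \<^bold>0\<^sub>N))"

text \<open>The nonzero entries of \<open>a\<close> need not form a final segment: where both
  alternatives hold, choice may take either one. Hence a single nonzero entry is only required to
  force nonzero entries from some stage on.\<close>

definition switch :: "tm \<Rightarrow> tm \<Rightarrow> form" where
  "switch f a = (pos_qc f \<^bold>\<and> (\<^bold>\<forall>\<^sub>N n. a \<^bold>\<cdot> n \<^bold>= \<^bold>0\<^sub>N \<^bold>\<or> \<^bold>\<not> (a \<^bold>\<cdot> n \<^bold>= \<^bold>0\<^sub>N)) \<^bold>\<and>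
     (\<^bold>\<forall>\<^sub>N n. a \<^bold>\<cdot> n \<^bold>= \<^bold>0\<^sub>N \<^bold>\<longrightarrow> (\<^bold>\<exists>\<^sub>R u. unit_interval u \<^bold>\<and> real_of n \<^bold>* (f \<^bold>\<cdot> u) \<^bold>< \<^bold>1)) \<^bold>\<and>
     (\<^bold>\<forall>\<^sub>N n. \<^bold>\<not> (a \<^bold>\<cdot> n \<^bold>= \<^bold>0\<^sub>N) \<^bold>\<longrightarrow> (\<^bold>\<exists>\<^sub>N k. \<^bold>\<forall>\<^sub>N i. k \<^bold>\<le>\<^sub>N i \<^bold>\<longrightarrow> \<^bold>\<not> (a \<^bold>\<cdot> i \<^bold>= \<^bold>0\<^sub>N))))"

text \<open>A repeated point keeps its old value, which need not be below \<open>1/n\<close> at the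
  later stage; the disjunct \<open>dead a\<close> admits this.\<close>

definition trace :: "tm \<Rightarrow> tm \<Rightarrow> tm \<Rightarrow> form" where
  "trace f a y = ((\<^bold>\<forall>\<^sub>N n. unit_interval (y \<^bold>\<cdot> n) \<^bold>\<and> (real_of n \<^bold>* (f \<^bold>\<cdot> (y \<^bold>\<cdot> n)) \<^bold>< \<^bold>1 \<^bold>\<or> dead a)) \<^bold>\<and>
     (\<^bold>\<forall>\<^sub>N n. (a \<^bold>\<cdot> nat_suc n \<^bold>= \<^bold>0\<^sub>N \<^bold>\<and> real_of (nat_suc n) \<^bold>* (f \<^bold>\<cdot> (y \<^bold>\<cdot> nat_suc n)) \<^bold>< \<^bold>1) \<^bold>\<or>
         (\<^bold>\<not> (a \<^bold>\<cdot> nat_suc n \<^bold>= \<^bold>0\<^sub>N) \<^bold>\<and> y \<^bold>\<cdot> nat_suc n \<^bold>= y \<^bold>\<cdot> n)))"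

lemma rel_dead [simp]:
  "(\<And>j. k \<le> j \<Longrightarrow> rel_tm p \<theta> j s s') \<Longrightarrow> rel_form p \<theta> k (dead s) (dead s')"
  by (simp add: dead_def)

lemma rel_switch [simp]:
  "(\<And>j. k \<le> j \<Longrightarrow> rel_tm p \<theta> j s s') \<Longrightarrow> (\<And>j. k \<le> j \<Longrightarrow> rel_tm p \<theta> j t t') \<Longrightarrow>
   rel_form p \<theta> k (switch s t) (switch s' t')"
  by (simp add: switch_def)

abbreviation is_nseq :: "trm \<Rightarrow> bool" where "is_nseq a \<equiv> ty_of a = Some (NatT \<rightarrow> NatT)"
abbreviation is_rseq :: "trm \<Rightarrow> bool" where "is_rseq a \<equiv> ty_of a = Some (NatT \<rightarrow> RealT)"

context
  fixes T f a
  assumes T: "world T" and switch: "T \<tturnstile> switch \<langle>f\<rangle> \<langle>a\<rangle>" and f: "is_fun f" and a: "is_nseq a"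
begin

lemma switch_pos_qc: "T \<tturnstile> pos_qc \<langle>f\<rangle>"
  using T switch by (simp add: switch_def)

lemma switch_cases:
  assumes "is_nat n"
  shows "(T \<tturnstile> \<langle>App a n\<rangle> \<^bold>= \<^bold>0\<^sub>N) \<or> (T \<tturnstile> \<^bold>\<not> (\<langle>App a n\<rangle> \<^bold>= \<^bold>0\<^sub>N))"
proof -
  have "T \<tturnstile> \<^bold>\<forall>\<^sub>N n. \<langle>a\<rangle> \<^bold>\<cdot> n \<^bold>= \<^bold>0\<^sub>N \<^bold>\<or> \<^bold>\<not> (\<langle>a\<rangle> \<^bold>\<cdot> n \<^bold>= \<^bold>0\<^sub>N)"
    using T switch by (simp add: switch_def)
  from world_all[OF T this] show ?thesis using assms a T by simp
qed

lemma switch_alive: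
  assumes "is_nat n" "T \<tturnstile> \<langle>App a n\<rangle> \<^bold>= \<^bold>0\<^sub>N"
  obtains u where "is_real u" "T \<tturnstile> unit_interval \<langle>u\<rangle>" "lt T (rnat n * rv (App f u)) 1"
proof -
  have 1: "T \<tturnstile> \<^bold>\<forall>\<^sub>N n. \<langle>a\<rangle> \<^bold>\<cdot> n \<^bold>= \<^bold>0\<^sub>N \<^bold>\<longrightarrow> (\<^bold>\<exists>\<^sub>R u. unit_interval u \<^bold>\<and> real_of n \<^bold>* (\<langle>f\<rangle> \<^bold>\<cdot> u) \<^bold>< \<^bold>1)"
    using T switch by (simp add: switch_def)
  have 2: "T \<tturnstile> \<^bold>\<exists>\<^sub>R u. unit_interval u \<^bold>\<and> real_of \<langle>n\<rangle> \<^bold>* (\<langle>f\<rangle> \<^bold>\<cdot> u) \<^bold>< \<^bold>1"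
    by (rule world_all_impD[OF T 1, of n]) (use assms a f in simp_all)
  obtain u where "is_real u" "T \<tturnstile> unit_interval \<langle>u\<rangle> \<^bold>\<and> real_of \<langle>n\<rangle> \<^bold>* (\<langle>f\<rangle> \<^bold>\<cdot> \<langle>u\<rangle>) \<^bold>< \<^bold>1"
    by (rule world_exE[OF T 2]) (use assms a f in simp_all)
  then show thesis using that[of u] T f assms by (simp add: ev)
qed

lemma switch_dead:
  assumes "T \<tturnstile> dead \<langle>a\<rangle>"
  obtains k where "is_nat k" "T \<tturnstile> \<^bold>\<forall>\<^sub>N i. \<langle>k\<rangle> \<^bold>\<le>\<^sub>N i \<^bold>\<longrightarrow> \<^bold>\<not> (\<langle>a\<rangle> \<^bold>\<cdot> i \<^bold>= \<^bold>0\<^sub>N)"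
proof -
  have 1: "T \<tturnstile> \<^bold>\<forall>\<^sub>N n. \<^bold>\<not> (\<langle>a\<rangle> \<^bold>\<cdot> n \<^bold>= \<^bold>0\<^sub>N) \<^bold>\<longrightarrow> (\<^bold>\<exists>\<^sub>N k. \<^bold>\<forall>\<^sub>N i. k \<^bold>\<le>\<^sub>N i \<^bold>\<longrightarrow> \<^bold>\<not> (\<langle>a\<rangle> \<^bold>\<cdot> i \<^bold>= \<^bold>0\<^sub>N))"
    using T switch by (simp add: switch_def)
  obtain n where n: "is_nat n" "T \<tturnstile> \<^bold>\<not> (\<langle>a\<rangle> \<^bold>\<cdot> \<langle>n\<rangle> \<^bold>= \<^bold>0\<^sub>N)"
    by (rule world_exE[OF T assms[unfolded dead_def]]) (use a in simp_all)
  have 2: "T \<tturnstile> \<^bold>\<exists>\<^sub>N k. \<^bold>\<forall>\<^sub>N i. k \<^bold>\<le>\<^sub>N i \<^bold>\<longrightarrow> \<^bold>\<not> (\<langle>a\<rangle> \<^bold>\<cdot> i \<^bold>= \<^bold>0\<^sub>N)"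
    by (rule world_all_impD[OF T 1 n(2,1)]) (use a in simp_all)
  show thesis
    by (rule world_exE[OF T 2]) (use a that in simp_all)
qed

end

lemma world_subst2:
  assumes T: "world T" and P: "par2 P" and st: "T \<tturnstile> \<langle>s\<rangle> \<^bold>= \<langle>s'\<rangle>" "T \<tturnstile> \<langle>t\<rangle> \<^bold>= \<langle>t'\<rangle>" "T \<tturnstile> P \<langle>s\<rangle> \<langle>t\<rangle>"
    and ty: "ty_of s = Some \<sigma>" "ty_of s' = Some \<sigma>" "ty_of t = Some \<tau>" "ty_of t' = Some \<tau>"
  shows "T \<tturnstile> P \<langle>s'\<rangle> \<langle>t'\<rangle>"
proof -
  have "par (\<lambda>x. P x \<langle>t\<rangle>)" using P ty by (simp add: par2_def)
  then have "T \<tturnstile> P \<langle>s'\<rangle> \<langle>t\<rangle>" using world_subst[OF T st(1), of "\<lambda>x. P x \<langle>t\<rangle>"] st(3) ty by blast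
  moreover have "par (\<lambda>x. P \<langle>s'\<rangle> x)" using P ty by (simp add: par2_def)
  ultimately show ?thesis using world_subst[OF T st(2), of "\<lambda>x. P \<langle>s'\<rangle> x"] ty by blast
qed

abbreviation "tpair x y \<equiv> App (App (Con (CPair NatT RealT)) x) y"
abbreviation "tfst z \<equiv> App (Con (CFst NatT RealT)) z"
abbreviation "tsnd z \<equiv> App (Con (CSnd NatT RealT)) z"

lemma pair_eqs:
  assumes "world T" "is_nat x" "is_real y"
  shows "T \<tturnstile> \<langle>tfst (tpair x y)\<rangle> \<^bold>= \<langle>x\<rangle>" "T \<tturnstile> \<langle>tsnd (tpair x y)\<rangle> \<^bold>= \<langle>y\<rangle>"
  using world_axiom2[OF assms(1) first_pair assms(2,3)] world_axiom2[OF assms(1) second_pair assms(2,3)]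
    assms by simp_all

lemma world_pair:
  assumes "world T" "par2 P" "is_nat x" "is_real y" "T \<tturnstile> P \<langle>x\<rangle> \<langle>y\<rangle>"
  shows "T \<tturnstile> P \<langle>tfst (tpair x y)\<rangle> \<langle>tsnd (tpair x y)\<rangle>"
  by (rule world_subst2[OF assms(1,2) world_sym[OF assms(1) pair_eqs(1)] world_sym[OF assms(1) pair_eqs(2)] assms(5)])
    (use assms in simp_all)

text \<open>The next point depends on the stage, which the relation in dependent choice cannot see.
  The choices are therefore made among pairs of a stage and a point, and the points are extracted
  afterwards.\<close>

lemma trace_ex:
  assumes T: "world T" and sw: "T \<tturnstile> switch \<langle>f\<rangle> \<langle>a\<rangle>" and f: "is_fun f" and a: "is_nseq a"
  obtains y where "is_rseq y" "T \<tturnstile> trace \<langle>f\<rangle> \<langle>a\<rangle> \<langle>y\<rangle>"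
proof -
  let ?\<sigma> = "NatT \<otimes> RealT"
  let ?fst = "first NatT RealT" let ?snd = "second NatT RealT"
  define G where "G = (\<lambda>n u. unit_interval u \<^bold>\<and> (real_of n \<^bold>* (\<langle>f\<rangle> \<^bold>\<cdot> u) \<^bold>< \<^bold>1 \<^bold>\<or> dead \<langle>a\<rangle>))"
  define Q where "Q = (\<lambda>n u v. (\<langle>a\<rangle> \<^bold>\<cdot> n \<^bold>= \<^bold>0\<^sub>N \<^bold>\<and> real_of n \<^bold>* (\<langle>f\<rangle> \<^bold>\<cdot> u) \<^bold>< \<^bold>1) \<^bold>\<or> (\<^bold>\<not> (\<langle>a\<rangle> \<^bold>\<cdot> n \<^bold>= \<^bold>0\<^sub>N) \<^bold>\<and> u \<^bold>= v))"
  have rel [simp]: "\<And>p \<theta> k n n' u u'. rel_tm p \<theta> k n n' \<Longrightarrow> rel_tm p \<theta> k u u' \<Longrightarrow> rel_form p \<theta> k (G n u) (G n' u')"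
    "\<And>p \<theta> k n n' u u' v v'. rel_tm p \<theta> k n n' \<Longrightarrow> rel_tm p \<theta> k u u' \<Longrightarrow> rel_tm p \<theta> k v v' \<Longrightarrow>
      rel_form p \<theta> k (Q n u v) (Q n' u' v')"
    using f a by (simp_all add: G_def Q_def)
  let ?F = "\<lambda>s. G (?fst s) (?snd s)"
  let ?P = "\<lambda>s s'. ?fst s' \<^bold>= nat_suc (?fst s) \<^bold>\<and> Q (?fst s') (?snd s') (?snd s)"
  \<comment> \<open>The start is the pair (0, 0): at stage 0 the product \<open>0 * f 0\<close> is
    below 1 whatever the value is.\<close>
  have init: "T \<tturnstile> ?F \<langle>tpair (Con CNZero) (Con CRZero)\<rangle>"
  proof -
    have "T \<tturnstile> unit_interval \<langle>Con CRZero\<rangle>"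
      by (rule unit_intervalI[OF T holds_verum[OF T]])
        (simp_all add: ev le_refl lt_imp_le lt_zero_one)
    moreover have "lt T (rnat (Con CNZero) * rv (App f (Con CRZero))) 1"
      using le_lt_trans[OF T eqr_le[OF T eqr_mul_zero[OF T rnat_0[OF T]]] lt_zero_one[OF T]] .
    ultimately have "T \<tturnstile> G \<langle>Con CNZero\<rangle> \<langle>Con CRZero\<rangle>" using T f by (simp add: G_def ev)
    then show ?thesis using world_pair[OF T, of G "Con CNZero" "Con CRZero"] by simp
  qed
  have step: "\<exists>y. ty_of y = Some ?\<sigma> \<and> (T' \<tturnstile> ?F \<langle>y\<rangle>) \<and> (T' \<tturnstile> ?P \<langle>x\<rangle> \<langle>y\<rangle>)"
    if T': "world T'" and sw': "T' \<tturnstile> switch \<langle>f\<rangle> \<langle>a\<rangle>" and x: "ty_of x = Some ?\<sigma>" and F: "T' \<tturnstile> ?F \<langle>x\<rangle>" for T' x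
  proof -
    let ?n = "tsuc (tfst x)"
    have n: "is_nat ?n" and xr: "is_real (tsnd x)" using x by simp_all
    have "\<exists>u. is_real u \<and> (T' \<tturnstile> G \<langle>?n\<rangle> \<langle>u\<rangle>) \<and> (T' \<tturnstile> Q \<langle>?n\<rangle> \<langle>u\<rangle> \<langle>tsnd x\<rangle>)"
      using switch_cases[OF T' sw' f a n]
    proof
      assume alive: "T' \<tturnstile> \<langle>App a ?n\<rangle> \<^bold>= \<^bold>0\<^sub>N"
      then obtain u where "is_real u" "T' \<tturnstile> unit_interval \<langle>u\<rangle>" "lt T' (rnat ?n * rv (App f u)) 1"
        by (rule switch_alive[OF T' sw' f a n])
      then show ?thesis using alive T' f n by (intro exI[of _ u]) (simp add: G_def Q_def ev)
    next
      assume stop: "T' \<tturnstile> \<^bold>\<not> (\<langle>App a ?n\<rangle> \<^bold>= \<^bold>0\<^sub>N)"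
      then have "T' \<tturnstile> dead \<langle>a\<rangle>"
        unfolding dead_def by (intro world_exI[OF T' _ n]) (use a in simp_all)
      moreover have "T' \<tturnstile> unit_interval \<langle>tsnd x\<rangle>" using F T' by (simp add: G_def)
      moreover have "T' \<tturnstile> \<langle>tsnd x\<rangle> \<^bold>= \<langle>tsnd x\<rangle>" using T' by (simp add: world_refl)
      ultimately show ?thesis using stop T' xr by (intro exI[of _ "tsnd x"]) (simp add: G_def Q_def)
    qed
    then obtain u where u: "is_real u" "T' \<tturnstile> G \<langle>?n\<rangle> \<langle>u\<rangle>" "T' \<tturnstile> Q \<langle>?n\<rangle> \<langle>u\<rangle> \<langle>tsnd x\<rangle>" by blast
    have "T' \<tturnstile> ?F \<langle>tpair ?n u\<rangle>"
      using world_pair[OF T', of G ?n u] n u by simp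
    moreover have "T' \<tturnstile> ?P \<langle>x\<rangle> \<langle>tpair ?n u\<rangle>"
      using world_pair[OF T', of "\<lambda>m v. Q m v \<langle>tsnd x\<rangle>" ?n u] pair_eqs(1)[OF T' n u(1)] n u xr T' by simp
    ultimately show ?thesis using n u by (intro exI[of _ "tpair ?n u"]) simp
  qed
  obtain g where g: "ty_of g = Some (NatT \<rightarrow> ?\<sigma>)" and g0: "T \<tturnstile> \<langle>g\<rangle> \<^bold>\<cdot> \<^bold>0\<^sub>N \<^bold>= \<langle>tpair (Con CNZero) (Con CRZero)\<rangle>"
    and gF: "T \<tturnstile> \<^bold>\<forall>\<^sub>N n. ?F (\<langle>g\<rangle> \<^bold>\<cdot> n)" and gP: "T \<tturnstile> \<^bold>\<forall>\<^sub>N n. ?P (\<langle>g\<rangle> \<^bold>\<cdot> n) (\<langle>g\<rangle> \<^bold>\<cdot> nat_suc n)"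
    by (rule world_dependent_choice[OF T sw, of ?F ?P ?\<sigma> "tpair (Con CNZero) (Con CRZero)"])
      (use step init in simp_all)
  \<comment> \<open>The first component of the \<open>n\<close>-th pair is \<open>n\<close>, by
    induction from the start value and the successor clause of \<open>?P\<close>.\<close>
  have index: "T' \<tturnstile> \<langle>tfst (App g n)\<rangle> \<^bold>= \<langle>n\<rangle>"
    if T': "world T'" and "T' \<tturnstile> \<langle>g\<rangle> \<^bold>\<cdot> \<^bold>0\<^sub>N \<^bold>= \<langle>tpair (Con CNZero) (Con CRZero)\<rangle>"
      "T' \<tturnstile> \<^bold>\<forall>\<^sub>N n. ?P (\<langle>g\<rangle> \<^bold>\<cdot> n) (\<langle>g\<rangle> \<^bold>\<cdot> nat_suc n)" and n: "is_nat n" for T' n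
  proof -
    let ?H = "\<langle>g\<rangle> \<^bold>\<cdot> \<^bold>0\<^sub>N \<^bold>= \<langle>tpair (Con CNZero) (Con CRZero)\<rangle> \<^bold>\<and> (\<^bold>\<forall>\<^sub>N n. ?P (\<langle>g\<rangle> \<^bold>\<cdot> n) (\<langle>g\<rangle> \<^bold>\<cdot> nat_suc n))"
    have "T' \<tturnstile> ?fst (\<langle>g\<rangle> \<^bold>\<cdot> \<langle>n\<rangle>) \<^bold>= \<langle>n\<rangle>"
    proof (rule world_induct[OF T', of ?H "\<lambda>n. ?fst (\<langle>g\<rangle> \<^bold>\<cdot> n) \<^bold>= n"])
      show "T' \<tturnstile> ?H" using that by simp
      have "T' \<tturnstile> \<langle>tfst (App g (Con CNZero))\<rangle> \<^bold>= \<langle>tfst (tpair (Con CNZero) (Con CRZero))\<rangle>"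
        by (rule world_cong[OF T', of _ _ _ ?\<sigma> NatT]) (use that g in \<open>simp_all\<close>)
      from world_trans[OF T' this pair_eqs(1)[OF T']]
      show "T' \<tturnstile> ?fst (\<langle>g\<rangle> \<^bold>\<cdot> \<langle>Con CNZero\<rangle>) \<^bold>= \<langle>Con CNZero\<rangle>" using g by simp
    next
      fix T'' m assume *: "world T''" "T'' \<tturnstile> ?H" "is_nat m" "T'' \<tturnstile> ?fst (\<langle>g\<rangle> \<^bold>\<cdot> \<langle>m\<rangle>) \<^bold>= \<langle>m\<rangle>"
      have "T'' \<tturnstile> \<^bold>\<forall>\<^sub>N n. ?P (\<langle>g\<rangle> \<^bold>\<cdot> n) (\<langle>g\<rangle> \<^bold>\<cdot> nat_suc n)" using * by simp
      from world_all[OF *(1) this _ *(3)] have "T'' \<tturnstile> \<langle>tfst (App g (tsuc m))\<rangle> \<^bold>= \<langle>tsuc (tfst (App g m))\<rangle>"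
        using g *(1) by simp
      moreover have "T'' \<tturnstile> \<langle>tsuc (tfst (App g m))\<rangle> \<^bold>= \<langle>tsuc m\<rangle>"
        by (rule world_cong[OF *(1), of _ _ _ NatT NatT]) (use * g in simp_all)
      ultimately have "T'' \<tturnstile> \<langle>tfst (App g (tsuc m))\<rangle> \<^bold>= \<langle>tsuc m\<rangle>"
        by (rule world_trans[OF *(1)]) (use * g in simp_all)
      then show "T'' \<tturnstile> ?fst (\<langle>g\<rangle> \<^bold>\<cdot> \<langle>tsuc m\<rangle>) \<^bold>= \<langle>tsuc m\<rangle>" by simp
    qed (use n g in simp_all)
    then show ?thesis by simp
  qed
  \<comment> \<open>The term language has no abstraction, so the sequence of second components is
    itself obtained by countable choice.\<close>
  obtain y where y: "is_rseq y" and yg: "T \<tturnstile> \<^bold>\<forall>\<^sub>N n. \<langle>y\<rangle> \<^bold>\<cdot> n \<^bold>= ?snd (\<langle>g\<rangle> \<^bold>\<cdot> n)"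
  proof (rule world_choice[OF T holds_verum[OF T], of "\<lambda>n v. v \<^bold>= ?snd (\<langle>g\<rangle> \<^bold>\<cdot> n)" RealT])
    show "\<exists>v. is_real v \<and> (T' \<tturnstile> \<langle>v\<rangle> \<^bold>= ?snd (\<langle>g\<rangle> \<^bold>\<cdot> \<langle>n\<rangle>))" if "world T'" "is_nat n" for T' n
      using that g by (intro exI[of _ "tsnd (App g n)"]) (simp add: world_refl)
  qed (use g in simp_all)
  let ?H = "(\<langle>g\<rangle> \<^bold>\<cdot> \<^bold>0\<^sub>N \<^bold>= \<langle>tpair (Con CNZero) (Con CRZero)\<rangle>) \<^bold>\<and> (\<^bold>\<forall>\<^sub>N n. ?F (\<langle>g\<rangle> \<^bold>\<cdot> n)) \<^bold>\<and>
    (\<^bold>\<forall>\<^sub>N n. ?P (\<langle>g\<rangle> \<^bold>\<cdot> n) (\<langle>g\<rangle> \<^bold>\<cdot> nat_suc n)) \<^bold>\<and> (\<^bold>\<forall>\<^sub>N n. \<langle>y\<rangle> \<^bold>\<cdot> n \<^bold>= ?snd (\<langle>g\<rangle> \<^bold>\<cdot> n))"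
  have H: "T \<tturnstile> ?H" using T g0 gF gP yg by simp
  have facts: "T' \<tturnstile> \<langle>tfst (App g n)\<rangle> \<^bold>= \<langle>n\<rangle>" "T' \<tturnstile> \<langle>tsnd (App g n)\<rangle> \<^bold>= \<langle>App y n\<rangle>"
      "T' \<tturnstile> G \<langle>tfst (App g n)\<rangle> \<langle>tsnd (App g n)\<rangle>"
      "T' \<tturnstile> Q \<langle>tfst (App g (tsuc n))\<rangle> \<langle>tsnd (App g (tsuc n))\<rangle> \<langle>tsnd (App g n)\<rangle>"
    if T': "world T'" and H': "T' \<tturnstile> ?H" and n: "is_nat n" for T' n
  proof -
    have h: "T' \<tturnstile> \<langle>g\<rangle> \<^bold>\<cdot> \<^bold>0\<^sub>N \<^bold>= \<langle>tpair (Con CNZero) (Con CRZero)\<rangle>" "T' \<tturnstile> \<^bold>\<forall>\<^sub>N n. ?F (\<langle>g\<rangle> \<^bold>\<cdot> n)"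
      "T' \<tturnstile> \<^bold>\<forall>\<^sub>N n. ?P (\<langle>g\<rangle> \<^bold>\<cdot> n) (\<langle>g\<rangle> \<^bold>\<cdot> nat_suc n)" "T' \<tturnstile> \<^bold>\<forall>\<^sub>N n. \<langle>y\<rangle> \<^bold>\<cdot> n \<^bold>= ?snd (\<langle>g\<rangle> \<^bold>\<cdot> n)"
      using H' T' by simp_all
    show "T' \<tturnstile> \<langle>tfst (App g n)\<rangle> \<^bold>= \<langle>n\<rangle>" by (rule index[OF T' h(1,3) n])
    show "T' \<tturnstile> G \<langle>tfst (App g n)\<rangle> \<langle>tsnd (App g n)\<rangle>"
      using world_all[OF T' h(2) _ n] g by simp
    show "T' \<tturnstile> Q \<langle>tfst (App g (tsuc n))\<rangle> \<langle>tsnd (App g (tsuc n))\<rangle> \<langle>tsnd (App g n)\<rangle>"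
      using world_all[OF T' h(3) _ n] g T' by simp
    have "T' \<tturnstile> \<langle>App y n\<rangle> \<^bold>= \<langle>tsnd (App g n)\<rangle>" using world_all[OF T' h(4) _ n] g y by simp
    then show "T' \<tturnstile> \<langle>tsnd (App g n)\<rangle> \<^bold>= \<langle>App y n\<rangle>" by (rule world_sym[OF T']) (use g y n in simp_all)
  qed
  have "T \<tturnstile> \<^bold>\<forall>\<^sub>N n. G n (\<langle>y\<rangle> \<^bold>\<cdot> n)"
  proof (rule world_allI[OF T H])
    fix T' n assume *: "world T'" "T' \<tturnstile> ?H" "is_nat n"
    have "T' \<tturnstile> G \<langle>n\<rangle> \<langle>App y n\<rangle>"
      by (rule world_subst2[where P = G, OF *(1) _ facts(1-3)[OF *]]) (use * g y in simp_all)
    then show "T' \<tturnstile> G \<langle>n\<rangle> (\<langle>y\<rangle> \<^bold>\<cdot> \<langle>n\<rangle>)" by simp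
  qed (use y in simp)
  moreover have "T \<tturnstile> \<^bold>\<forall>\<^sub>N n. Q (nat_suc n) (\<langle>y\<rangle> \<^bold>\<cdot> nat_suc n) (\<langle>y\<rangle> \<^bold>\<cdot> n)"
  proof (rule world_allI[OF T H])
    fix T' n assume *: "world T'" "T' \<tturnstile> ?H" "is_nat n"
    then have sn: "is_nat (tsuc n)" by simp
    have "T' \<tturnstile> Q \<langle>tsuc n\<rangle> \<langle>App y (tsuc n)\<rangle> \<langle>tsnd (App g n)\<rangle>"
      by (rule world_subst2[where P = "\<lambda>m u. Q m u \<langle>tsnd (App g n)\<rangle>",
            OF *(1) _ facts(1,2)[OF *(1,2) sn] facts(4)[OF *]]) (use * g y in simp_all)
    then have "T' \<tturnstile> Q \<langle>tsuc n\<rangle> \<langle>App y (tsuc n)\<rangle> \<langle>App y n\<rangle>"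
      by (rule world_subst[where F = "Q \<langle>tsuc n\<rangle> \<langle>App y (tsuc n)\<rangle>", OF *(1) facts(2)[OF *]]) (use * g y in simp_all)
    then show "T' \<tturnstile> Q (nat_suc \<langle>n\<rangle>) (\<langle>y\<rangle> \<^bold>\<cdot> nat_suc \<langle>n\<rangle>) (\<langle>y\<rangle> \<^bold>\<cdot> \<langle>n\<rangle>)" by simp
  qed (use y in simp)
  ultimately have "T \<tturnstile> trace \<langle>f\<rangle> \<langle>a\<rangle> \<langle>y\<rangle>" using T by (simp add: trace_def G_def Q_def)
  with y that show thesis by blast
qed

lemma rel_trace [simp]:
  "(\<And>j. k \<le> j \<Longrightarrow> rel_tm p \<theta> j s s') \<Longrightarrow> (\<And>j. k \<le> j \<Longrightarrow> rel_tm p \<theta> j t t') \<Longrightarrow>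
   (\<And>j. k \<le> j \<Longrightarrow> rel_tm p \<theta> j u u') \<Longrightarrow> rel_form p \<theta> k (trace s t u) (trace s' t' u')"
  by (simp add: trace_def)

lemma trace_point:
  assumes T: "world T" and tr: "T \<tturnstile> trace \<langle>f\<rangle> \<langle>a\<rangle> \<langle>y\<rangle>" and ty: "is_fun f" "is_nseq a" "is_rseq y" "is_nat n"
  shows "T \<tturnstile> unit_interval \<langle>App y n\<rangle>" "lt T (rnat n * rv (App f (App y n))) 1 \<or> (T \<tturnstile> dead \<langle>a\<rangle>)"
proof -
  have "T \<tturnstile> \<^bold>\<forall>\<^sub>N n. unit_interval (\<langle>y\<rangle> \<^bold>\<cdot> n) \<^bold>\<and> (real_of n \<^bold>* (\<langle>f\<rangle> \<^bold>\<cdot> (\<langle>y\<rangle> \<^bold>\<cdot> n)) \<^bold>< \<^bold>1 \<^bold>\<or> dead \<langle>a\<rangle>)"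
    using T tr by (simp add: trace_def)
  from world_all[OF T this _ ty(4)] ty T
  show "T \<tturnstile> unit_interval \<langle>App y n\<rangle>" "lt T (rnat n * rv (App f (App y n))) 1 \<or> (T \<tturnstile> dead \<langle>a\<rangle>)"
    by (simp_all add: ev)
qed

lemma trace_step:
  assumes T: "world T" and tr: "T \<tturnstile> trace \<langle>f\<rangle> \<langle>a\<rangle> \<langle>y\<rangle>" and ty: "is_fun f" "is_nseq a" "is_rseq y" "is_nat n"
  shows "lt T (rnat (tsuc n) * rv (App f (App y (tsuc n)))) 1 \<and> (T \<tturnstile> \<langle>App a (tsuc n)\<rangle> \<^bold>= \<^bold>0\<^sub>N) \<or>
    (T \<tturnstile> \<langle>App y (tsuc n)\<rangle> \<^bold>= \<langle>App y n\<rangle>)"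
proof -
  have "T \<tturnstile> \<^bold>\<forall>\<^sub>N n. (\<langle>a\<rangle> \<^bold>\<cdot> nat_suc n \<^bold>= \<^bold>0\<^sub>N \<^bold>\<and> real_of (nat_suc n) \<^bold>* (\<langle>f\<rangle> \<^bold>\<cdot> (\<langle>y\<rangle> \<^bold>\<cdot> nat_suc n)) \<^bold>< \<^bold>1) \<^bold>\<or>
         (\<^bold>\<not> (\<langle>a\<rangle> \<^bold>\<cdot> nat_suc n \<^bold>= \<^bold>0\<^sub>N) \<^bold>\<and> \<langle>y\<rangle> \<^bold>\<cdot> nat_suc n \<^bold>= \<langle>y\<rangle> \<^bold>\<cdot> n)"
    using T tr by (simp add: trace_def)
  from world_all[OF T this _ ty(4)] have
    "(T \<tturnstile> \<langle>App a (tsuc n)\<rangle> \<^bold>= \<^bold>0\<^sub>N) \<and> (T \<tturnstile> real_of \<langle>tsuc n\<rangle> \<^bold>* \<langle>App f (App y (tsuc n))\<rangle> \<^bold>< \<^bold>1) \<or>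
      (T \<tturnstile> \<langle>App y (tsuc n)\<rangle> \<^bold>= \<langle>App y n\<rangle>)"
    using ty T by auto
  moreover have "(T \<tturnstile> real_of \<langle>tsuc n\<rangle> \<^bold>* \<langle>App f (App y (tsuc n))\<rangle> \<^bold>< \<^bold>1) \<longleftrightarrow>
      lt T (rnat (tsuc n) * rv (App f (App y (tsuc n)))) 1"
    using ty T by (simp add: ev)
  ultimately show ?thesis by blast
qed

lemma mul_less_mono:
  assumes "world T" "lt T (y * x) 1" "le T 0 x" "le T z y"
  shows "lt T (z * x) 1"
proof -
  have "le T 0 ((y - z) * x)" using assms by (intro nonneg_mul leD)
  then have "le T (z * x) (y * x)" by (rule leI[OF assms(1)]) (simp add: algebra_simps)
  then show ?thesis using assms le_lt_trans by blast
qed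

lemma mul_less_cong:
  assumes "world T" "lt T (k * x) 1" "eqr T x y"
  shows "lt T (k * y) 1"
  using le_lt_trans[OF assms(1) eqr_le[OF assms(1) eqr_mul[OF assms(1) eqr_sym[OF assms(1,3)]]] assms(2)] .

text \<open>A new point at stage \<open>n + 1\<close> satisfies the stronger bound with factor
  \<open>n + 1\<close>, which is at least \<open>k\<close>; a repeated point inherits the
  bound.\<close>

lemma trace_stays_low:
  assumes T: "world T" and f: "T \<tturnstile> pos_qc \<langle>f\<rangle>" and tr: "T \<tturnstile> trace \<langle>f\<rangle> \<langle>a\<rangle> \<langle>y\<rangle>"
    and ty: "is_fun f" "is_nseq a" "is_rseq y" "is_nat k" "is_nat n"
    and low: "lt T (rnat k * rv (App f (App y k))) 1" and le: "T \<tturnstile> \<langle>k\<rangle> \<^bold>\<le>\<^sub>N \<langle>n\<rangle>"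
  shows "lt T (rnat k * rv (App f (App y n))) 1"
proof -
  let ?H = "pos_qc \<langle>f\<rangle> \<^bold>\<and> trace \<langle>f\<rangle> \<langle>a\<rangle> \<langle>y\<rangle>"
  let ?F = "\<lambda>n. real_of \<langle>k\<rangle> \<^bold>* (\<langle>f\<rangle> \<^bold>\<cdot> (\<langle>y\<rangle> \<^bold>\<cdot> n)) \<^bold>< \<^bold>1"
  have F: "(T' \<tturnstile> ?F \<langle>n\<rangle>) \<longleftrightarrow> lt T' (rnat k * rv (App f (App y n))) 1" if "world T'" "is_nat n" for T' n
    using that ty by (simp add: ev)
  have "T \<tturnstile> ?F \<langle>n\<rangle>"
  proof (rule world_induct_from[OF T _ _ ty(4) _ _ ty(5) le, of ?H ?F])
    show "T \<tturnstile> ?H" using T f tr by simp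
    show "par ?F" using ty by simp
    show "T \<tturnstile> ?F \<langle>k\<rangle>" using F[OF T ty(4)] low by blast
    fix T' n assume T': "world T'" and H: "T' \<tturnstile> ?H" and n: "is_nat n" and kn: "T' \<tturnstile> \<langle>k\<rangle> \<^bold>\<le>\<^sub>N \<langle>n\<rangle>" and IH: "T' \<tturnstile> ?F \<langle>n\<rangle>"
    have sn: "is_nat (tsuc n)" using n by simp
    have H': "T' \<tturnstile> pos_qc \<langle>f\<rangle>" "T' \<tturnstile> trace \<langle>f\<rangle> \<langle>a\<rangle> \<langle>y\<rangle>" using H T' by simp_all
    have "le T' (rnat k) (rnat (tsuc n))"
      by (rule rnat_mono[OF T' ty(4) sn nat_le_suc[OF T' ty(4) n kn]])
    moreover have "le T' 0 (rv (App f (App y (tsuc n))))"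
      by (rule lt_imp_le[OF T' positive_valuedD[OF T' H'(1) trace_point(1)[OF T' H'(2) ty(1-3) sn] ty(1)]])
        (use ty n in simp)
    moreover have "eqr T' (rv (App f (App y n))) (rv (App f (App y (tsuc n))))"
      if "T' \<tturnstile> \<langle>App y (tsuc n)\<rangle> \<^bold>= \<langle>App y n\<rangle>"
      by (rule eqr_sym[OF T' fun_cong_rv[OF T' ty(1)]]) (use that T' ty n in \<open>simp_all add: ev\<close>)
    ultimately show "T' \<tturnstile> ?F \<langle>tsuc n\<rangle>"
      using trace_step[OF T' H'(2) ty(1-3) n] IH F[OF T' n] F[OF T' sn] mul_less_mono[OF T'] mul_less_cong[OF T'] by blast
  qed
  then show ?thesis using F[OF T ty(5)] by blast
qed

text \<open>From the stage provided by \<open>switch_dead\<close> on, every entry of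
  \<open>a\<close> is nonzero, which leaves repetition as the only step.\<close>

lemma trace_dead_constant:
  assumes T: "world T" and sw: "T \<tturnstile> switch \<langle>f\<rangle> \<langle>a\<rangle>" and tr: "T \<tturnstile> trace \<langle>f\<rangle> \<langle>a\<rangle> \<langle>y\<rangle>"
    and ty: "is_fun f" "is_nseq a" "is_rseq y" and dead: "T \<tturnstile> dead \<langle>a\<rangle>"
  obtains k where "is_nat k" "T \<tturnstile> \<^bold>\<forall>\<^sub>N i. \<langle>k\<rangle> \<^bold>\<le>\<^sub>N i \<^bold>\<longrightarrow> \<langle>y\<rangle> \<^bold>\<cdot> i \<^bold>= \<langle>y\<rangle> \<^bold>\<cdot> \<langle>k\<rangle>"
proof -
  obtain k where k: "is_nat k" and stop: "T \<tturnstile> \<^bold>\<forall>\<^sub>N i. \<langle>k\<rangle> \<^bold>\<le>\<^sub>N i \<^bold>\<longrightarrow> \<^bold>\<not> (\<langle>a\<rangle> \<^bold>\<cdot> i \<^bold>= \<^bold>0\<^sub>N)"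
    by (rule switch_dead[OF T sw ty(1,2) dead])
  let ?H = "trace \<langle>f\<rangle> \<langle>a\<rangle> \<langle>y\<rangle> \<^bold>\<and> (\<^bold>\<forall>\<^sub>N i. \<langle>k\<rangle> \<^bold>\<le>\<^sub>N i \<^bold>\<longrightarrow> \<^bold>\<not> (\<langle>a\<rangle> \<^bold>\<cdot> i \<^bold>= \<^bold>0\<^sub>N))"
  have "T \<tturnstile> \<^bold>\<forall>\<^sub>N i. \<langle>k\<rangle> \<^bold>\<le>\<^sub>N i \<^bold>\<longrightarrow> \<langle>y\<rangle> \<^bold>\<cdot> i \<^bold>= \<langle>y\<rangle> \<^bold>\<cdot> \<langle>k\<rangle>"
  proof (rule world_all_impI[OF T])
    show "T \<tturnstile> ?H" using T tr stop by simp
    fix T' i assume T': "world T'" "T' \<tturnstile> ?H" and i: "is_nat i" "T' \<tturnstile> \<langle>k\<rangle> \<^bold>\<le>\<^sub>N \<langle>i\<rangle>"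
    show "T' \<tturnstile> \<langle>y\<rangle> \<^bold>\<cdot> \<langle>i\<rangle> \<^bold>= \<langle>y\<rangle> \<^bold>\<cdot> \<langle>k\<rangle>"
    proof (rule world_induct_from[OF T' _ k _ _ i, of "\<lambda>i. \<langle>y\<rangle> \<^bold>\<cdot> i \<^bold>= \<langle>y\<rangle> \<^bold>\<cdot> \<langle>k\<rangle>"])
      show "T' \<tturnstile> \<langle>y\<rangle> \<^bold>\<cdot> \<langle>k\<rangle> \<^bold>= \<langle>y\<rangle> \<^bold>\<cdot> \<langle>k\<rangle>" using T' by (simp add: world_refl)
      fix T2 n assume *: "world T2" "T2 \<tturnstile> ?H" "is_nat n" "T2 \<tturnstile> \<langle>k\<rangle> \<^bold>\<le>\<^sub>N \<langle>n\<rangle>" "T2 \<tturnstile> \<langle>y\<rangle> \<^bold>\<cdot> \<langle>n\<rangle> \<^bold>= \<langle>y\<rangle> \<^bold>\<cdot> \<langle>k\<rangle>"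
      have h: "T2 \<tturnstile> trace \<langle>f\<rangle> \<langle>a\<rangle> \<langle>y\<rangle>" "T2 \<tturnstile> \<^bold>\<forall>\<^sub>N i. \<langle>k\<rangle> \<^bold>\<le>\<^sub>N i \<^bold>\<longrightarrow> \<^bold>\<not> (\<langle>a\<rangle> \<^bold>\<cdot> i \<^bold>= \<^bold>0\<^sub>N)"
        using * by simp_all
      have "T2 \<tturnstile> \<^bold>\<not> (\<langle>a\<rangle> \<^bold>\<cdot> \<langle>tsuc n\<rangle> \<^bold>= \<^bold>0\<^sub>N)"
        by (rule world_all_impD[OF *(1) h(2) nat_le_suc[OF *(1) k *(3,4)]]) (use * k ty in simp_all)
      then have "\<not> (T2 \<tturnstile> \<langle>App a (tsuc n)\<rangle> \<^bold>= \<^bold>0\<^sub>N)" using world_not[OF *(1)] by simp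
      then have "T2 \<tturnstile> \<langle>App y (tsuc n)\<rangle> \<^bold>= \<langle>App y n\<rangle>" using trace_step[OF *(1) h(1) ty *(3)] by blast
      from world_trans[OF *(1) this, of "App y k" RealT]
      show "T2 \<tturnstile> \<langle>y\<rangle> \<^bold>\<cdot> \<langle>tsuc n\<rangle> \<^bold>= \<langle>y\<rangle> \<^bold>\<cdot> \<langle>k\<rangle>" using * k ty by simp
    qed (use k ty in simp_all)
  qed (use k ty in simp_all)
  with k that show thesis by blast
qed

text \<open>For a threshold \<open>h\<close> from \<open>modulus_ex\<close> and
  \<open>k h > 1\<close>, stage \<open>k\<close> shows one of two things. Either the value there is
  low, and all later terms stay below \<open>h\<close> and hence close together; or a stop has been
  recorded, and the sequence is eventually constant.\<close>

lemma trace_cauchy: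
  assumes T: "world T" and sw: "T \<tturnstile> switch \<langle>f\<rangle> \<langle>a\<rangle>" and tr: "T \<tturnstile> trace \<langle>f\<rangle> \<langle>a\<rangle> \<langle>y\<rangle>"
    and ty: "is_fun f" "is_nseq a" "is_rseq y"
  shows "T \<tturnstile> cauchy \<langle>y\<rangle>"
proof -
  let ?H = "switch \<langle>f\<rangle> \<langle>a\<rangle> \<^bold>\<and> trace \<langle>f\<rangle> \<langle>a\<rangle> \<langle>y\<rangle>"
  have H0: "T \<tturnstile> ?H" using T sw tr by simp
  have abs: "(T' \<tturnstile> real_abs (\<langle>y\<rangle> \<^bold>\<cdot> \<langle>m\<rangle> \<^bold>- \<langle>y\<rangle> \<^bold>\<cdot> \<langle>n\<rangle>) \<^bold>< \<langle>e\<rangle>) \<longleftrightarrow>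
      lt T' (rv (App y m) - rv (App y n)) (rv e) \<and> lt T' (rv (App y n) - rv (App y m)) (rv e)"
    if "world T'" "is_nat m" "is_nat n" "is_real e" for T' m n e
    using holds_abs_diff[OF that(1), of "App y m" "App y n" e] that ty by simp
  show ?thesis
    unfolding cauchy_def
  proof (rule world_all_impI[OF T H0])
    fix T' e assume T': "world T'" and H: "T' \<tturnstile> ?H" and e: "is_real e" and "T' \<tturnstile> \<^bold>0 \<^bold>< \<langle>e\<rangle>"
    then have pos: "lt T' 0 (rv e)" by (simp add: ev)
    have sw': "T' \<tturnstile> switch \<langle>f\<rangle> \<langle>a\<rangle>" and tr': "T' \<tturnstile> trace \<langle>f\<rangle> \<langle>a\<rangle> \<langle>y\<rangle>" using H T' by simp_all
    have f': "T' \<tturnstile> pos_qc \<langle>f\<rangle>" by (rule switch_pos_qc[OF T' sw' ty(1,2)])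
    obtain h where h: "is_real h" "lt T' 0 (rv h)" "T' \<tturnstile> modulus \<langle>f\<rangle> \<langle>h\<rangle> \<langle>e\<rangle>"
      by (rule modulus_ex[OF T' f' ty(1) e pos])
    obtain k where k: "is_nat k" "lt T' 1 (rnat k * rv h)" by (rule archimedes_mul[OF T' h(1,2)])
    let ?C = "\<lambda>k m n. k \<^bold>\<le>\<^sub>N m \<^bold>\<and> k \<^bold>\<le>\<^sub>N n \<^bold>\<longrightarrow> real_abs (\<langle>y\<rangle> \<^bold>\<cdot> m \<^bold>- \<langle>y\<rangle> \<^bold>\<cdot> n) \<^bold>< \<langle>e\<rangle>"
    consider "lt T' (rnat k * rv (App f (App y k))) 1" | "T' \<tturnstile> dead \<langle>a\<rangle>"
      using trace_point(2)[OF T' tr' ty k(1)] by blast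
    then have "\<exists>k. is_nat k \<and> (T' \<tturnstile> \<^bold>\<forall>\<^sub>N m. \<^bold>\<forall>\<^sub>N n. ?C \<langle>k\<rangle> m n)"
    proof cases
      case 1
      let ?H2 = "pos_qc \<langle>f\<rangle> \<^bold>\<and> trace \<langle>f\<rangle> \<langle>a\<rangle> \<langle>y\<rangle> \<^bold>\<and> modulus \<langle>f\<rangle> \<langle>h\<rangle> \<langle>e\<rangle> \<^bold>\<and> \<^bold>1 \<^bold>< real_of \<langle>k\<rangle> \<^bold>* \<langle>h\<rangle> \<^bold>\<and>
        real_of \<langle>k\<rangle> \<^bold>* \<langle>App f (App y k)\<rangle> \<^bold>< \<^bold>1"
      have "T' \<tturnstile> \<^bold>\<forall>\<^sub>N m. \<^bold>\<forall>\<^sub>N n. ?C \<langle>k\<rangle> m n"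
      proof (rule world_all2_impI[OF T'])
        show "T' \<tturnstile> ?H2" using T' f' tr' h k 1 ty by (simp add: ev)
        fix T2 m n assume *: "world T2" "T2 \<tturnstile> ?H2" "is_nat m" "is_nat n" "T2 \<tturnstile> \<langle>k\<rangle> \<^bold>\<le>\<^sub>N \<langle>m\<rangle> \<^bold>\<and> \<langle>k\<rangle> \<^bold>\<le>\<^sub>N \<langle>n\<rangle>"
        have H2: "T2 \<tturnstile> pos_qc \<langle>f\<rangle>" "T2 \<tturnstile> trace \<langle>f\<rangle> \<langle>a\<rangle> \<langle>y\<rangle>" "T2 \<tturnstile> modulus \<langle>f\<rangle> \<langle>h\<rangle> \<langle>e\<rangle>" "lt T2 1 (rnat k * rv h)"
          "lt T2 (rnat k * rv (App f (App y k))) 1" "T2 \<tturnstile> \<langle>k\<rangle> \<^bold>\<le>\<^sub>N \<langle>m\<rangle>" "T2 \<tturnstile> \<langle>k\<rangle> \<^bold>\<le>\<^sub>N \<langle>n\<rangle>"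
          using * k h ty by (simp_all add: ev)
        have low: "T2 \<tturnstile> low \<langle>f\<rangle> \<langle>h\<rangle> \<langle>App y i\<rangle>" if "is_nat i" "T2 \<tturnstile> \<langle>k\<rangle> \<^bold>\<le>\<^sub>N \<langle>i\<rangle>" for i
          using holds_low[OF *(1) ty(1) h(1), of "App y i"] trace_point(1)[OF *(1) H2(2) ty that(1)]
            small_of_mul_less[OF *(1) k(1) H2(4) trace_stays_low[OF *(1) H2(1,2) ty k(1) that(1) H2(5) that(2)]] ty that
          by simp
        have "T2 \<tturnstile> real_abs (\<langle>App y m\<rangle> \<^bold>- \<langle>App y n\<rangle>) \<^bold>< \<langle>e\<rangle>"
          by (rule modulusD[OF *(1) H2(3) ty(1) h(1) e _ _ low[OF *(3) H2(6)] low[OF *(4) H2(7)]])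
            (use ty * in simp_all)
        then show "T2 \<tturnstile> real_abs (\<langle>y\<rangle> \<^bold>\<cdot> \<langle>m\<rangle> \<^bold>- \<langle>y\<rangle> \<^bold>\<cdot> \<langle>n\<rangle>) \<^bold>< \<langle>e\<rangle>" by simp
      qed (use k e ty in simp_all)
      with k show ?thesis by blast
    next
      case 2
      obtain k where k: "is_nat k" and const: "T' \<tturnstile> \<^bold>\<forall>\<^sub>N i. \<langle>k\<rangle> \<^bold>\<le>\<^sub>N i \<^bold>\<longrightarrow> \<langle>y\<rangle> \<^bold>\<cdot> i \<^bold>= \<langle>y\<rangle> \<^bold>\<cdot> \<langle>k\<rangle>"
        by (rule trace_dead_constant[OF T' sw' tr' ty 2])
      let ?H2 = "(\<^bold>\<forall>\<^sub>N i. \<langle>k\<rangle> \<^bold>\<le>\<^sub>N i \<^bold>\<longrightarrow> \<langle>y\<rangle> \<^bold>\<cdot> i \<^bold>= \<langle>y\<rangle> \<^bold>\<cdot> \<langle>k\<rangle>) \<^bold>\<and> \<^bold>0 \<^bold>< \<langle>e\<rangle>"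
      have "T' \<tturnstile> \<^bold>\<forall>\<^sub>N m. \<^bold>\<forall>\<^sub>N n. ?C \<langle>k\<rangle> m n"
      proof (rule world_all2_impI[OF T'])
        show "T' \<tturnstile> ?H2" using T' const e pos by (simp add: ev)
        fix T2 m n assume *: "world T2" "T2 \<tturnstile> ?H2" "is_nat m" "is_nat n" "T2 \<tturnstile> \<langle>k\<rangle> \<^bold>\<le>\<^sub>N \<langle>m\<rangle> \<^bold>\<and> \<langle>k\<rangle> \<^bold>\<le>\<^sub>N \<langle>n\<rangle>"
        have H2: "T2 \<tturnstile> \<^bold>\<forall>\<^sub>N i. \<langle>k\<rangle> \<^bold>\<le>\<^sub>N i \<^bold>\<longrightarrow> \<langle>y\<rangle> \<^bold>\<cdot> i \<^bold>= \<langle>y\<rangle> \<^bold>\<cdot> \<langle>k\<rangle>" "lt T2 0 (rv e)"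
          "T2 \<tturnstile> \<langle>k\<rangle> \<^bold>\<le>\<^sub>N \<langle>m\<rangle>" "T2 \<tturnstile> \<langle>k\<rangle> \<^bold>\<le>\<^sub>N \<langle>n\<rangle>"
          using * e by (simp_all add: ev)
        have eq: "eqr T2 (rv (App y i)) (rv (App y k))" if "is_nat i" "T2 \<tturnstile> \<langle>k\<rangle> \<^bold>\<le>\<^sub>N \<langle>i\<rangle>" for i
        proof -
          have "T2 \<tturnstile> \<langle>y\<rangle> \<^bold>\<cdot> \<langle>i\<rangle> \<^bold>= \<langle>y\<rangle> \<^bold>\<cdot> \<langle>k\<rangle>"
            by (rule world_all_impD[OF *(1) H2(1) that(2,1)]) (use k ty in simp)
          then show ?thesis using * ty k that by (simp add: ev)
        qed
        have "le T2 (rv (App y i) - rv (App y j)) 0" if "is_nat i" "T2 \<tturnstile> \<langle>k\<rangle> \<^bold>\<le>\<^sub>N \<langle>i\<rangle>" "is_nat j" "T2 \<tturnstile> \<langle>k\<rangle> \<^bold>\<le>\<^sub>N \<langle>j\<rangle>" for i j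
          by (rule leI[OF *(1) leD[OF *(1) le_trans[OF *(1) eqr_le[OF *(1) eq[OF that(1,2)]]
            eqr_le[OF *(1) eqr_sym[OF *(1) eq[OF that(3,4)]]]]]]) simp
        then show "T2 \<tturnstile> real_abs (\<langle>y\<rangle> \<^bold>\<cdot> \<langle>m\<rangle> \<^bold>- \<langle>y\<rangle> \<^bold>\<cdot> \<langle>n\<rangle>) \<^bold>< \<langle>e\<rangle>"
          using le_lt_trans[OF *(1) _ H2(2)] abs[OF *(1,3,4) e] * H2 by blast
      qed (use k e ty in simp_all)
      with k show ?thesis by blast
    qed
    then show "T' \<tturnstile> \<^bold>\<exists>\<^sub>N k. \<^bold>\<forall>\<^sub>N m. \<^bold>\<forall>\<^sub>N n. ?C k m n"
      using world_exI[OF T', of "\<lambda>k. \<^bold>\<forall>\<^sub>N m. \<^bold>\<forall>\<^sub>N n. ?C k m n"] e ty by auto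
  qed (use ty in simp_all)
qed

section \<open>Limits of traces\<close>

lemma convergesD:
  assumes T: "world T" and c: "T \<tturnstile> converges \<langle>y\<rangle> \<langle>z\<rangle>" and ty: "is_rseq y" "is_real z" and e: "is_real e" "lt T 0 (rv e)"
  shows "\<exists>k. is_nat k \<and> (\<forall>n. is_nat n \<longrightarrow> (T \<tturnstile> \<langle>k\<rangle> \<^bold>\<le>\<^sub>N \<langle>n\<rangle>) \<longrightarrow>
    lt T (rv (App y n) - rv z) (rv e) \<and> lt T (rv z - rv (App y n)) (rv e))"
proof -
  have "T \<tturnstile> \<^bold>\<exists>\<^sub>N k. \<^bold>\<forall>\<^sub>N n. k \<^bold>\<le>\<^sub>N n \<^bold>\<longrightarrow> real_abs (\<langle>y\<rangle> \<^bold>\<cdot> n \<^bold>- \<langle>z\<rangle>) \<^bold>< \<langle>e\<rangle>"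
    by (rule world_all_impD[OF T c[unfolded converges_def] _ e(1)]) (use T ty e in \<open>simp_all add: ev\<close>)
  then obtain k where k: "is_nat k" "T \<tturnstile> \<^bold>\<forall>\<^sub>N n. \<langle>k\<rangle> \<^bold>\<le>\<^sub>N n \<^bold>\<longrightarrow> real_abs (\<langle>y\<rangle> \<^bold>\<cdot> n \<^bold>- \<langle>z\<rangle>) \<^bold>< \<langle>e\<rangle>"
    by (rule world_exE[OF T]) (use ty e in simp_all)
  have "lt T (rv (App y n) - rv z) (rv e) \<and> lt T (rv z - rv (App y n)) (rv e)"
    if n: "is_nat n" "T \<tturnstile> \<langle>k\<rangle> \<^bold>\<le>\<^sub>N \<langle>n\<rangle>" for n
  proof -
    have "T \<tturnstile> real_abs (\<langle>y\<rangle> \<^bold>\<cdot> \<langle>n\<rangle> \<^bold>- \<langle>z\<rangle>) \<^bold>< \<langle>e\<rangle>"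
      by (rule world_all_impD[OF T k(2) n(2,1)]) (use k ty e in simp)
    then show ?thesis using holds_abs_diff[OF T, of "App y n" z e] ty e n by simp
  qed
  with k(1) show ?thesis by blast
qed

lemma limit_unit_interval:
  assumes T: "world T" and c: "T \<tturnstile> converges \<langle>y\<rangle> \<langle>z\<rangle>" and u: "T \<tturnstile> \<^bold>\<forall>\<^sub>N n. unit_interval (\<langle>y\<rangle> \<^bold>\<cdot> n)"
    and ty: "is_rseq y" "is_real z"
  shows "T \<tturnstile> unit_interval \<langle>z\<rangle>"
proof (rule unit_intervalI[OF T _ ty(2)])
  let ?H = "converges \<langle>y\<rangle> \<langle>z\<rangle> \<^bold>\<and> (\<^bold>\<forall>\<^sub>N n. unit_interval (\<langle>y\<rangle> \<^bold>\<cdot> n))"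
  show "T \<tturnstile> ?H" using T c u by simp
  fix T' assume T': "world T'" and H: "T' \<tturnstile> ?H"
  have c': "T' \<tturnstile> converges \<langle>y\<rangle> \<langle>z\<rangle>" and u': "T' \<tturnstile> \<^bold>\<forall>\<^sub>N n. unit_interval (\<langle>y\<rangle> \<^bold>\<cdot> n)" using T' H by simp_all
  have yu: "T' \<tturnstile> unit_interval \<langle>App y n\<rangle>" if "is_nat n" for n
    using world_all[OF T' u' _ that] ty by simp
  show "le T' 0 (rv z)"
  proof (rule ccontr)
    assume "\<not> ?thesis"
    \<comment> \<open>With the tolerance \<open>- z\<close>, a term close to \<open>z\<close> would
      itself be negative.\<close>
    then have e: "is_real (tneg z)" "lt T' 0 (rv (tneg z))"
      using ltD[OF T', of "rv z" 0] ty by (simp_all add: le_def ev)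
    obtain k where k: "is_nat k" "lt T' (rv (App y k) - rv z) (rv (tneg z))"
      using convergesD[OF T' c' ty e] nat_le_refl[OF T'] by blast
    have "lt T' (rv (App y k)) 0"
      by (rule ltI[OF T' ltD[OF T' k(2)]]) (use ty in \<open>simp add: ev\<close>)
    then show False using unit_intervalD(1)[OF T' yu[OF k(1)]] ty k by (simp add: le_def)
  qed
  show "le T' (rv z) 1"
  proof (rule ccontr)
    assume "\<not> ?thesis"
    then have e: "is_real (tsub z (Con CROne))" "lt T' 0 (rv (tsub z (Con CROne)))"
      using ltD[OF T', of 1 "rv z"] ty by (simp_all add: le_def ev)
    obtain k where k: "is_nat k" "lt T' (rv z - rv (App y k)) (rv (tsub z (Con CROne)))"
      using convergesD[OF T' c' ty e] nat_le_refl[OF T'] by blast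
    have "lt T' 1 (rv (App y k))"
      by (rule ltI[OF T' ltD[OF T' k(2)]]) (use ty in \<open>simp add: ev\<close>)
    then show False using unit_intervalD(2)[OF T' yu[OF k(1)]] ty k by (simp add: le_def)
  qed
qed

text \<open>By tightness. If the limit differed from the final value, that difference, taken as
  tolerance, would be contradicted by a sufficiently late term.\<close>

lemma limit_constant:
  assumes T: "world T" and c: "T \<tturnstile> converges \<langle>y\<rangle> \<langle>z\<rangle>"
    and const: "T \<tturnstile> \<^bold>\<forall>\<^sub>N i. \<langle>k\<rangle> \<^bold>\<le>\<^sub>N i \<^bold>\<longrightarrow> \<langle>y\<rangle> \<^bold>\<cdot> i \<^bold>= \<langle>y\<rangle> \<^bold>\<cdot> \<langle>k\<rangle>" and ty: "is_rseq y" "is_real z" "is_nat k"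
  shows "T \<tturnstile> \<langle>z\<rangle> \<^bold>= \<langle>App y k\<rangle>"
proof -
  let ?H = "converges \<langle>y\<rangle> \<langle>z\<rangle> \<^bold>\<and> (\<^bold>\<forall>\<^sub>N i. \<langle>k\<rangle> \<^bold>\<le>\<^sub>N i \<^bold>\<longrightarrow> \<langle>y\<rangle> \<^bold>\<cdot> i \<^bold>= \<langle>y\<rangle> \<^bold>\<cdot> \<langle>k\<rangle>)"
  have yk: "is_real (App y k)" using ty by simp
  have H: "T \<tturnstile> ?H" using T c const by simp
  have near: "\<exists>n. eqr T' (rv (App y n)) (rv (App y k)) \<and> lt T' (rv (App y n) - rv z) (rv e) \<and> lt T' (rv z - rv (App y n)) (rv e)"
    if T': "world T'" and H': "T' \<tturnstile> ?H" and e: "is_real e" "lt T' 0 (rv e)" for T' e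
  proof -
    have c': "T' \<tturnstile> converges \<langle>y\<rangle> \<langle>z\<rangle>" and const': "T' \<tturnstile> \<^bold>\<forall>\<^sub>N i. \<langle>k\<rangle> \<^bold>\<le>\<^sub>N i \<^bold>\<longrightarrow> \<langle>y\<rangle> \<^bold>\<cdot> i \<^bold>= \<langle>y\<rangle> \<^bold>\<cdot> \<langle>k\<rangle>"
      using T' H' by simp_all
    obtain m where m: "is_nat m" "\<And>n. is_nat n \<Longrightarrow> T' \<tturnstile> \<langle>m\<rangle> \<^bold>\<le>\<^sub>N \<langle>n\<rangle> \<Longrightarrow> lt T' (rv (App y n) - rv z) (rv e)"
      "\<And>n. is_nat n \<Longrightarrow> T' \<tturnstile> \<langle>m\<rangle> \<^bold>\<le>\<^sub>N \<langle>n\<rangle> \<Longrightarrow> lt T' (rv z - rv (App y n)) (rv e)"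
      using convergesD[OF T' c' ty(1,2) e] by blast
    have n: "is_nat (tplus k m)" using ty m by simp
    have "T' \<tturnstile> \<langle>y\<rangle> \<^bold>\<cdot> \<langle>tplus k m\<rangle> \<^bold>= \<langle>y\<rangle> \<^bold>\<cdot> \<langle>k\<rangle>"
      by (rule world_all_impD[OF T' const' nat_le_plus(1)[OF T' ty(3) m(1)] n]) (use ty in simp)
    then have "eqr T' (rv (App y (tplus k m))) (rv (App y k))" using T' ty n by (simp add: ev)
    then show ?thesis using m(2,3)[OF n nat_le_plus(2)[OF T' ty(3) m(1)]] by blast
  qed
  show ?thesis
  proof (rule tight[OF T H ty(2) yk]; rule ccontr)
    fix T' assume T': "world T'" and H': "T' \<tturnstile> ?H" and "\<not> le T' (rv z) (rv (App y k))"
    then have e: "is_real (tsub z (App y k))" "lt T' 0 (rv (tsub z (App y k)))"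
      using ltD[OF T', of "rv (App y k)" "rv z"] ty by (simp_all add: le_def)
    obtain n where n: "eqr T' (rv (App y n)) (rv (App y k))" "lt T' (rv z - rv (App y n)) (rv (tsub z (App y k)))"
      using near[OF T' H' e] by blast
    have "lt T' (rv (App y k)) (rv (App y n))"
      by (rule ltI[OF T' ltD[OF T' n(2)]]) (use ty in simp)
    then show False using eqr_le[OF T' n(1)] by (simp add: le_def)
  next
    fix T' assume T': "world T'" and H': "T' \<tturnstile> ?H" and "\<not> le T' (rv (App y k)) (rv z)"
    then have e: "is_real (tsub (App y k) z)" "lt T' 0 (rv (tsub (App y k) z))"
      using ltD[OF T', of "rv z" "rv (App y k)"] ty by (simp_all add: le_def)
    obtain n where n: "eqr T' (rv (App y n)) (rv (App y k))" "lt T' (rv (App y n) - rv z) (rv (tsub (App y k) z))"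
      using near[OF T' H' e] by blast
    have "lt T' (rv (App y n)) (rv (App y k))"
      by (rule ltI[OF T' ltD[OF T' n(2)]]) (use ty in simp)
    then show False using eqr_le[OF T' eqr_sym[OF T' n(1)]] by (simp add: le_def)
  qed
qed

text \<open>If no stop occurs, the terms are eventually low. A low \<open>u\<close> is then within
  \<open>r\<close> of a late term, which is within \<open>r\<close> of the limit, and
  \<open>2 r < e\<close>.\<close>

lemma trace_limit_concentrates:
  assumes T: "world T" and f: "T \<tturnstile> pos_qc \<langle>f\<rangle>" and tr: "T \<tturnstile> trace \<langle>f\<rangle> \<langle>a\<rangle> \<langle>y\<rangle>" and c: "T \<tturnstile> converges \<langle>y\<rangle> \<langle>z\<rangle>"
    and alive: "T \<tturnstile> \<^bold>\<not> dead \<langle>a\<rangle>" and ty: "is_fun f" "is_nseq a" "is_rseq y" "is_real z"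
  shows "T \<tturnstile> concentrates \<langle>f\<rangle> \<langle>z\<rangle>"
  unfolding concentrates_def
proof (rule world_all_impI[OF T])
  let ?H = "pos_qc \<langle>f\<rangle> \<^bold>\<and> trace \<langle>f\<rangle> \<langle>a\<rangle> \<langle>y\<rangle> \<^bold>\<and> converges \<langle>y\<rangle> \<langle>z\<rangle> \<^bold>\<and> \<^bold>\<not> dead \<langle>a\<rangle>"
  show "T \<tturnstile> ?H" using assms by simp
  fix T' e assume T': "world T'" and H: "T' \<tturnstile> ?H" and e: "is_real e" and "T' \<tturnstile> \<^bold>0 \<^bold>< \<langle>e\<rangle>"
  then have pos: "lt T' 0 (rv e)" by (simp add: ev)
  have f': "T' \<tturnstile> pos_qc \<langle>f\<rangle>" using T' H by simp
  obtain r where r: "is_real r" "lt T' 0 (rv r)" "lt T' (rv r + rv r) (rv e)" by (rule fraction_ex[OF T' e pos])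
  obtain h where h: "is_real h" "lt T' 0 (rv h)" "T' \<tturnstile> modulus \<langle>f\<rangle> \<langle>h\<rangle> \<langle>r\<rangle>"
    by (rule modulus_ex[OF T' f' ty(1) r(1,2)])
  obtain k where k: "is_nat k" "lt T' 1 (rnat k * rv h)" by (rule archimedes_mul[OF T' h(1,2)])
  let ?H2 = "?H \<^bold>\<and> modulus \<langle>f\<rangle> \<langle>h\<rangle> \<langle>r\<rangle> \<^bold>\<and> \<^bold>1 \<^bold>< real_of \<langle>k\<rangle> \<^bold>* \<langle>h\<rangle> \<^bold>\<and> \<^bold>0 \<^bold>< \<langle>r\<rangle> \<^bold>\<and> \<langle>r\<rangle> \<^bold>+ \<langle>r\<rangle> \<^bold>< \<langle>e\<rangle>"
  have "T' \<tturnstile> \<^bold>\<forall>\<^sub>R u. low \<langle>f\<rangle> \<langle>h\<rangle> u \<^bold>\<longrightarrow> real_abs (u \<^bold>- \<langle>z\<rangle>) \<^bold>< \<langle>e\<rangle>"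
  proof (rule world_all_impI[OF T'])
    show "T' \<tturnstile> ?H2" using T' H e r h k by (simp add: ev)
    fix T2 u assume *: "world T2" "T2 \<tturnstile> ?H2" "is_real u" "T2 \<tturnstile> low \<langle>f\<rangle> \<langle>h\<rangle> \<langle>u\<rangle>"
    have H2: "T2 \<tturnstile> pos_qc \<langle>f\<rangle>" "T2 \<tturnstile> trace \<langle>f\<rangle> \<langle>a\<rangle> \<langle>y\<rangle>" "T2 \<tturnstile> converges \<langle>y\<rangle> \<langle>z\<rangle>" "T2 \<tturnstile> \<^bold>\<not> dead \<langle>a\<rangle>"
      "T2 \<tturnstile> modulus \<langle>f\<rangle> \<langle>h\<rangle> \<langle>r\<rangle>" "lt T2 1 (rnat k * rv h)" "lt T2 0 (rv r)" "lt T2 (rv r + rv r) (rv e)"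
      using * k h r e by (simp_all add: ev)
    obtain m where m: "is_nat m" "\<And>n. is_nat n \<Longrightarrow> T2 \<tturnstile> \<langle>m\<rangle> \<^bold>\<le>\<^sub>N \<langle>n\<rangle> \<Longrightarrow> lt T2 (rv (App y n) - rv z) (rv r)"
      "\<And>n. is_nat n \<Longrightarrow> T2 \<tturnstile> \<langle>m\<rangle> \<^bold>\<le>\<^sub>N \<langle>n\<rangle> \<Longrightarrow> lt T2 (rv z - rv (App y n)) (rv r)"
      using convergesD[OF *(1) H2(3) ty(3,4) r(1) H2(7)] by blast
    define n where "n = tplus k m"
    have n: "is_nat n" "T2 \<tturnstile> \<langle>k\<rangle> \<^bold>\<le>\<^sub>N \<langle>n\<rangle>" "T2 \<tturnstile> \<langle>m\<rangle> \<^bold>\<le>\<^sub>N \<langle>n\<rangle>"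
      using nat_le_plus[OF *(1) k(1) m(1)] k m by (simp_all add: n_def)
    have yn: "is_real (App y n)" using ty n by simp
    have "lt T2 (rnat k * rv (App f (App y k))) 1"
      using trace_point(2)[OF *(1) H2(2) ty(1-3) k(1)] world_not[OF *(1) H2(4)] by blast
    then have "lt T2 (rnat k * rv (App f (App y n))) 1"
      by (rule trace_stays_low[OF *(1) H2(1,2) ty(1-3) k(1) n(1) _ n(2)])
    then have "lt T2 (rv (App f (App y n))) (rv h)" by (rule small_of_mul_less[OF *(1) k(1) H2(6)])
    then have low: "T2 \<tturnstile> low \<langle>f\<rangle> \<langle>h\<rangle> \<langle>App y n\<rangle>"
      using holds_low[OF *(1) ty(1) h(1) yn] trace_point(1)[OF *(1) H2(2) ty(1-3) n(1)] by blast
    have near: "lt T2 (rv u - rv (App y n)) (rv r)" "lt T2 (rv (App y n) - rv u) (rv r)"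
      using modulusD[OF *(1) H2(5) ty(1) h(1) r(1) *(3) yn *(4) low] holds_abs_diff[OF *(1,3) yn r(1)] by blast+
    have "lt T2 0 ((rv r - (rv u - rv (App y n))) + (rv r - (rv (App y n) - rv z)) + (rv e - (rv r + rv r)))"
      by (intro pos_add[OF *(1)] ltD[OF *(1)] near m(2) n H2(8))
    then have "lt T2 (rv u - rv z) (rv e)" by (rule ltI[OF *(1)]) (simp add: algebra_simps)
    moreover have "lt T2 0 ((rv r - (rv (App y n) - rv u)) + (rv r - (rv z - rv (App y n))) + (rv e - (rv r + rv r)))"
      by (intro pos_add[OF *(1)] ltD[OF *(1)] near m(3) n H2(8))
    then have "lt T2 (rv z - rv u) (rv e)" by (rule ltI[OF *(1)]) (simp add: algebra_simps)
    ultimately show "T2 \<tturnstile> real_abs (\<langle>u\<rangle> \<^bold>- \<langle>z\<rangle>) \<^bold>< \<langle>e\<rangle>"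
      using holds_abs_diff[OF *(1,3) ty(4) e] by blast
  qed (use ty e h in simp_all)
  then have "T' \<tturnstile> \<^bold>0 \<^bold>< \<langle>h\<rangle> \<^bold>\<and> (\<^bold>\<forall>\<^sub>R u. low \<langle>f\<rangle> \<langle>h\<rangle> u \<^bold>\<longrightarrow> real_abs (u \<^bold>- \<langle>z\<rangle>) \<^bold>< \<langle>e\<rangle>)"
    using h T' by (simp add: ev)
  then show "T' \<tturnstile> \<^bold>\<exists>\<^sub>R h. \<^bold>0 \<^bold>< h \<^bold>\<and> (\<^bold>\<forall>\<^sub>R u. low \<langle>f\<rangle> h u \<^bold>\<longrightarrow> real_abs (u \<^bold>- \<langle>z\<rangle>) \<^bold>< \<langle>e\<rangle>)"
    by (rule world_exI[OF T' _ h(1)]) (use ty e in simp)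
qed (use ty in simp_all)

text \<open>
  The positivity of \<open>f z\<close> will exclude one of the alternatives for a large \<open>k\<close>: this is what
  decides between a stopped and a never stopping sequence.
\<close>

lemma switch_limit:
  assumes T: "world T" and sw: "T \<tturnstile> switch \<langle>f\<rangle> \<langle>a\<rangle>" and ty: "is_fun f" "is_nseq a"
  obtains z where "is_real z" "T \<tturnstile> unit_interval \<langle>z\<rangle>"
    "\<And>k. is_nat k \<Longrightarrow> (T \<tturnstile> dead \<langle>a\<rangle>) \<or> (T \<tturnstile> dead \<langle>a\<rangle> \<^bold>\<longrightarrow> real_of \<langle>k\<rangle> \<^bold>* \<langle>App f z\<rangle> \<^bold>< \<^bold>1)"
    "T \<tturnstile> \<^bold>\<not> dead \<langle>a\<rangle> \<^bold>\<longrightarrow> concentrates \<langle>f\<rangle> \<langle>z\<rangle>"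
proof -
  obtain y where y: "is_rseq y" and tr: "T \<tturnstile> trace \<langle>f\<rangle> \<langle>a\<rangle> \<langle>y\<rangle>" by (rule trace_ex[OF T sw ty])
  have "T \<tturnstile> cauchy \<langle>y\<rangle> \<^bold>\<longrightarrow> (\<^bold>\<exists>\<^sub>R x. converges \<langle>y\<rangle> x)"
    by (rule world_axiom1[OF T complete]) (use y in simp_all)
  from world_mp[OF T this trace_cauchy[OF T sw tr ty y]]
  obtain z where z: "is_real z" and c: "T \<tturnstile> converges \<langle>y\<rangle> \<langle>z\<rangle>"
    by (rule world_exE[OF T]) (use y in simp_all)
  have f: "T \<tturnstile> pos_qc \<langle>f\<rangle>" by (rule switch_pos_qc[OF T sw ty])
  have "T \<tturnstile> \<^bold>\<forall>\<^sub>N n. unit_interval (\<langle>y\<rangle> \<^bold>\<cdot> n)"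
    by (rule world_allI[OF T tr]) (use trace_point(1) ty y in simp_all)
  then have "T \<tturnstile> unit_interval \<langle>z\<rangle>" by (rule limit_unit_interval[OF T c _ y z])
  moreover have "(T \<tturnstile> dead \<langle>a\<rangle>) \<or> (T \<tturnstile> dead \<langle>a\<rangle> \<^bold>\<longrightarrow> real_of \<langle>k\<rangle> \<^bold>* \<langle>App f z\<rangle> \<^bold>< \<^bold>1)" if k: "is_nat k" for k
    using trace_point(2)[OF T tr ty y k]
  proof
    assume low: "lt T (rnat k * rv (App f (App y k))) 1"
    let ?H = "switch \<langle>f\<rangle> \<langle>a\<rangle> \<^bold>\<and> trace \<langle>f\<rangle> \<langle>a\<rangle> \<langle>y\<rangle> \<^bold>\<and> converges \<langle>y\<rangle> \<langle>z\<rangle> \<^bold>\<and> real_of \<langle>k\<rangle> \<^bold>* \<langle>App f (App y k)\<rangle> \<^bold>< \<^bold>1"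
    \<comment> \<open>If a stop is recorded in a larger world, the limit equals a late term there,
      and this term has kept the bound of stage \<open>k\<close>. Equality replaces the missing
      continuity of \<open>f\<close>.\<close>
    have "T \<tturnstile> dead \<langle>a\<rangle> \<^bold>\<longrightarrow> real_of \<langle>k\<rangle> \<^bold>* \<langle>App f z\<rangle> \<^bold>< \<^bold>1"
    proof (rule world_impI[OF T])
      show "T \<tturnstile> ?H" using T sw tr c low k ty y by (simp add: ev)
      fix T' assume T': "world T'" and "T' \<tturnstile> ?H" and dead: "T' \<tturnstile> dead \<langle>a\<rangle>"
      then have H: "T' \<tturnstile> switch \<langle>f\<rangle> \<langle>a\<rangle>" "T' \<tturnstile> trace \<langle>f\<rangle> \<langle>a\<rangle> \<langle>y\<rangle>" "T' \<tturnstile> converges \<langle>y\<rangle> \<langle>z\<rangle>"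
        "lt T' (rnat k * rv (App f (App y k))) 1"
        using k ty y by (simp_all add: ev)
      obtain m where m: "is_nat m" "T' \<tturnstile> \<^bold>\<forall>\<^sub>N i. \<langle>m\<rangle> \<^bold>\<le>\<^sub>N i \<^bold>\<longrightarrow> \<langle>y\<rangle> \<^bold>\<cdot> i \<^bold>= \<langle>y\<rangle> \<^bold>\<cdot> \<langle>m\<rangle>"
        by (rule trace_dead_constant[OF T' H(1,2) ty y dead])
      \<comment> \<open>The sum lies beyond both stages: \<open>k\<close>, after which the value
        stays low, and \<open>m\<close>, after which the sequence is constant.\<close>
      define n where "n = tplus k m"
      have n: "is_nat n" "T' \<tturnstile> \<langle>k\<rangle> \<^bold>\<le>\<^sub>N \<langle>n\<rangle>" "T' \<tturnstile> \<langle>m\<rangle> \<^bold>\<le>\<^sub>N \<langle>n\<rangle>"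
        using nat_le_plus[OF T' k m(1)] k m by (simp_all add: n_def)
      have "T' \<tturnstile> \<langle>y\<rangle> \<^bold>\<cdot> \<langle>n\<rangle> \<^bold>= \<langle>y\<rangle> \<^bold>\<cdot> \<langle>m\<rangle>"
        by (rule world_all_impD[OF T' m(2) n(3,1)]) (use m y in simp)
      from world_trans[OF T' _ world_sym[OF T' limit_constant[OF T' H(3) m(2) y z m(1)]], of "App y n" RealT] this
      have "eqr T' (rv (App y n)) (rv z)" using y z n m T' by (simp add: ev)
      then have "eqr T' (rv (App f (App y n))) (rv (App f z))"
        by (intro fun_cong_rv[OF T' ty(1)]) (use y n z in simp_all)
      moreover have "lt T' (rnat k * rv (App f (App y n))) 1"
        by (rule trace_stays_low[OF T' switch_pos_qc[OF T' H(1) ty] H(2) ty y k n(1) H(4) n(2)])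
      ultimately have "lt T' (rnat k * rv (App f z)) 1" using mul_less_cong[OF T'] by blast
      then show "T' \<tturnstile> real_of \<langle>k\<rangle> \<^bold>* \<langle>App f z\<rangle> \<^bold>< \<^bold>1" using T' k ty z by (simp add: ev)
    qed
    then show ?thesis ..
  qed simp
  moreover have "T \<tturnstile> \<^bold>\<not> dead \<langle>a\<rangle> \<^bold>\<longrightarrow> concentrates \<langle>f\<rangle> \<langle>z\<rangle>"
  proof (rule world_impI[OF T])
    let ?H = "pos_qc \<langle>f\<rangle> \<^bold>\<and> trace \<langle>f\<rangle> \<langle>a\<rangle> \<langle>y\<rangle> \<^bold>\<and> converges \<langle>y\<rangle> \<langle>z\<rangle>"
    show "T \<tturnstile> ?H" using T f tr c by simp
    fix T' assume "world T'" "T' \<tturnstile> ?H" "T' \<tturnstile> \<^bold>\<not> dead \<langle>a\<rangle>"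
    then show "T' \<tturnstile> concentrates \<langle>f\<rangle> \<langle>z\<rangle>"
      using trace_limit_concentrates[of T' f a y z] ty y z by simp
  qed
  ultimately show thesis using that z by blast
qed

section \<open>Infima\<close>

lemma rel_is_inf [simp]:
  "(\<And>j. k \<le> j \<Longrightarrow> rel_tm p \<theta> j s s') \<Longrightarrow> (\<And>j. k \<le> j \<Longrightarrow> rel_tm p \<theta> j t t') \<Longrightarrow>
   rel_form p \<theta> k (is_inf s unit_interval t) (is_inf s' unit_interval t')"
  by (simp add: is_inf_def)

lemma holds_leI_strict:
  assumes "world T" "is_real s" "is_real t" "lt T (rv s) (rv t)"
  shows "T \<tturnstile> \<langle>s\<rangle> \<^bold>\<le> \<langle>t\<rangle>"
  by (rule holds_leI[OF assms(1), of "\<langle>s\<rangle> \<^bold>< \<langle>t\<rangle>"]) (use assms lt_imp_le in \<open>auto simp: ev\<close>)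

lemma is_infD:
  assumes T: "world T" and inf: "T \<tturnstile> is_inf \<langle>f\<rangle> unit_interval \<langle>m\<rangle>" and ty: "is_fun f" "is_real m" "is_real e"
    and e: "lt T 0 (rv e)"
  obtains u where "is_real u" "T \<tturnstile> unit_interval \<langle>u\<rangle>" "lt T (rv (App f u)) (rv m + rv e)"
proof -
  have 1: "T \<tturnstile> \<^bold>\<forall>\<^sub>R \<epsilon>. \<^bold>0 \<^bold>< \<epsilon> \<^bold>\<longrightarrow> (\<^bold>\<exists>\<^sub>R x. unit_interval x \<^bold>\<and> \<langle>f\<rangle> \<^bold>\<cdot> x \<^bold>< \<langle>m\<rangle> \<^bold>+ \<epsilon>)"
    using T inf by (simp add: is_inf_def)
  have 2: "T \<tturnstile> \<^bold>\<exists>\<^sub>R x. unit_interval x \<^bold>\<and> \<langle>f\<rangle> \<^bold>\<cdot> x \<^bold>< \<langle>m\<rangle> \<^bold>+ \<langle>e\<rangle>"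
    by (rule world_all_impD[OF T 1 _ ty(3)]) (use T ty e in \<open>simp_all add: ev\<close>)
  obtain u where "is_real u" "T \<tturnstile> unit_interval \<langle>u\<rangle> \<^bold>\<and> \<langle>f\<rangle> \<^bold>\<cdot> \<langle>u\<rangle> \<^bold>< \<langle>m\<rangle> \<^bold>+ \<langle>e\<rangle>"
    by (rule world_exE[OF T 2]) (use ty in simp_all)
  then show thesis using that[of u] T ty by (simp add: ev)
qed

text \<open>The slack \<open>1 - n m\<close> leaves room for a value slightly above
  \<open>m\<close>; the factor \<open>n + 1\<close> in place of \<open>n\<close> covers
  \<open>n = 0\<close>.\<close>

lemma is_inf_scaled:
  assumes T: "world T" and inf: "T \<tturnstile> is_inf \<langle>f\<rangle> unit_interval \<langle>m\<rangle>" and ty: "is_fun f" "is_real m" "is_nat n"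
    and n: "lt T (rnat n * rv m) 1"
  shows "\<exists>u. is_real u \<and> (T \<tturnstile> unit_interval \<langle>u\<rangle>) \<and> lt T (rnat n * rv (App f u)) 1"
proof -
  let ?n = "tadd (App (Con CROfNat) n) (Con CROne)"
  have n1: "is_real ?n" "rv ?n = rnat n + 1" using ty by (simp_all add: ev)
  have "lt T 0 (1 + rnat n)" by (rule pos_add_nonneg[OF T lt_zero_one[OF T] rnat_nonneg[OF T ty(3)]])
  then have "lt T 0 (rv ?n)" by (simp add: n1 add.commute)
  then obtain w where w: "is_real w" "lt T 0 (rv w)" "eqr T (rv ?n * rv w) 1" using inverse_ex[OF T _ n1(1)] by blast
  \<comment> \<open>This is \<open>(1 - n m) / (n + 1)\<close>, so that
    \<open>n (m + e) = 1 - e\<close>.\<close>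
  define e where "e = tmul (tsub (Con CROne) (tmul (App (Con CROfNat) n) m)) w"
  have e: "is_real e" "rv e = (1 - rnat n * rv m) * rv w" using ty w by (simp_all add: e_def ev)
  have e0: "lt T 0 (rv e)" unfolding e by (rule lt_mul[OF T ltD[OF T n] w(2)])
  obtain u where u: "is_real u" "T \<tturnstile> unit_interval \<langle>u\<rangle>" "lt T (rv (App f u)) (rv m + rv e)"
    by (rule is_infD[OF T inf ty(1,2) e(1) e0])
  have "eqr T ((1 - rnat n * rv m) * (rv ?n * rv w)) ((1 - rnat n * rv m) * 1)" by (rule eqr_mul[OF T w(3)])
  moreover have "(1 - rnat n * rv m) * (rv ?n * rv w) = rnat n * rv e + rv e"
    by (simp add: n1 e algebra_simps)
  ultimately have "le T (rnat n * rv e + rv e) (1 - rnat n * rv m)" using eqr_le[OF T] by simp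
  \<comment> \<open>The sum is \<open>1 - n f u\<close>; its strict positivity comes from the first
    summand.\<close>
  then have "lt T 0 (rv e + (1 - rnat n * rv m - (rnat n * rv e + rv e)) + rnat n * (rv m + rv e - rv (App f u)))"
    by (intro pos_add_nonneg[OF T] e0 nonneg_mul[OF T rnat_nonneg[OF T ty(3)]] leD[OF T] lt_imp_le[OF T u(3)])
  then have "lt T (rnat n * rv (App f u)) 1" by (rule ltI[OF T]) (simp add: algebra_simps)
  with u show ?thesis by blast
qed

section \<open>Switches given by a disjunction\<close>

abbreviation indicator :: "tm \<Rightarrow> (tm \<Rightarrow> form) \<Rightarrow> (tm \<Rightarrow> form) \<Rightarrow> form" where
  "indicator a Z E \<equiv> \<^bold>\<forall>\<^sub>N n. (a \<^bold>\<cdot> n \<^bold>= \<^bold>0\<^sub>N \<^bold>\<and> Z n) \<^bold>\<or> (\<^bold>\<not> (a \<^bold>\<cdot> n \<^bold>= \<^bold>0\<^sub>N) \<^bold>\<and> E n)"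

text \<open>Countable choice selects at each \<open>n\<close> the number 0 or 1 as a record of an
  alternative that holds. The record can then be tested, which is not known of \<open>Z\<close> and
  \<open>E\<close>.\<close>

lemma indicator_ex:
  assumes T: "world T" and H: "T \<tturnstile> H" and par: "par Z" "par E"
    and cases: "\<And>T' n. world T' \<Longrightarrow> T' \<tturnstile> H \<Longrightarrow> is_nat n \<Longrightarrow> (T' \<tturnstile> Z \<langle>n\<rangle>) \<or> (T' \<tturnstile> E \<langle>n\<rangle>)"
  obtains a where "is_nseq a" "T \<tturnstile> indicator \<langle>a\<rangle> Z E"
proof (rule world_choice[OF T H, of "\<lambda>n w. (w \<^bold>= \<^bold>0\<^sub>N \<^bold>\<and> Z n) \<^bold>\<or> (\<^bold>\<not> (w \<^bold>= \<^bold>0\<^sub>N) \<^bold>\<and> E n)" NatT])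
  show "par2 (\<lambda>n w. (w \<^bold>= \<^bold>0\<^sub>N \<^bold>\<and> Z n) \<^bold>\<or> (\<^bold>\<not> (w \<^bold>= \<^bold>0\<^sub>N) \<^bold>\<and> E n))"
    using par by (simp add: par_def)
  fix T' n assume T': "world T'" "T' \<tturnstile> H" "is_nat n"
  have "T' \<tturnstile> \<langle>Con CNZero\<rangle> \<^bold>= \<^bold>0\<^sub>N" using T' by (simp add: cst_con world_refl)
  moreover have "T' \<tturnstile> \<^bold>\<not> (\<langle>tsuc (Con CNZero)\<rangle> \<^bold>= \<^bold>0\<^sub>N)"
    by (rule world_notI[OF T'(1) holds_verum[OF T'(1)]]) (use nat_suc_neq_zero in \<open>simp add: cst_con\<close>)
  ultimately show "\<exists>w. is_nat w \<and> (T' \<tturnstile> (\<langle>w\<rangle> \<^bold>= \<^bold>0\<^sub>N \<^bold>\<and> Z \<langle>n\<rangle>) \<^bold>\<or> (\<^bold>\<not> (\<langle>w\<rangle> \<^bold>= \<^bold>0\<^sub>N) \<^bold>\<and> E \<langle>n\<rangle>))"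
    using cases[OF T'] T'(1)
    by (elim disjE) (rule exI[of _ "Con CNZero"], simp, rule exI[of _ "tsuc (Con CNZero)"], simp)
qed (use that in blast)

lemma indicatorD:
  assumes T: "world T" and ind: "T \<tturnstile> indicator \<langle>a\<rangle> Z E" and ty: "is_nseq a" "is_nat n" and par: "par Z" "par E"
  shows "(T \<tturnstile> \<langle>App a n\<rangle> \<^bold>= \<^bold>0\<^sub>N) \<and> (T \<tturnstile> Z \<langle>n\<rangle>) \<or> (T \<tturnstile> \<^bold>\<not> (\<langle>App a n\<rangle> \<^bold>= \<^bold>0\<^sub>N)) \<and> (T \<tturnstile> E \<langle>n\<rangle>)"
proof -
  have "T \<tturnstile> (\<langle>a\<rangle> \<^bold>\<cdot> \<langle>n\<rangle> \<^bold>= \<^bold>0\<^sub>N \<^bold>\<and> Z \<langle>n\<rangle>) \<^bold>\<or> (\<^bold>\<not> (\<langle>a\<rangle> \<^bold>\<cdot> \<langle>n\<rangle> \<^bold>= \<^bold>0\<^sub>N) \<^bold>\<and> E \<langle>n\<rangle>)"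
    by (rule world_all[OF T ind _ ty(2)]) (use par ty in \<open>simp add: par_def\<close>)
  then show ?thesis using T by simp
qed

lemma indicator_deadD:
  assumes T: "world T" and ind: "T \<tturnstile> indicator \<langle>a\<rangle> Z E" and ty: "is_nseq a" and par: "par Z" "par E"
    and dead: "T \<tturnstile> dead \<langle>a\<rangle>"
  obtains n where "is_nat n" "T \<tturnstile> E \<langle>n\<rangle>"
proof -
  obtain n where n: "is_nat n" "T \<tturnstile> \<^bold>\<not> (\<langle>a\<rangle> \<^bold>\<cdot> \<langle>n\<rangle> \<^bold>= \<^bold>0\<^sub>N)"
    by (rule world_exE[OF T dead[unfolded dead_def]]) (use ty in simp_all)
  then show thesis using indicatorD[OF T ind ty n(1) par] world_not[OF T n(2)] that by simp
qed

lemma switchI: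
  assumes T: "world T" and H: "T \<tturnstile> H" and f: "T \<tturnstile> pos_qc \<langle>f\<rangle>" and ty: "is_fun f" "is_nseq a" and par: "par Z" "par E"
    and ind: "\<And>T'. world T' \<Longrightarrow> T' \<tturnstile> H \<Longrightarrow> T' \<tturnstile> indicator \<langle>a\<rangle> Z E"
    and alive: "\<And>T' n. world T' \<Longrightarrow> T' \<tturnstile> H \<Longrightarrow> is_nat n \<Longrightarrow> T' \<tturnstile> Z \<langle>n\<rangle> \<Longrightarrow>
      \<exists>u. is_real u \<and> (T' \<tturnstile> unit_interval \<langle>u\<rangle>) \<and> lt T' (rnat n * rv (App f u)) 1"
    and stop: "\<And>T' n. world T' \<Longrightarrow> T' \<tturnstile> H \<Longrightarrow> is_nat n \<Longrightarrow> T' \<tturnstile> E \<langle>n\<rangle> \<Longrightarrow>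
      \<exists>k. is_nat k \<and> (T' \<tturnstile> \<^bold>\<forall>\<^sub>N i. \<langle>k\<rangle> \<^bold>\<le>\<^sub>N i \<^bold>\<longrightarrow> \<^bold>\<not> (\<langle>a\<rangle> \<^bold>\<cdot> i \<^bold>= \<^bold>0\<^sub>N))"
  shows "T \<tturnstile> switch \<langle>f\<rangle> \<langle>a\<rangle>"
proof -
  have "T \<tturnstile> \<^bold>\<forall>\<^sub>N n. \<langle>a\<rangle> \<^bold>\<cdot> n \<^bold>= \<^bold>0\<^sub>N \<^bold>\<or> \<^bold>\<not> (\<langle>a\<rangle> \<^bold>\<cdot> n \<^bold>= \<^bold>0\<^sub>N)"
  proof (rule world_allI[OF T H])
    fix T' n assume *: "world T'" "T' \<tturnstile> H" "is_nat n"
    then show "T' \<tturnstile> \<langle>a\<rangle> \<^bold>\<cdot> \<langle>n\<rangle> \<^bold>= \<^bold>0\<^sub>N \<^bold>\<or> \<^bold>\<not> (\<langle>a\<rangle> \<^bold>\<cdot> \<langle>n\<rangle> \<^bold>= \<^bold>0\<^sub>N)"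
      using indicatorD[OF *(1) ind[OF *(1,2)] ty(2) *(3) par] by auto
  qed (use ty in simp)
  moreover have "T \<tturnstile> \<^bold>\<forall>\<^sub>N n. \<langle>a\<rangle> \<^bold>\<cdot> n \<^bold>= \<^bold>0\<^sub>N \<^bold>\<longrightarrow> (\<^bold>\<exists>\<^sub>R u. unit_interval u \<^bold>\<and> real_of n \<^bold>* (\<langle>f\<rangle> \<^bold>\<cdot> u) \<^bold>< \<^bold>1)"
  proof (rule world_all_impI[OF T H])
    fix T' n assume *: "world T'" "T' \<tturnstile> H" "is_nat n" "T' \<tturnstile> \<langle>a\<rangle> \<^bold>\<cdot> \<langle>n\<rangle> \<^bold>= \<^bold>0\<^sub>N"
    then have "T' \<tturnstile> Z \<langle>n\<rangle>"
      using indicatorD[OF *(1) ind[OF *(1,2)] ty(2) *(3) par] world_not[OF *(1)] by auto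
    then obtain u where u: "is_real u" "T' \<tturnstile> unit_interval \<langle>u\<rangle>" "lt T' (rnat n * rv (App f u)) 1"
      using alive[OF *(1-3)] by blast
    then have "T' \<tturnstile> unit_interval \<langle>u\<rangle> \<^bold>\<and> real_of \<langle>n\<rangle> \<^bold>* (\<langle>f\<rangle> \<^bold>\<cdot> \<langle>u\<rangle>) \<^bold>< \<^bold>1" using * ty by (simp add: ev)
    then show "T' \<tturnstile> \<^bold>\<exists>\<^sub>R u. unit_interval u \<^bold>\<and> real_of \<langle>n\<rangle> \<^bold>* (\<langle>f\<rangle> \<^bold>\<cdot> u) \<^bold>< \<^bold>1"
      by (rule world_exI[OF *(1) _ u(1)]) (use ty * in simp)
  qed (use ty in simp_all)
  moreover have "T \<tturnstile> \<^bold>\<forall>\<^sub>N n. \<^bold>\<not> (\<langle>a\<rangle> \<^bold>\<cdot> n \<^bold>= \<^bold>0\<^sub>N) \<^bold>\<longrightarrow> (\<^bold>\<exists>\<^sub>N k. \<^bold>\<forall>\<^sub>N i. k \<^bold>\<le>\<^sub>N i \<^bold>\<longrightarrow> \<^bold>\<not> (\<langle>a\<rangle> \<^bold>\<cdot> i \<^bold>= \<^bold>0\<^sub>N))"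
  proof (rule world_all_impI[OF T H])
    fix T' n assume *: "world T'" "T' \<tturnstile> H" "is_nat n" "T' \<tturnstile> \<^bold>\<not> (\<langle>a\<rangle> \<^bold>\<cdot> \<langle>n\<rangle> \<^bold>= \<^bold>0\<^sub>N)"
    then have "T' \<tturnstile> E \<langle>n\<rangle>"
      using indicatorD[OF *(1) ind[OF *(1,2)] ty(2) *(3) par] world_not[OF *(1,4)] by auto
    then obtain k where "is_nat k" "T' \<tturnstile> \<^bold>\<forall>\<^sub>N i. \<langle>k\<rangle> \<^bold>\<le>\<^sub>N i \<^bold>\<longrightarrow> \<^bold>\<not> (\<langle>a\<rangle> \<^bold>\<cdot> i \<^bold>= \<^bold>0\<^sub>N)"
      using stop[OF *(1-3)] by blast
    then show "T' \<tturnstile> \<^bold>\<exists>\<^sub>N k. \<^bold>\<forall>\<^sub>N i. k \<^bold>\<le>\<^sub>N i \<^bold>\<longrightarrow> \<^bold>\<not> (\<langle>a\<rangle> \<^bold>\<cdot> i \<^bold>= \<^bold>0\<^sub>N)"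
      by (intro world_exI[OF *(1)]) (use ty in simp_all)
  qed (use ty in simp_all)
  ultimately show ?thesis using T f by (simp add: switch_def)
qed

lemma is_inf_dichotomy:
  assumes T: "world T" and f: "T \<tturnstile> pos_qc \<langle>f\<rangle>" and inf: "T \<tturnstile> is_inf \<langle>f\<rangle> unit_interval \<langle>m\<rangle>" and ty: "is_fun f" "is_real m"
  shows "lt T 0 (rv m) \<or> (T \<tturnstile> is_inf \<langle>f\<rangle> unit_interval \<^bold>0)"
proof -
  let ?Z = "\<lambda>n. real_of n \<^bold>* \<langle>m\<rangle> \<^bold>< \<^bold>1" let ?E = "\<lambda>n::tm. \<^bold>0 \<^bold>< \<langle>m\<rangle>"
  have par: "par ?Z" "par ?E" using ty by simp_all
  have Z: "(T' \<tturnstile> ?Z \<langle>n\<rangle>) \<longleftrightarrow> lt T' (rnat n * rv m) 1" and E: "(T' \<tturnstile> \<^bold>0 \<^bold>< \<langle>m\<rangle>) \<longleftrightarrow> lt T' 0 (rv m)"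
    if "world T'" "is_nat n" for T' n
    using that ty by (simp_all add: ev)
  obtain a where a: "is_nseq a" and ind: "T \<tturnstile> indicator \<langle>a\<rangle> ?Z ?E"
  proof (rule indicator_ex[OF T holds_verum[OF T] par])
    fix T' n assume *: "world T'" "is_nat n"
    \<comment> \<open>Cotransitivity of \<open>0 < 1\<close> at \<open>n m\<close>; from
      \<open>0 < n m\<close> the factor \<open>n\<close> is cancelled.\<close>
    show "(T' \<tturnstile> ?Z \<langle>n\<rangle>) \<or> (T' \<tturnstile> \<^bold>0 \<^bold>< \<langle>m\<rangle>)"
      unfolding Z[OF *] E[OF *]
      using lt_cotrans[OF *(1) lt_zero_one[OF *(1)], of "rnat n * rv m"] pos_mulD[OF *(1) rnat_nonneg[OF *]] by blast
  qed
  let ?H = "is_inf \<langle>f\<rangle> unit_interval \<langle>m\<rangle> \<^bold>\<and> indicator \<langle>a\<rangle> ?Z ?E"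
  have sw: "T \<tturnstile> switch \<langle>f\<rangle> \<langle>a\<rangle>"
  proof (rule switchI[OF T _ f ty(1) a par])
    show "T \<tturnstile> ?H" using T inf ind by simp
    fix T' assume T': "world T'" "T' \<tturnstile> ?H"
    then have h: "T' \<tturnstile> is_inf \<langle>f\<rangle> unit_interval \<langle>m\<rangle>" "T' \<tturnstile> indicator \<langle>a\<rangle> ?Z ?E" by simp_all
    show "T' \<tturnstile> indicator \<langle>a\<rangle> ?Z ?E" by (rule h(2))
    fix n assume n: "is_nat n"
    show "\<exists>u. is_real u \<and> (T' \<tturnstile> unit_interval \<langle>u\<rangle>) \<and> lt T' (rnat n * rv (App f u)) 1" if "T' \<tturnstile> ?Z \<langle>n\<rangle>"
      using is_inf_scaled[OF T'(1) h(1) ty n] that Z[OF T'(1) n] by blast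
    show "\<exists>k. is_nat k \<and> (T' \<tturnstile> \<^bold>\<forall>\<^sub>N i. \<langle>k\<rangle> \<^bold>\<le>\<^sub>N i \<^bold>\<longrightarrow> \<^bold>\<not> (\<langle>a\<rangle> \<^bold>\<cdot> i \<^bold>= \<^bold>0\<^sub>N))" if "T' \<tturnstile> ?E \<langle>n\<rangle>"
    proof -
      have m: "lt T' 0 (rv m)" using that E[OF T'(1) n] by blast
      \<comment> \<open>For \<open>i >= k\<close> the alternative \<open>i m < 1\<close> is
        impossible, so a positive infimum forces a stop from stage \<open>k\<close> on.\<close>
      obtain k where k: "is_nat k" "lt T' 1 (rnat k * rv m)" by (rule archimedes_mul[OF T'(1) ty(2) m])
      let ?H2 = "indicator \<langle>a\<rangle> ?Z ?E \<^bold>\<and> \<^bold>1 \<^bold>< real_of \<langle>k\<rangle> \<^bold>* \<langle>m\<rangle>"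
      have "T' \<tturnstile> \<^bold>\<forall>\<^sub>N i. \<langle>k\<rangle> \<^bold>\<le>\<^sub>N i \<^bold>\<longrightarrow> \<^bold>\<not> (\<langle>a\<rangle> \<^bold>\<cdot> i \<^bold>= \<^bold>0\<^sub>N)"
      proof (rule world_all_impI[OF T'(1)])
        show "T' \<tturnstile> ?H2" using T' h k ty by (simp add: ev)
        fix T2 i assume T2: "world T2" "T2 \<tturnstile> ?H2" "is_nat i" "T2 \<tturnstile> \<langle>k\<rangle> \<^bold>\<le>\<^sub>N \<langle>i\<rangle>"
        show "T2 \<tturnstile> \<^bold>\<not> (\<langle>a\<rangle> \<^bold>\<cdot> \<langle>i\<rangle> \<^bold>= \<^bold>0\<^sub>N)"
        proof (rule world_notI[OF T2(1), of "?H2 \<^bold>\<and> \<langle>k\<rangle> \<^bold>\<le>\<^sub>N \<langle>i\<rangle>"])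
          show "T2 \<tturnstile> ?H2 \<^bold>\<and> \<langle>k\<rangle> \<^bold>\<le>\<^sub>N \<langle>i\<rangle>" using T2 by simp
          fix T3 assume T3: "world T3" "T3 \<tturnstile> ?H2 \<^bold>\<and> \<langle>k\<rangle> \<^bold>\<le>\<^sub>N \<langle>i\<rangle>" and zero: "T3 \<tturnstile> \<langle>a\<rangle> \<^bold>\<cdot> \<langle>i\<rangle> \<^bold>= \<^bold>0\<^sub>N"
          then have h3: "T3 \<tturnstile> indicator \<langle>a\<rangle> ?Z ?E" "lt T3 1 (rnat k * rv m)" "T3 \<tturnstile> \<langle>k\<rangle> \<^bold>\<le>\<^sub>N \<langle>i\<rangle>"
            using k ty by (simp_all add: ev)
          have "lt T3 (rnat i * rv m) 1"
            using indicatorD[OF T3(1) h3(1) a T2(3) par] zero world_not[OF T3(1)] Z[OF T3(1) T2(3)] by auto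
          moreover have "le T3 0 (rv m)"
            using pos_mulD[OF T3(1) rnat_nonneg[OF T3(1) k(1)] lt_trans[OF T3(1) lt_zero_one[OF T3(1)] h3(2)]] lt_imp_le[OF T3(1)] by blast
          ultimately have "lt T3 (rnat k * rv m) 1"
            using mul_less_mono[OF T3(1)] rnat_mono[OF T3(1) k(1) T2(3) h3(3)] by blast
          then show False using lt_asym[OF T3(1) h3(2)] by (simp add: le_def)
        qed
      qed (use k a in simp_all)
      with k show ?thesis by blast
    qed
  qed
  obtain z where z: "is_real z" "T \<tturnstile> unit_interval \<langle>z\<rangle>"
    "\<forall>k. is_nat k \<longrightarrow> (T \<tturnstile> dead \<langle>a\<rangle>) \<or> (T \<tturnstile> dead \<langle>a\<rangle> \<^bold>\<longrightarrow> real_of \<langle>k\<rangle> \<^bold>* \<langle>App f z\<rangle> \<^bold>< \<^bold>1)"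
    using switch_limit[OF T sw ty(1) a] by blast
  have fz: "is_real (App f z)" using ty z by simp
  \<comment> \<open>At this stage the bound on \<open>f z\<close> in the second alternative of
    \<open>switch_limit\<close> is false, so that alternative refutes a stop.\<close>
  obtain k where k: "is_nat k" "lt T 1 (rnat k * rv (App f z))"
    by (rule archimedes_mul[OF T fz positive_valuedD[OF T f z(2) ty(1) z(1)]])
  consider "T \<tturnstile> dead \<langle>a\<rangle>" | "T \<tturnstile> dead \<langle>a\<rangle> \<^bold>\<longrightarrow> real_of \<langle>k\<rangle> \<^bold>* \<langle>App f z\<rangle> \<^bold>< \<^bold>1" using z(3) k(1) by blast
  then show ?thesis
  proof cases
    case 1
    then obtain n where "is_nat n" "T \<tturnstile> \<^bold>0 \<^bold>< \<langle>m\<rangle>" by (rule indicator_deadD[OF T ind a par])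
    then show ?thesis using E[OF T] by blast
  next
    case 2
    have "T \<tturnstile> \<^bold>\<forall>\<^sub>R x. unit_interval x \<^bold>\<longrightarrow> \<^bold>0 \<^bold>\<le> \<langle>f\<rangle> \<^bold>\<cdot> x"
    proof (rule world_all_impI[OF T f])
      fix T' x assume *: "world T'" "T' \<tturnstile> pos_qc \<langle>f\<rangle>" "is_real x" "T' \<tturnstile> unit_interval \<langle>x\<rangle>"
      have "T' \<tturnstile> \<langle>Con CRZero\<rangle> \<^bold>\<le> \<langle>App f x\<rangle>"
        by (rule holds_leI_strict[OF *(1)])
          (use positive_valuedD[OF *(1,2,4) ty(1) *(3)] ty * in \<open>simp_all add: ev\<close>)
      then show "T' \<tturnstile> \<^bold>0 \<^bold>\<le> \<langle>f\<rangle> \<^bold>\<cdot> \<langle>x\<rangle>" by (simp add: cst_con)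
    qed (use ty in simp_all)
    moreover have "T \<tturnstile> \<^bold>\<forall>\<^sub>R \<epsilon>. \<^bold>0 \<^bold>< \<epsilon> \<^bold>\<longrightarrow> (\<^bold>\<exists>\<^sub>R x. unit_interval x \<^bold>\<and> \<langle>f\<rangle> \<^bold>\<cdot> x \<^bold>< \<^bold>0 \<^bold>+ \<epsilon>)"
    proof (rule world_all_impI[OF T])
      let ?H3 = "switch \<langle>f\<rangle> \<langle>a\<rangle> \<^bold>\<and> (dead \<langle>a\<rangle> \<^bold>\<longrightarrow> real_of \<langle>k\<rangle> \<^bold>* \<langle>App f z\<rangle> \<^bold>< \<^bold>1) \<^bold>\<and> \<^bold>1 \<^bold>< real_of \<langle>k\<rangle> \<^bold>* \<langle>App f z\<rangle>"
      show "T \<tturnstile> ?H3" using T sw 2 k fz by (simp add: ev)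
      fix T' e assume T': "world T'" and H: "T' \<tturnstile> ?H3" and e: "is_real e" and "T' \<tturnstile> \<^bold>0 \<^bold>< \<langle>e\<rangle>"
      then have pos: "lt T' 0 (rv e)" by (simp add: ev)
      have h: "T' \<tturnstile> switch \<langle>f\<rangle> \<langle>a\<rangle>" "T' \<tturnstile> dead \<langle>a\<rangle> \<^bold>\<longrightarrow> real_of \<langle>k\<rangle> \<^bold>* \<langle>App f z\<rangle> \<^bold>< \<^bold>1" "lt T' 1 (rnat k * rv (App f z))"
        using T' H k fz by (simp_all add: ev)
      obtain n where n: "is_nat n" "lt T' 1 (rnat n * rv e)" by (rule archimedes_mul[OF T' e pos])
      \<comment> \<open>Without a stop all entries of \<open>a\<close> are 0, and each stage
        supplies a point with \<open>n f u < 1\<close>. A stage with \<open>n e > 1\<close> thus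
        gives a value below \<open>e\<close>.\<close>
      have "\<not> (T' \<tturnstile> dead \<langle>a\<rangle>)"
        using world_mp[OF T' h(2)] lt_asym[OF T' h(3)] T' k fz by (auto simp: ev le_def)
      then have "\<not> (T' \<tturnstile> \<^bold>\<not> (\<langle>App a n\<rangle> \<^bold>= \<^bold>0\<^sub>N))"
        using world_exI[OF T', of "\<lambda>n. \<^bold>\<not> (\<langle>a\<rangle> \<^bold>\<cdot> n \<^bold>= \<^bold>0\<^sub>N)" n NatT] n a by (auto simp: dead_def)
      then have "T' \<tturnstile> \<langle>App a n\<rangle> \<^bold>= \<^bold>0\<^sub>N" using switch_cases[OF T' h(1) ty(1) a n(1)] by blast
      then obtain u where u: "is_real u" "T' \<tturnstile> unit_interval \<langle>u\<rangle>" "lt T' (rnat n * rv (App f u)) 1"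
        by (rule switch_alive[OF T' h(1) ty(1) a n(1)])
      have "lt T' (rv (App f u)) (rv e)" by (rule small_of_mul_less[OF T' n u(3)])
      then have "T' \<tturnstile> unit_interval \<langle>u\<rangle> \<^bold>\<and> \<langle>f\<rangle> \<^bold>\<cdot> \<langle>u\<rangle> \<^bold>< \<^bold>0 \<^bold>+ \<langle>e\<rangle>" using T' u e ty by (simp add: ev)
      then show "T' \<tturnstile> \<^bold>\<exists>\<^sub>R x. unit_interval x \<^bold>\<and> \<langle>f\<rangle> \<^bold>\<cdot> x \<^bold>< \<^bold>0 \<^bold>+ \<langle>e\<rangle>"
        by (rule world_exI[OF T' _ u(1)]) (use ty e in simp)
    qed (use ty in simp_all)
    ultimately show ?thesis using T by (simp add: is_inf_def)
  qed
qed

section \<open>Consequences of a vanishing infimum\<close>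

lemma concentratesD:
  assumes T: "world T" and c: "T \<tturnstile> concentrates \<langle>f\<rangle> \<langle>x\<rangle>" and ty: "is_fun f" "is_real x" and e: "is_real e" "lt T 0 (rv e)"
  obtains h where "is_real h" "lt T 0 (rv h)" "T \<tturnstile> \<^bold>\<forall>\<^sub>R u. low \<langle>f\<rangle> \<langle>h\<rangle> u \<^bold>\<longrightarrow> real_abs (u \<^bold>- \<langle>x\<rangle>) \<^bold>< \<langle>e\<rangle>"
proof -
  have "T \<tturnstile> \<^bold>\<exists>\<^sub>R h. \<^bold>0 \<^bold>< h \<^bold>\<and> (\<^bold>\<forall>\<^sub>R u. low \<langle>f\<rangle> h u \<^bold>\<longrightarrow> real_abs (u \<^bold>- \<langle>x\<rangle>) \<^bold>< \<langle>e\<rangle>)"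
    by (rule world_all_impD[OF T c[unfolded concentrates_def] _ e(1)]) (use T ty e in \<open>simp_all add: ev\<close>)
  then obtain h where "is_real h" "T \<tturnstile> \<^bold>0 \<^bold>< \<langle>h\<rangle> \<^bold>\<and> (\<^bold>\<forall>\<^sub>R u. low \<langle>f\<rangle> \<langle>h\<rangle> u \<^bold>\<longrightarrow> real_abs (u \<^bold>- \<langle>x\<rangle>) \<^bold>< \<langle>e\<rangle>)"
    by (rule world_exE[OF T]) (use ty e in simp_all)
  then show thesis using that[of h] T by (simp add: ev)
qed

lemma near_of_low:
  assumes T: "world T" and c: "T \<tturnstile> \<^bold>\<forall>\<^sub>R u. low \<langle>f\<rangle> \<langle>h\<rangle> u \<^bold>\<longrightarrow> real_abs (u \<^bold>- \<langle>x\<rangle>) \<^bold>< \<langle>e\<rangle>"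
    and ty: "is_fun f" "is_real x" "is_real h" "is_real e" "is_real u"
    and u: "T \<tturnstile> unit_interval \<langle>u\<rangle>" "lt T (rv (App f u)) (rv h)"
  shows "T \<tturnstile> real_abs (\<langle>u\<rangle> \<^bold>- \<langle>x\<rangle>) \<^bold>< \<langle>e\<rangle>"
proof -
  have "T \<tturnstile> low \<langle>f\<rangle> \<langle>h\<rangle> \<langle>u\<rangle>" using holds_low[OF T ty(1,3,5)] u by blast
  then show ?thesis by (rule world_all_impD[OF T c _ ty(5)]) (use ty in simp)
qed

text \<open>If \<open>x < z\<close>, a common low point would be close to both. The inequality is
  proved in all worlds with the hypotheses and in both directions, as \<open>tight\<close>
  demands.\<close>

lemma concentrates_unique:
  assumes T: "world T" and inf: "T \<tturnstile> is_inf \<langle>f\<rangle> unit_interval \<^bold>0"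
    and c: "T \<tturnstile> concentrates \<langle>f\<rangle> \<langle>x\<rangle>" "T \<tturnstile> concentrates \<langle>f\<rangle> \<langle>z\<rangle>" and ty: "is_fun f" "is_real x" "is_real z"
  shows "T \<tturnstile> \<langle>x\<rangle> \<^bold>= \<langle>z\<rangle>"
proof -
  have *: "le T (rv z) (rv x)" if T: "world T" and inf: "T \<tturnstile> is_inf \<langle>f\<rangle> unit_interval \<^bold>0"
    and c: "T \<tturnstile> concentrates \<langle>f\<rangle> \<langle>x\<rangle>" "T \<tturnstile> concentrates \<langle>f\<rangle> \<langle>z\<rangle>" and x: "is_real x" and z: "is_real z" for T x z
  proof (rule ccontr)
    assume "\<not> ?thesis"
    then have d: "is_real (tsub z x)" "lt T 0 (rv (tsub z x))"
      using ltD[OF T, of "rv x" "rv z"] x z by (simp_all add: le_def)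
    obtain r where r: "is_real r" "lt T 0 (rv r)" "lt T (rv r + rv r) (rv (tsub z x))" by (rule fraction_ex[OF T d])
    obtain h where h: "is_real h" "lt T 0 (rv h)" "T \<tturnstile> \<^bold>\<forall>\<^sub>R u. low \<langle>f\<rangle> \<langle>h\<rangle> u \<^bold>\<longrightarrow> real_abs (u \<^bold>- \<langle>x\<rangle>) \<^bold>< \<langle>r\<rangle>"
      by (rule concentratesD[OF T c(1) ty(1) x r(1,2)])
    obtain h' where h': "is_real h'" "lt T 0 (rv h')" "T \<tturnstile> \<^bold>\<forall>\<^sub>R u. low \<langle>f\<rangle> \<langle>h'\<rangle> u \<^bold>\<longrightarrow> real_abs (u \<^bold>- \<langle>z\<rangle>) \<^bold>< \<langle>r\<rangle>"
      by (rule concentratesD[OF T c(2) ty(1) z r(1,2)])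
    obtain m where m: "is_real m" "lt T 0 (rv m)"
      "\<And>T' x. world T' \<Longrightarrow> lt T' x (rv m) \<Longrightarrow> lt T' x (rv h) \<and> lt T' x (rv h')"
      by (rule min_ex[OF T h(1) h'(1) h(2) h'(2)]) (rule that; assumption)
    \<comment> \<open>The vanishing infimum supplies a point whose value is below both
      thresholds.\<close>
    obtain u where u: "is_real u" "T \<tturnstile> unit_interval \<langle>u\<rangle>" "lt T (rv (App f u)) (rv (Con CRZero) + rv m)"
      by (rule is_infD[OF T inf[unfolded cst_con] ty(1) _ m(1,2)]) simp
    then have "lt T (rv (App f u)) (rv h)" "lt T (rv (App f u)) (rv h')"
      using m(3)[OF T, of "rv (App f u)"] by (simp_all add: ev)
    then have "lt T (rv u - rv x) (rv r)" "lt T (rv z - rv u) (rv r)"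
      using near_of_low[OF T h(3) ty(1) x h(1) r(1) u(1,2)] near_of_low[OF T h'(3) ty(1) z h'(1) r(1) u(1,2)]
        holds_abs_diff[OF T u(1) x r(1)] holds_abs_diff[OF T u(1) z r(1)] by blast+
    then have "lt T 0 ((rv r - (rv u - rv x)) + (rv r - (rv z - rv u)) + (rv (tsub z x) - (rv r + rv r)))"
      by (intro pos_add[OF T] ltD[OF T] r(3))
    then have "lt T 0 0" using x z by (simp add: algebra_simps)
    then show False using lt_irrefl[OF T] by blast
  qed
  let ?H = "is_inf \<langle>f\<rangle> unit_interval \<^bold>0 \<^bold>\<and> concentrates \<langle>f\<rangle> \<langle>x\<rangle> \<^bold>\<and> concentrates \<langle>f\<rangle> \<langle>z\<rangle>"
  have H: "T \<tturnstile> ?H" using T inf c by simp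
  show ?thesis by (rule tight[OF T H ty(2,3)]) (use * ty in simp_all)
qed

lemma zero_inf_scaled:
  assumes T: "world T" and inf: "T \<tturnstile> is_inf \<langle>f\<rangle> unit_interval \<^bold>0" and ty: "is_fun f" "is_nat n"
  shows "\<exists>u. is_real u \<and> (T \<tturnstile> unit_interval \<langle>u\<rangle>) \<and> lt T (rnat n * rv (App f u)) 1"
  by (rule is_inf_scaled[OF T inf[unfolded cst_con] ty(1) _ ty(2)]) (use lt_zero_one[OF T] in \<open>simp_all add: ev\<close>)

text \<open>A plain minimising sequence is the switch that never stops: the first alternative is
  always true and the second always false.\<close>

lemma concentrates_ex:
  assumes T: "world T" and f: "T \<tturnstile> pos_qc \<langle>f\<rangle>" and inf: "T \<tturnstile> is_inf \<langle>f\<rangle> unit_interval \<^bold>0" and ty: "is_fun f"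
  obtains x where "is_real x" "T \<tturnstile> unit_interval \<langle>x\<rangle>" "T \<tturnstile> concentrates \<langle>f\<rangle> \<langle>x\<rangle>"
proof -
  let ?Z = "\<lambda>n::tm. verum" let ?E = "\<lambda>n::tm. \<^bold>\<bottom>"
  have par: "par ?Z" "par ?E" by (simp_all add: verum_def)
  obtain a where a: "is_nseq a" and ind: "T \<tturnstile> indicator \<langle>a\<rangle> ?Z ?E"
    by (rule indicator_ex[OF T holds_verum[OF T] par]) (use holds_verum in blast)
  let ?H = "is_inf \<langle>f\<rangle> unit_interval \<^bold>0 \<^bold>\<and> indicator \<langle>a\<rangle> ?Z ?E"
  have sw: "T \<tturnstile> switch \<langle>f\<rangle> \<langle>a\<rangle>"
  proof (rule switchI[OF T _ f ty a par])
    show "T \<tturnstile> ?H" using T inf ind by simp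
    fix T' assume T': "world T'" "T' \<tturnstile> ?H"
    show "T' \<tturnstile> indicator \<langle>a\<rangle> ?Z ?E" using T' by simp
    show "\<exists>u. is_real u \<and> (T' \<tturnstile> unit_interval \<langle>u\<rangle>) \<and> lt T' (rnat n * rv (App f u)) 1" if "is_nat n" for n
      by (rule zero_inf_scaled[OF T'(1) _ ty that]) (use T' in simp)
    show "\<exists>k. is_nat k \<and> (T' \<tturnstile> \<^bold>\<forall>\<^sub>N i. \<langle>k\<rangle> \<^bold>\<le>\<^sub>N i \<^bold>\<longrightarrow> \<^bold>\<not> (\<langle>a\<rangle> \<^bold>\<cdot> i \<^bold>= \<^bold>0\<^sub>N))" if "T' \<tturnstile> \<^bold>\<bottom>"
      using that T' by simp
  qed
  have "T \<tturnstile> \<^bold>\<not> dead \<langle>a\<rangle>"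
  proof (rule world_notI[OF T ind])
    fix T' assume T': "world T'" "T' \<tturnstile> indicator \<langle>a\<rangle> ?Z ?E" "T' \<tturnstile> dead \<langle>a\<rangle>"
    obtain n where "is_nat n" "T' \<tturnstile> \<^bold>\<bottom>" by (rule indicator_deadD[OF T'(1,2) a par T'(3)])
    then show False using T' by simp
  qed
  moreover obtain x where "is_real x" "T \<tturnstile> unit_interval \<langle>x\<rangle>" "T \<tturnstile> \<^bold>\<not> dead \<langle>a\<rangle> \<^bold>\<longrightarrow> concentrates \<langle>f\<rangle> \<langle>x\<rangle>"
    using switch_limit[OF T sw ty a] by blast
  ultimately show thesis using world_mp[OF T] that by blast
qed

text \<open>Points with values tending to 0 converge to \<open>x\<close> by concentration, while
  \<open>f x\<close> is positive. Keeping all their values below \<open>r\<close>, where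
  \<open>2 r < f x\<close>, gives a jump of more than \<open>r\<close> at every term.\<close>

lemma zero_inf_discontinuity:
  assumes T: "world T" and f: "T \<tturnstile> pos_qc \<langle>f\<rangle>" and inf: "T \<tturnstile> is_inf \<langle>f\<rangle> unit_interval \<^bold>0" and ty: "is_fun f"
  shows "T \<tturnstile> has_discontinuity \<langle>f\<rangle>"
proof -
  obtain x where x: "is_real x" "T \<tturnstile> unit_interval \<langle>x\<rangle>" and conc: "T \<tturnstile> concentrates \<langle>f\<rangle> \<langle>x\<rangle>"
    by (rule concentrates_ex[OF T f inf ty])
  have fx: "is_real (App f x)" using ty x by simp
  obtain r where r: "is_real r" "lt T 0 (rv r)" "lt T (rv r + rv r) (rv (App f x))"
    by (rule fraction_ex[OF T fx positive_valuedD[OF T f x(2) ty x(1)]])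
  let ?P = "\<lambda>n u. unit_interval u \<^bold>\<and> real_of n \<^bold>* (\<langle>f\<rangle> \<^bold>\<cdot> u) \<^bold>< \<^bold>1 \<^bold>\<and> \<langle>f\<rangle> \<^bold>\<cdot> u \<^bold>< \<langle>r\<rangle>"
  let ?H = "pos_qc \<langle>f\<rangle> \<^bold>\<and> is_inf \<langle>f\<rangle> unit_interval \<^bold>0 \<^bold>\<and> \<^bold>0 \<^bold>< \<langle>r\<rangle>"
  have H: "T \<tturnstile> ?H" using T f inf r by (simp add: ev)
  obtain s where s: "is_rseq s" and sP: "T \<tturnstile> \<^bold>\<forall>\<^sub>N n. ?P n (\<langle>s\<rangle> \<^bold>\<cdot> n)"
  proof (rule world_choice[OF T H, of ?P RealT])
    fix T' n assume T': "world T'" and H': "T' \<tturnstile> ?H" and n: "is_nat n"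
    have h: "T' \<tturnstile> pos_qc \<langle>f\<rangle>" "T' \<tturnstile> is_inf \<langle>f\<rangle> unit_interval \<^bold>0" "lt T' 0 (rv r)" using T' H' r by (simp_all add: ev)
    obtain k where k: "is_nat k" "lt T' 1 (rnat k * rv r)" by (rule archimedes_mul[OF T' r(1) h(3)])
    \<comment> \<open>A point for the index \<open>n + k\<close> meets both demands:
      \<open>n f u < 1\<close>, and \<open>k f u < 1 < k r\<close>, hence
      \<open>f u < r\<close>.\<close>
    have nk: "is_nat (tplus n k)" using n k by simp
    obtain u where u: "is_real u" "T' \<tturnstile> unit_interval \<langle>u\<rangle>" "lt T' (rnat (tplus n k) * rv (App f u)) 1"
      using zero_inf_scaled[OF T' h(2) ty nk] by blast
    have fu: "le T' 0 (rv (App f u))" by (rule lt_imp_le[OF T' positive_valuedD[OF T' h(1) u(2) ty u(1)]])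
    have "lt T' (rnat n * rv (App f u)) 1"
      by (rule mul_less_mono[OF T' u(3) fu rnat_mono[OF T' n nk nat_le_plus(1)[OF T' n k(1)]]])
    moreover have "lt T' (rnat k * rv (App f u)) 1"
      by (rule mul_less_mono[OF T' u(3) fu rnat_mono[OF T' k(1) nk nat_le_plus(2)[OF T' n k(1)]]])
    then have "lt T' (rv (App f u)) (rv r)" by (rule small_of_mul_less[OF T' k])
    ultimately have "T' \<tturnstile> ?P \<langle>n\<rangle> \<langle>u\<rangle>" using T' u ty n r by (simp add: ev)
    with u(1) show "\<exists>u. is_real u \<and> (T' \<tturnstile> ?P \<langle>n\<rangle> \<langle>u\<rangle>)" by blast
  qed (use ty r in simp_all)
  have point: "T' \<tturnstile> unit_interval \<langle>App s n\<rangle>" "lt T' (rnat n * rv (App f (App s n))) 1" "lt T' (rv (App f (App s n))) (rv r)"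
    if "world T'" "T' \<tturnstile> \<^bold>\<forall>\<^sub>N n. ?P n (\<langle>s\<rangle> \<^bold>\<cdot> n)" "is_nat n" for T' n
    using world_all[OF that(1,2) _ that(3)] that s ty r by (simp_all add: ev)
  have "T \<tturnstile> \<^bold>\<forall>\<^sub>N n. unit_interval (\<langle>s\<rangle> \<^bold>\<cdot> n)"
    by (rule world_allI[OF T sP]) (use point(1) s in simp_all)
  moreover have "T \<tturnstile> converges \<langle>s\<rangle> \<langle>x\<rangle>"
    unfolding converges_def
  proof (rule world_all_impI[OF T])
    let ?H1 = "pos_qc \<langle>f\<rangle> \<^bold>\<and> concentrates \<langle>f\<rangle> \<langle>x\<rangle> \<^bold>\<and> (\<^bold>\<forall>\<^sub>N n. ?P n (\<langle>s\<rangle> \<^bold>\<cdot> n))"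
    show "T \<tturnstile> ?H1" using T f conc sP by simp
    fix T' e assume T': "world T'" and H': "T' \<tturnstile> ?H1" and e: "is_real e" and "T' \<tturnstile> \<^bold>0 \<^bold>< \<langle>e\<rangle>"
    then have pos: "lt T' 0 (rv e)" by (simp add: ev)
    have c': "T' \<tturnstile> concentrates \<langle>f\<rangle> \<langle>x\<rangle>" using T' H' by simp
    obtain h where h: "is_real h" "lt T' 0 (rv h)" "T' \<tturnstile> \<^bold>\<forall>\<^sub>R u. low \<langle>f\<rangle> \<langle>h\<rangle> u \<^bold>\<longrightarrow> real_abs (u \<^bold>- \<langle>x\<rangle>) \<^bold>< \<langle>e\<rangle>"
      by (rule concentratesD[OF T' c' ty x(1) e pos])
    obtain k where k: "is_nat k" "lt T' 1 (rnat k * rv h)" by (rule archimedes_mul[OF T' h(1,2)])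
    let ?H2 = "pos_qc \<langle>f\<rangle> \<^bold>\<and> (\<^bold>\<forall>\<^sub>N n. ?P n (\<langle>s\<rangle> \<^bold>\<cdot> n)) \<^bold>\<and> (\<^bold>\<forall>\<^sub>R u. low \<langle>f\<rangle> \<langle>h\<rangle> u \<^bold>\<longrightarrow> real_abs (u \<^bold>- \<langle>x\<rangle>) \<^bold>< \<langle>e\<rangle>) \<^bold>\<and>
      \<^bold>1 \<^bold>< real_of \<langle>k\<rangle> \<^bold>* \<langle>h\<rangle>"
    have "T' \<tturnstile> \<^bold>\<forall>\<^sub>N n. \<langle>k\<rangle> \<^bold>\<le>\<^sub>N n \<^bold>\<longrightarrow> real_abs (\<langle>s\<rangle> \<^bold>\<cdot> n \<^bold>- \<langle>x\<rangle>) \<^bold>< \<langle>e\<rangle>"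
    proof (rule world_all_impI[OF T'])
      show "T' \<tturnstile> ?H2" using T' H' h k by (simp add: ev)
      fix T2 n assume T2: "world T2" "T2 \<tturnstile> ?H2" "is_nat n" "T2 \<tturnstile> \<langle>k\<rangle> \<^bold>\<le>\<^sub>N \<langle>n\<rangle>"
      have h2: "T2 \<tturnstile> pos_qc \<langle>f\<rangle>" "T2 \<tturnstile> \<^bold>\<forall>\<^sub>N n. ?P n (\<langle>s\<rangle> \<^bold>\<cdot> n)"
        "T2 \<tturnstile> \<^bold>\<forall>\<^sub>R u. low \<langle>f\<rangle> \<langle>h\<rangle> u \<^bold>\<longrightarrow> real_abs (u \<^bold>- \<langle>x\<rangle>) \<^bold>< \<langle>e\<rangle>" "lt T2 1 (rnat k * rv h)"
        using T2 h k by (simp_all add: ev)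
      have sn: "is_real (App s n)" using s T2 by simp
      have u: "T2 \<tturnstile> unit_interval \<langle>App s n\<rangle>" by (rule point(1)[OF T2(1) h2(2) T2(3)])
      have "lt T2 (rnat k * rv (App f (App s n))) 1"
        by (rule mul_less_mono[OF T2(1) point(2)[OF T2(1) h2(2) T2(3)]
              lt_imp_le[OF T2(1) positive_valuedD[OF T2(1) h2(1) u ty sn]] rnat_mono[OF T2(1) k(1) T2(3,4)]])
      then have "lt T2 (rv (App f (App s n))) (rv h)" by (rule small_of_mul_less[OF T2(1) k(1) h2(4)])
      from near_of_low[OF T2(1) h2(3) ty x(1) h(1) e sn u this]
      show "T2 \<tturnstile> real_abs (\<langle>s\<rangle> \<^bold>\<cdot> \<langle>n\<rangle> \<^bold>- \<langle>x\<rangle>) \<^bold>< \<langle>e\<rangle>" by simp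
    qed (use k s x e in simp_all)
    then show "T' \<tturnstile> \<^bold>\<exists>\<^sub>N k. \<^bold>\<forall>\<^sub>N n. k \<^bold>\<le>\<^sub>N n \<^bold>\<longrightarrow> real_abs (\<langle>s\<rangle> \<^bold>\<cdot> n \<^bold>- \<langle>x\<rangle>) \<^bold>< \<langle>e\<rangle>"
      by (rule world_exI[OF T' _ k(1)]) (use s x e in simp)
  qed (use s x in simp_all)
  moreover have "T \<tturnstile> \<^bold>\<exists>\<^sub>R \<epsilon>. \<^bold>0 \<^bold>< \<epsilon> \<^bold>\<and> (\<^bold>\<forall>\<^sub>N n. \<epsilon> \<^bold>< real_abs (\<langle>f\<rangle> \<^bold>\<cdot> (\<langle>s\<rangle> \<^bold>\<cdot> n) \<^bold>- \<langle>f\<rangle> \<^bold>\<cdot> \<langle>x\<rangle>))"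
  proof (rule world_exI[OF T _ r(1)])
    let ?H2 = "(\<^bold>\<forall>\<^sub>N n. ?P n (\<langle>s\<rangle> \<^bold>\<cdot> n)) \<^bold>\<and> \<langle>r\<rangle> \<^bold>+ \<langle>r\<rangle> \<^bold>< \<langle>App f x\<rangle>"
    have H2: "T \<tturnstile> ?H2" using T sP r fx by (simp add: ev)
    have "T \<tturnstile> \<^bold>\<forall>\<^sub>N n. \<langle>r\<rangle> \<^bold>< real_abs (\<langle>f\<rangle> \<^bold>\<cdot> (\<langle>s\<rangle> \<^bold>\<cdot> n) \<^bold>- \<langle>f\<rangle> \<^bold>\<cdot> \<langle>x\<rangle>)"
    proof (rule world_allI[OF T H2])
      fix T' n assume T': "world T'" and H': "T' \<tturnstile> ?H2" and n: "is_nat n"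
      have h: "T' \<tturnstile> \<^bold>\<forall>\<^sub>N n. ?P n (\<langle>s\<rangle> \<^bold>\<cdot> n)" "lt T' (rv r + rv r) (rv (App f x))" using T' H' r fx by (simp_all add: ev)
      let ?d = "tsub (App f (App s n)) (App f x)"
      have d: "is_real ?d" "rv ?d = rv (App f (App s n)) - rv (App f x)" using ty s n fx by simp_all
      have "lt T' (rv r) (- rv ?d)" unfolding d
        \<comment> \<open>The difference is \<open>(f x - 2 r) + (r - f (s n))\<close>.\<close>
        by (rule ltI[OF T' pos_add[OF T' ltD[OF T' h(2)] ltD[OF T' point(3)[OF T' h(1) n]]]]) (simp add: algebra_simps)
      then have "lt T' (rv r) (rv (tmax ?d (tneg ?d)))"
        using less_max_iff[OF T', of ?d "tneg ?d"] d(1) by (simp add: rv_ops(5)[OF d(1)])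
      then have "T' \<tturnstile> \<langle>r\<rangle> \<^bold>< \<langle>tmax ?d (tneg ?d)\<rangle>" using T' r d by (simp add: lt_rv)
      then show "T' \<tturnstile> \<langle>r\<rangle> \<^bold>< real_abs (\<langle>f\<rangle> \<^bold>\<cdot> (\<langle>s\<rangle> \<^bold>\<cdot> \<langle>n\<rangle>) \<^bold>- \<langle>f\<rangle> \<^bold>\<cdot> \<langle>x\<rangle>)" by simp
    qed (use ty s x r in simp)
    then show "T \<tturnstile> \<^bold>0 \<^bold>< \<langle>r\<rangle> \<^bold>\<and> (\<^bold>\<forall>\<^sub>N n. \<langle>r\<rangle> \<^bold>< real_abs (\<langle>f\<rangle> \<^bold>\<cdot> (\<langle>s\<rangle> \<^bold>\<cdot> n) \<^bold>- \<langle>f\<rangle> \<^bold>\<cdot> \<langle>x\<rangle>))"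
      using T r by (simp add: ev)
  qed (use ty s x in simp)
  ultimately have "T \<tturnstile> (\<^bold>\<forall>\<^sub>N n. unit_interval (\<langle>s\<rangle> \<^bold>\<cdot> n)) \<^bold>\<and> converges \<langle>s\<rangle> \<langle>x\<rangle> \<^bold>\<and>
      (\<^bold>\<exists>\<^sub>R \<epsilon>. \<^bold>0 \<^bold>< \<epsilon> \<^bold>\<and> (\<^bold>\<forall>\<^sub>N n. \<epsilon> \<^bold>< real_abs (\<langle>f\<rangle> \<^bold>\<cdot> (\<langle>s\<rangle> \<^bold>\<cdot> n) \<^bold>- \<langle>f\<rangle> \<^bold>\<cdot> \<langle>x\<rangle>)))" using T by simp
  then have "T \<tturnstile> ex_of (NatT \<rightarrow> RealT) (\<lambda>s. (\<^bold>\<forall>\<^sub>N n. unit_interval (s \<^bold>\<cdot> n)) \<^bold>\<and> converges s \<langle>x\<rangle> \<^bold>\<and>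
      (\<^bold>\<exists>\<^sub>R \<epsilon>. \<^bold>0 \<^bold>< \<epsilon> \<^bold>\<and> (\<^bold>\<forall>\<^sub>N n. \<epsilon> \<^bold>< real_abs (\<langle>f\<rangle> \<^bold>\<cdot> (s \<^bold>\<cdot> n) \<^bold>- \<langle>f\<rangle> \<^bold>\<cdot> \<langle>x\<rangle>))))"
    by (rule world_exI[OF T _ s]) (use ty x in simp)
  with x(2) show ?thesis
    unfolding has_discontinuity_def by (intro world_exI[OF T _ x(1)]) (use T ty in simp_all)
qed

section \<open>From a vanishing infimum to WLPO\<close>

text \<open>Bounded search, by induction on \<open>n\<close>. The condition
  \<open>Suc i <= n\<close> expresses \<open>i < n\<close>, so the case \<open>n = 0\<close> is
  vacuous.\<close>

lemma zero_or_one_below: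
  assumes T: "world T" and a: "is_nseq a"
    and bin: "T \<tturnstile> \<^bold>\<forall>\<^sub>N n. \<langle>a\<rangle> \<^bold>\<cdot> n \<^bold>= \<^bold>0\<^sub>N \<^bold>\<or> \<langle>a\<rangle> \<^bold>\<cdot> n \<^bold>= nat_suc \<^bold>0\<^sub>N" and n: "is_nat n"
  shows "(T \<tturnstile> \<^bold>\<forall>\<^sub>N i. nat_suc i \<^bold>\<le>\<^sub>N \<langle>n\<rangle> \<^bold>\<longrightarrow> \<langle>a\<rangle> \<^bold>\<cdot> i \<^bold>= \<^bold>0\<^sub>N) \<or>
    (T \<tturnstile> \<^bold>\<exists>\<^sub>N i. nat_suc i \<^bold>\<le>\<^sub>N \<langle>n\<rangle> \<^bold>\<and> \<langle>a\<rangle> \<^bold>\<cdot> i \<^bold>= nat_suc \<^bold>0\<^sub>N)"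
proof -
  let ?Z = "\<lambda>n. \<^bold>\<forall>\<^sub>N i. nat_suc i \<^bold>\<le>\<^sub>N n \<^bold>\<longrightarrow> \<langle>a\<rangle> \<^bold>\<cdot> i \<^bold>= \<^bold>0\<^sub>N"
  let ?E = "\<lambda>n. \<^bold>\<exists>\<^sub>N i. nat_suc i \<^bold>\<le>\<^sub>N n \<^bold>\<and> \<langle>a\<rangle> \<^bold>\<cdot> i \<^bold>= nat_suc \<^bold>0\<^sub>N"
  have "T \<tturnstile> ?Z \<langle>n\<rangle> \<^bold>\<or> ?E \<langle>n\<rangle>"
  proof (rule world_induct[OF T bin _ _ _ n, of "\<lambda>n. ?Z n \<^bold>\<or> ?E n"])
    show "par (\<lambda>n. ?Z n \<^bold>\<or> ?E n)" using a by simp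
    have "T \<tturnstile> ?Z \<langle>Con CNZero\<rangle>"
    proof (rule world_all_impI[OF T holds_verum[OF T]])
      fix T' i assume T': "world T'" and i: "is_nat i" and "T' \<tturnstile> nat_suc \<langle>i\<rangle> \<^bold>\<le>\<^sub>N \<langle>Con CNZero\<rangle>"
      then obtain k where k: "is_nat k" "T' \<tturnstile> \<langle>Con CNZero\<rangle> \<^bold>= \<langle>tplus (tsuc i) k\<rangle>"
        using nat_le_iff[OF T', of "tsuc i" "Con CNZero"] by auto
      have "T' \<tturnstile> \<langle>Con CNZero\<rangle> \<^bold>= \<langle>tsuc (tplus i k)\<rangle>"
        by (rule world_trans[OF T' k(2) suc_plus[OF T' i k(1)]]) (use i k in simp_all)
      then have "T' \<tturnstile> \<langle>tsuc (tplus i k)\<rangle> \<^bold>= \<langle>Con CNZero\<rangle>"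
        by (rule world_sym[OF T']) (use i k in simp_all)
      then show "T' \<tturnstile> \<langle>a\<rangle> \<^bold>\<cdot> \<langle>i\<rangle> \<^bold>= \<^bold>0\<^sub>N" using nat_suc_neq_zero[OF T', of "tplus i k"] i k by simp
    qed (use a in simp_all)
    then show "T \<tturnstile> ?Z \<langle>Con CNZero\<rangle> \<^bold>\<or> ?E \<langle>Con CNZero\<rangle>" using T by simp
    fix T' n
    assume T': "world T'" and bin': "T' \<tturnstile> \<^bold>\<forall>\<^sub>N n. \<langle>a\<rangle> \<^bold>\<cdot> n \<^bold>= \<^bold>0\<^sub>N \<^bold>\<or> \<langle>a\<rangle> \<^bold>\<cdot> n \<^bold>= nat_suc \<^bold>0\<^sub>N"
      and n: "is_nat n" and "T' \<tturnstile> ?Z \<langle>n\<rangle> \<^bold>\<or> ?E \<langle>n\<rangle>"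
    moreover have "T' \<tturnstile> \<langle>a\<rangle> \<^bold>\<cdot> \<langle>n\<rangle> \<^bold>= \<^bold>0\<^sub>N \<^bold>\<or> \<langle>a\<rangle> \<^bold>\<cdot> \<langle>n\<rangle> \<^bold>= nat_suc \<^bold>0\<^sub>N"
      by (rule world_all[OF T' bin' _ n]) (use a in simp)
    ultimately consider "T' \<tturnstile> ?Z \<langle>n\<rangle>" "T' \<tturnstile> \<langle>a\<rangle> \<^bold>\<cdot> \<langle>n\<rangle> \<^bold>= \<^bold>0\<^sub>N" | "T' \<tturnstile> ?E \<langle>n\<rangle>" | "T' \<tturnstile> \<langle>a\<rangle> \<^bold>\<cdot> \<langle>n\<rangle> \<^bold>= nat_suc \<^bold>0\<^sub>N"
      unfolding world_disj[OF T'] by blast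
    then have "(T' \<tturnstile> ?Z \<langle>tsuc n\<rangle>) \<or> (T' \<tturnstile> ?E \<langle>tsuc n\<rangle>)"
    proof cases
      case 1
      let ?H = "?Z \<langle>n\<rangle> \<^bold>\<and> \<langle>a\<rangle> \<^bold>\<cdot> \<langle>n\<rangle> \<^bold>= \<^bold>0\<^sub>N"
      have "T' \<tturnstile> ?Z \<langle>tsuc n\<rangle>"
      proof (rule world_all_impI[OF T'])
        show "T' \<tturnstile> ?H" using T' 1 by simp
        fix T2 i assume T2: "world T2" and H: "T2 \<tturnstile> ?H" and i: "is_nat i" and "T2 \<tturnstile> nat_suc \<langle>i\<rangle> \<^bold>\<le>\<^sub>N \<langle>tsuc n\<rangle>"
        then obtain k where k: "is_nat k" "T2 \<tturnstile> \<langle>tsuc n\<rangle> \<^bold>= \<langle>tplus (tsuc i) k\<rangle>"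
          using nat_le_iff[OF T2, of "tsuc i" "tsuc n"] n by auto
        have h: "T2 \<tturnstile> ?Z \<langle>n\<rangle>" "T2 \<tturnstile> \<langle>App a n\<rangle> \<^bold>= \<^bold>0\<^sub>N" using T2 H by simp_all
        have "T2 \<tturnstile> \<langle>tsuc n\<rangle> \<^bold>= \<langle>tsuc (tplus i k)\<rangle>"
          by (rule world_trans[OF T2 k(2) suc_plus[OF T2 i k(1)]]) (use i n k in simp_all)
        then have nik: "T2 \<tturnstile> \<langle>n\<rangle> \<^bold>= \<langle>tplus i k\<rangle>" by (intro nat_suc_eqD[OF T2 n]) (use i k in simp_all)
        \<comment> \<open>From \<open>n = i + k\<close>: if \<open>k\<close> is 0, then
          \<open>i\<close> is the new index \<open>n\<close>; otherwise \<open>i\<close> is below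
          \<open>n\<close> and the hypothesis on smaller indices applies.\<close>
        from nat_cases[OF T2 k(1)] show "T2 \<tturnstile> \<langle>a\<rangle> \<^bold>\<cdot> \<langle>i\<rangle> \<^bold>= \<^bold>0\<^sub>N"
        proof
          assume k0: "T2 \<tturnstile> \<langle>k\<rangle> \<^bold>= \<langle>Con CNZero\<rangle>"
          have "T2 \<tturnstile> \<langle>tplus i k\<rangle> \<^bold>= \<langle>tplus i (Con CNZero)\<rangle>"
            by (rule world_cong[OF T2 k0]) (use i k in simp_all)
          from world_trans[OF T2 this plus_zero[OF T2 i]] i k have "T2 \<tturnstile> \<langle>tplus i k\<rangle> \<^bold>= \<langle>i\<rangle>" by simp
          from world_trans[OF T2 nik this] i n k have "T2 \<tturnstile> \<langle>n\<rangle> \<^bold>= \<langle>i\<rangle>" by simp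
          from world_subst[where F = "\<lambda>i. \<langle>a\<rangle> \<^bold>\<cdot> i \<^bold>= \<^bold>0\<^sub>N", OF T2 this] h(2) show ?thesis using a n i by simp
        next
          assume "\<exists>m. is_nat m \<and> (T2 \<tturnstile> \<langle>k\<rangle> \<^bold>= \<langle>tsuc m\<rangle>)"
          then obtain m where m: "is_nat m" "T2 \<tturnstile> \<langle>k\<rangle> \<^bold>= \<langle>tsuc m\<rangle>" by blast
          have "T2 \<tturnstile> \<langle>tplus i k\<rangle> \<^bold>= \<langle>tplus i (tsuc m)\<rangle>"
            by (rule world_cong[OF T2 m(2)]) (use i k m in simp_all)
          moreover have "T2 \<tturnstile> \<langle>tplus i (tsuc m)\<rangle> \<^bold>= \<langle>tplus (tsuc i) m\<rangle>"
            by (rule world_trans[OF T2 plus_suc[OF T2 i m(1)] world_sym[OF T2 suc_plus[OF T2 i m(1)]]]) (use i m in simp_all)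
          ultimately have "T2 \<tturnstile> \<langle>tplus i k\<rangle> \<^bold>= \<langle>tplus (tsuc i) m\<rangle>"
            by (rule world_trans[OF T2]) (use i k m in simp_all)
          from world_trans[OF T2 nik this] i n k m have "T2 \<tturnstile> \<langle>n\<rangle> \<^bold>= \<langle>tplus (tsuc i) m\<rangle>" by simp
          then have le: "T2 \<tturnstile> nat_suc \<langle>i\<rangle> \<^bold>\<le>\<^sub>N \<langle>n\<rangle>" using nat_le_iff[OF T2, of "tsuc i" n] i n m by auto
          show ?thesis
            by (rule world_all_impD[OF T2 h(1) le i]) (use a n in simp)
        qed
      qed (use a n in simp_all)
      then show ?thesis ..
    next
      case 2
      then obtain i where i: "is_nat i" "T' \<tturnstile> nat_suc \<langle>i\<rangle> \<^bold>\<le>\<^sub>N \<langle>n\<rangle> \<^bold>\<and> \<langle>a\<rangle> \<^bold>\<cdot> \<langle>i\<rangle> \<^bold>= nat_suc \<^bold>0\<^sub>N"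
        by (rule world_exE[OF T']) (use a n in simp_all)
      then have "T' \<tturnstile> nat_suc \<langle>i\<rangle> \<^bold>\<le>\<^sub>N \<langle>tsuc n\<rangle> \<^bold>\<and> \<langle>a\<rangle> \<^bold>\<cdot> \<langle>i\<rangle> \<^bold>= nat_suc \<^bold>0\<^sub>N"
        using nat_le_suc[OF T', of "tsuc i" n] T' n by simp
      then have "T' \<tturnstile> ?E \<langle>tsuc n\<rangle>" by (rule world_exI[OF T' _ i(1)]) (use a n in simp)
      then show ?thesis ..
    next
      case 3
      then have "T' \<tturnstile> nat_suc \<langle>n\<rangle> \<^bold>\<le>\<^sub>N \<langle>tsuc n\<rangle> \<^bold>\<and> \<langle>a\<rangle> \<^bold>\<cdot> \<langle>n\<rangle> \<^bold>= nat_suc \<^bold>0\<^sub>N"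
        using nat_le_refl[OF T', of "tsuc n"] T' n by simp
      then have "T' \<tturnstile> ?E \<langle>tsuc n\<rangle>" by (rule world_exI[OF T' _ n]) (use a n in simp)
      then show ?thesis ..
    qed
    then show "T' \<tturnstile> ?Z \<langle>tsuc n\<rangle> \<^bold>\<or> ?E \<langle>tsuc n\<rangle>" using T' by simp
  qed
  then show ?thesis using T by simp
qed

lemma zero_neq_one:
  assumes T: "world T" and ty: "is_nat s" and eq: "T \<tturnstile> \<langle>s\<rangle> \<^bold>= \<^bold>0\<^sub>N" "T \<tturnstile> \<langle>s\<rangle> \<^bold>= nat_suc \<^bold>0\<^sub>N"
  shows False
proof -
  have "T \<tturnstile> \<langle>tsuc (Con CNZero)\<rangle> \<^bold>= \<langle>s\<rangle>" by (rule world_sym[OF T]) (use eq ty in \<open>simp_all\<close>)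
  from world_trans[OF T this, of "Con CNZero" NatT] eq(1) ty
  have "T \<tturnstile> \<langle>tsuc (Con CNZero)\<rangle> \<^bold>= \<langle>Con CNZero\<rangle>" by (simp add: cst_con)
  then show False using nat_suc_neq_zero[OF T] by simp
qed

lemma zero_inf_WLPO:
  assumes T: "world T" and f: "T \<tturnstile> pos_qc \<langle>f\<rangle>" and inf: "T \<tturnstile> is_inf \<langle>f\<rangle> unit_interval \<^bold>0" and ty: "is_fun f"
  shows "T \<tturnstile> WLPO"
proof -
  obtain x where x: "is_real x" "T \<tturnstile> unit_interval \<langle>x\<rangle>" and conc: "T \<tturnstile> concentrates \<langle>f\<rangle> \<langle>x\<rangle>"
    by (rule concentrates_ex[OF T f inf ty])
  have fx: "is_real (App f x)" using ty x by simp
  let ?B = "\<lambda>a. \<^bold>\<forall>\<^sub>N n. a \<^bold>\<cdot> n \<^bold>= \<^bold>0\<^sub>N \<^bold>\<or> a \<^bold>\<cdot> n \<^bold>= nat_suc \<^bold>0\<^sub>N"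
  let ?A = "\<lambda>a. \<^bold>\<forall>\<^sub>N n. a \<^bold>\<cdot> n \<^bold>= \<^bold>0\<^sub>N"
  show ?thesis
    unfolding WLPO_def
  proof (rule world_all_impI[OF T])
    let ?H = "pos_qc \<langle>f\<rangle> \<^bold>\<and> is_inf \<langle>f\<rangle> unit_interval \<^bold>0 \<^bold>\<and> unit_interval \<langle>x\<rangle> \<^bold>\<and> concentrates \<langle>f\<rangle> \<langle>x\<rangle>"
    show "T \<tturnstile> ?H" using T f inf x conc by simp
    show "par ?B" "par (\<lambda>a. ?A a \<^bold>\<or> \<^bold>\<not> ?A a)" by simp_all
    fix T' a assume T': "world T'" and "T' \<tturnstile> ?H" and a: "is_nseq a" and bin: "T' \<tturnstile> ?B \<langle>a\<rangle>"
    then have h: "T' \<tturnstile> pos_qc \<langle>f\<rangle>" "T' \<tturnstile> is_inf \<langle>f\<rangle> unit_interval \<^bold>0" "T' \<tturnstile> unit_interval \<langle>x\<rangle>" "T' \<tturnstile> concentrates \<langle>f\<rangle> \<langle>x\<rangle>"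
      by simp_all
    let ?Z = "\<lambda>n. \<^bold>\<forall>\<^sub>N i. nat_suc i \<^bold>\<le>\<^sub>N n \<^bold>\<longrightarrow> \<langle>a\<rangle> \<^bold>\<cdot> i \<^bold>= \<^bold>0\<^sub>N"
    let ?E = "\<lambda>n. \<^bold>\<exists>\<^sub>N i. nat_suc i \<^bold>\<le>\<^sub>N n \<^bold>\<and> \<langle>a\<rangle> \<^bold>\<cdot> i \<^bold>= nat_suc \<^bold>0\<^sub>N"
    have par: "par ?Z" "par ?E" using a by simp_all
    have E: "\<exists>i. is_nat i \<and> (T2 \<tturnstile> \<langle>App a i\<rangle> \<^bold>= nat_suc \<^bold>0\<^sub>N)" if "world T2" "T2 \<tturnstile> ?E \<langle>n\<rangle>" "is_nat n" for T2 n
      using world_exE[OF that(1,2)] a that(1,3) by auto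
    \<comment> \<open>\<open>c n\<close> is 0 only if all entries of \<open>a\<close> before
      \<open>n\<close> vanish, and nonzero only if a 1 occurs among them.\<close>
    obtain c where c: "is_nseq c" and ind: "T' \<tturnstile> indicator \<langle>c\<rangle> ?Z ?E"
      by (rule indicator_ex[OF T' bin par]) (use zero_or_one_below[OF _ a] in blast)
    let ?I = "indicator \<langle>c\<rangle> ?Z ?E"
    have stop: "T2 \<tturnstile> \<^bold>\<not> (\<langle>c\<rangle> \<^bold>\<cdot> \<langle>j\<rangle> \<^bold>= \<^bold>0\<^sub>N)"
      if T2: "world T2" "T2 \<tturnstile> ?I" and i: "is_nat i" "T2 \<tturnstile> \<langle>App a i\<rangle> \<^bold>= nat_suc \<^bold>0\<^sub>N"
        and j: "is_nat j" "T2 \<tturnstile> \<langle>tsuc i\<rangle> \<^bold>\<le>\<^sub>N \<langle>j\<rangle>" for T2 i j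
    proof (rule world_notI[OF T2(1)])
      let ?H3 = "?I \<^bold>\<and> \<langle>App a i\<rangle> \<^bold>= nat_suc \<^bold>0\<^sub>N \<^bold>\<and> \<langle>tsuc i\<rangle> \<^bold>\<le>\<^sub>N \<langle>j\<rangle>"
      show "T2 \<tturnstile> ?H3" using T2 i j by simp
      fix T3 assume T3: "world T3" and "T3 \<tturnstile> ?H3" and zero: "T3 \<tturnstile> \<langle>c\<rangle> \<^bold>\<cdot> \<langle>j\<rangle> \<^bold>= \<^bold>0\<^sub>N"
      then have h3: "T3 \<tturnstile> ?I" "T3 \<tturnstile> \<langle>App a i\<rangle> \<^bold>= nat_suc \<^bold>0\<^sub>N" "T3 \<tturnstile> nat_suc \<langle>i\<rangle> \<^bold>\<le>\<^sub>N \<langle>j\<rangle>" by simp_all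
      have "T3 \<tturnstile> ?Z \<langle>j\<rangle>"
        using indicatorD[OF T3 h3(1) c j(1) par] zero world_not[OF T3] by auto
      from world_all_impD[OF T3 this h3(3) i(1)] a j have "T3 \<tturnstile> \<langle>App a i\<rangle> \<^bold>= \<^bold>0\<^sub>N" by simp
      then show False using zero_neq_one[OF T3 _ _ h3(2)] a i by simp
    qed
    have sw: "T' \<tturnstile> switch \<langle>f\<rangle> \<langle>c\<rangle>"
    proof (rule switchI[OF T' _ h(1) ty c par])
      let ?H1 = "is_inf \<langle>f\<rangle> unit_interval \<^bold>0 \<^bold>\<and> ?I"
      show "T' \<tturnstile> ?H1" using T' h ind by simp
      fix T2 assume T2: "world T2" "T2 \<tturnstile> ?H1"
      then have h2: "T2 \<tturnstile> is_inf \<langle>f\<rangle> unit_interval \<^bold>0" "T2 \<tturnstile> ?I" by simp_all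
      show "T2 \<tturnstile> ?I" by (rule h2(2))
      fix n assume n: "is_nat n"
      show "\<exists>u. is_real u \<and> (T2 \<tturnstile> unit_interval \<langle>u\<rangle>) \<and> lt T2 (rnat n * rv (App f u)) 1"
        by (rule zero_inf_scaled[OF T2(1) h2(1) ty n])
      assume "T2 \<tturnstile> ?E \<langle>n\<rangle>"
      then obtain i where i: "is_nat i" "T2 \<tturnstile> \<langle>App a i\<rangle> \<^bold>= nat_suc \<^bold>0\<^sub>N" using E[OF T2(1) _ n] by blast
      have "T2 \<tturnstile> \<^bold>\<forall>\<^sub>N j. \<langle>tsuc i\<rangle> \<^bold>\<le>\<^sub>N j \<^bold>\<longrightarrow> \<^bold>\<not> (\<langle>c\<rangle> \<^bold>\<cdot> j \<^bold>= \<^bold>0\<^sub>N)"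
      proof (rule world_all_impI[OF T2(1)])
        let ?H3 = "?I \<^bold>\<and> \<langle>App a i\<rangle> \<^bold>= nat_suc \<^bold>0\<^sub>N"
        show "T2 \<tturnstile> ?H3" using T2 h2 i by simp
        fix T3 j assume "world T3" "T3 \<tturnstile> ?H3" "is_nat j" "T3 \<tturnstile> \<langle>tsuc i\<rangle> \<^bold>\<le>\<^sub>N \<langle>j\<rangle>"
        then show "T3 \<tturnstile> \<^bold>\<not> (\<langle>c\<rangle> \<^bold>\<cdot> \<langle>j\<rangle> \<^bold>= \<^bold>0\<^sub>N)" using stop[of T3 i j] i(1) by simp
      qed (use i c in simp_all)
      with i(1) show "\<exists>k. is_nat k \<and> (T2 \<tturnstile> \<^bold>\<forall>\<^sub>N j. \<langle>k\<rangle> \<^bold>\<le>\<^sub>N j \<^bold>\<longrightarrow> \<^bold>\<not> (\<langle>c\<rangle> \<^bold>\<cdot> j \<^bold>= \<^bold>0\<^sub>N))"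
        by (intro exI[of _ "tsuc i"]) simp
    qed
    have dead_one: "\<not> (T2 \<tturnstile> ?A \<langle>a\<rangle>)" if T2: "world T2" "T2 \<tturnstile> ?I" "T2 \<tturnstile> dead \<langle>c\<rangle>" for T2
    proof
      assume all: "T2 \<tturnstile> ?A \<langle>a\<rangle>"
      obtain n where n: "is_nat n" "T2 \<tturnstile> ?E \<langle>n\<rangle>" by (rule indicator_deadD[OF T2(1,2) c par T2(3)])
      then obtain i where i: "is_nat i" "T2 \<tturnstile> \<langle>App a i\<rangle> \<^bold>= nat_suc \<^bold>0\<^sub>N" using E[OF T2(1)] by blast
      have "T2 \<tturnstile> \<langle>App a i\<rangle> \<^bold>= \<^bold>0\<^sub>N" using world_all[OF T2(1) all _ i(1)] a by simp
      then show False using zero_neq_one[OF T2(1) _ _ i(2)] a i by simp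
    qed
    obtain z where z: "is_real z" "T' \<tturnstile> unit_interval \<langle>z\<rangle>"
      "\<forall>k. is_nat k \<longrightarrow> (T' \<tturnstile> dead \<langle>c\<rangle>) \<or> (T' \<tturnstile> dead \<langle>c\<rangle> \<^bold>\<longrightarrow> real_of \<langle>k\<rangle> \<^bold>* \<langle>App f z\<rangle> \<^bold>< \<^bold>1)"
      "T' \<tturnstile> \<^bold>\<not> dead \<langle>c\<rangle> \<^bold>\<longrightarrow> concentrates \<langle>f\<rangle> \<langle>z\<rangle>"
      using switch_limit[OF T' sw ty c] by blast
    have fz: "is_real (App f z)" using ty z by simp
    \<comment> \<open>A positive \<open>r < f x\<close> is what the comparison with
      \<open>f z\<close> needs: cotransitivity then yields \<open>r < f z\<close> or
      \<open>f z < f x\<close>.\<close>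
    obtain r where r: "is_real r" "lt T' 0 (rv r)" "lt T' (rv r + rv r) (rv (App f x))"
      by (rule fraction_ex[OF T' fx positive_valuedD[OF T' h(1,3) ty x(1)]])
    have "lt T' (rv r) (rv r + rv r)" by (rule ltI[OF T' r(2)]) simp
    then have "lt T' (rv r) (rv (App f x))" using lt_trans[OF T' _ r(3)] by blast
    then consider "lt T' (rv r) (rv (App f z))" | "lt T' (rv (App f z)) (rv (App f x))"
      using lt_cotrans[OF T'] by blast
    then have "(T' \<tturnstile> ?A \<langle>a\<rangle>) \<or> (T' \<tturnstile> \<^bold>\<not> ?A \<langle>a\<rangle>)"
    proof cases
      case 1
      \<comment> \<open>Then \<open>k f z > 1\<close>, and stage \<open>k\<close> tells whether a
        stop is recorded, which means a 1 in \<open>a\<close>, or whether a stop is refuted.\<close>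
      obtain k where k: "is_nat k" "lt T' 1 (rnat k * rv r)" by (rule archimedes_mul[OF T' r(1,2)])
      have "le T' 0 (rnat k * (rv (App f z) - rv r))"
        by (rule nonneg_mul[OF T' rnat_nonneg[OF T' k(1)] lt_imp_le[OF T' ltD[OF T' 1]]])
      then have "le T' (rnat k * rv r) (rnat k * rv (App f z))"
        by (rule leI[OF T']) (simp add: algebra_simps)
      then have kz: "lt T' 1 (rnat k * rv (App f z))" by (rule lt_le_trans[OF T' k(2)])
      consider "T' \<tturnstile> dead \<langle>c\<rangle>" | "T' \<tturnstile> dead \<langle>c\<rangle> \<^bold>\<longrightarrow> real_of \<langle>k\<rangle> \<^bold>* \<langle>App f z\<rangle> \<^bold>< \<^bold>1" using z(3) k(1) by blast
      then show ?thesis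
      proof cases
        case 1
        have "T' \<tturnstile> \<^bold>\<not> ?A \<langle>a\<rangle>"
          by (rule world_notI[OF T', of "?I \<^bold>\<and> dead \<langle>c\<rangle>"]) (use T' 1 ind dead_one in \<open>simp_all only: world_conj\<close>)
        then show ?thesis ..
      next
        case 2
        let ?H2 = "(dead \<langle>c\<rangle> \<^bold>\<longrightarrow> real_of \<langle>k\<rangle> \<^bold>* \<langle>App f z\<rangle> \<^bold>< \<^bold>1) \<^bold>\<and> \<^bold>1 \<^bold>< real_of \<langle>k\<rangle> \<^bold>* \<langle>App f z\<rangle> \<^bold>\<and> ?B \<langle>a\<rangle> \<^bold>\<and> ?I"
        have H2: "T' \<tturnstile> ?H2" using T' 2 kz bin ind k fz by (simp add: ev)
        have "T' \<tturnstile> ?A \<langle>a\<rangle>"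
        proof (rule world_allI[OF T' H2])
          fix T2 n assume T2: "world T2" and "T2 \<tturnstile> ?H2" and n: "is_nat n"
          then have h2: "T2 \<tturnstile> dead \<langle>c\<rangle> \<^bold>\<longrightarrow> real_of \<langle>k\<rangle> \<^bold>* \<langle>App f z\<rangle> \<^bold>< \<^bold>1" "lt T2 1 (rnat k * rv (App f z))"
            "T2 \<tturnstile> ?B \<langle>a\<rangle>" "T2 \<tturnstile> ?I"
            using k fz by (simp_all add: ev)
          have no: "\<not> (T2 \<tturnstile> dead \<langle>c\<rangle>)"
            using world_mp[OF T2 h2(1)] lt_asym[OF T2 h2(2)] T2 k fz by (auto simp: ev le_def)
          \<comment> \<open>An entry 1 at \<open>n\<close> would be noticed at stage
            \<open>n + 1\<close>, the first stage that looks at index \<open>n\<close>.\<close>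
          have "\<not> (T2 \<tturnstile> \<langle>App a n\<rangle> \<^bold>= nat_suc \<^bold>0\<^sub>N)"
          proof
            assume one: "T2 \<tturnstile> \<langle>App a n\<rangle> \<^bold>= nat_suc \<^bold>0\<^sub>N"
            have sn: "is_nat (tsuc n)" using n by simp
            have "T2 \<tturnstile> dead \<langle>c\<rangle>"
              unfolding dead_def
              by (rule world_exI[OF T2 _ sn])
                (use stop[OF T2 h2(4) n one sn nat_le_refl[OF T2 sn]] c in simp_all)
            then show False using no by blast
          qed
          then show "T2 \<tturnstile> \<langle>a\<rangle> \<^bold>\<cdot> \<langle>n\<rangle> \<^bold>= \<^bold>0\<^sub>N"
            using world_all[OF T2 h2(3) _ n] a T2 by simp
        qed (use a in simp)
        then show ?thesis ..
      qed
    next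
      case 2
      let ?H2 = "is_inf \<langle>f\<rangle> unit_interval \<^bold>0 \<^bold>\<and> concentrates \<langle>f\<rangle> \<langle>x\<rangle> \<^bold>\<and> ?I \<^bold>\<and> (\<^bold>\<not> dead \<langle>c\<rangle> \<^bold>\<longrightarrow> concentrates \<langle>f\<rangle> \<langle>z\<rangle>) \<^bold>\<and>
        \<langle>App f z\<rangle> \<^bold>< \<langle>App f x\<rangle>"
      have "T' \<tturnstile> \<^bold>\<not> ?A \<langle>a\<rangle>"
      proof (rule world_notI[OF T'])
        show "T' \<tturnstile> ?H2" using T' h ind z 2 fx fz by (simp add: ev)
        fix T2 assume T2: "world T2" and "T2 \<tturnstile> ?H2" and all: "T2 \<tturnstile> ?A \<langle>a\<rangle>"
        then have h2: "T2 \<tturnstile> is_inf \<langle>f\<rangle> unit_interval \<^bold>0" "T2 \<tturnstile> concentrates \<langle>f\<rangle> \<langle>x\<rangle>" "T2 \<tturnstile> ?I"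
          "T2 \<tturnstile> \<^bold>\<not> dead \<langle>c\<rangle> \<^bold>\<longrightarrow> concentrates \<langle>f\<rangle> \<langle>z\<rangle>" "lt T2 (rv (App f z)) (rv (App f x))"
          using fx fz by (simp_all add: ev)
        \<comment> \<open>If \<open>a\<close> vanishes, the sequence never stops, so its limit
          \<open>z\<close> is a point of concentration and therefore equal to \<open>x\<close>; then
          \<open>f z = f x\<close>, against \<open>f z < f x\<close>.\<close>
        have "T2 \<tturnstile> \<^bold>\<not> dead \<langle>c\<rangle>"
        proof (rule world_notI[OF T2])
          show "T2 \<tturnstile> ?I \<^bold>\<and> ?A \<langle>a\<rangle>" using T2 h2 all by simp
          fix T3 assume "world T3" "T3 \<tturnstile> ?I \<^bold>\<and> ?A \<langle>a\<rangle>" "T3 \<tturnstile> dead \<langle>c\<rangle>"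
          then show False using dead_one[of T3] world_conj by blast
        qed
        then have "T2 \<tturnstile> concentrates \<langle>f\<rangle> \<langle>z\<rangle>" by (rule world_mp[OF T2 h2(4)])
        from concentrates_unique[OF T2 h2(1,2) this ty x(1) z(1)]
        have "eqr T2 (rv x) (rv z)" using T2 x z by (simp add: eqr_rv)
        from eqr_le[OF T2 fun_cong_rv[OF T2 ty x(1) z(1) this]] h2(5) show False by (simp add: le_def)
      qed
      then show ?thesis ..
    qed
    then show "T' \<tturnstile> ?A \<langle>a\<rangle> \<^bold>\<or> \<^bold>\<not> ?A \<langle>a\<rangle>" using T' by simp
  qed
qed

theorem proposition8p1:
  shows "BISH_proves
    (all_of (RealT \<rightarrow> RealT) (\<lambda>f.
       positive_valued f \<^bold>\<and> quasi_convex f \<^bold>\<and> inf_exists_on_subintervals f \<^bold>\<longrightarrow>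
         ((\<^bold>\<exists>\<^sub>R m. is_inf f unit_interval m \<^bold>\<and> \<^bold>0 \<^bold>< m) \<^bold>\<or> is_inf f unit_interval \<^bold>0) \<^bold>\<and>
         (is_inf f unit_interval \<^bold>0 \<^bold>\<longrightarrow> has_discontinuity f \<^bold>\<and> WLPO)))"
  unfolding BISH_proves_def
proof (rule completeness)
  fix T assume T: "world T"
  have "T \<tturnstile> all_of (RealT \<rightarrow> RealT) (\<lambda>f.
       positive_valued f \<^bold>\<and> quasi_convex f \<^bold>\<and> inf_exists_on_subintervals f \<^bold>\<longrightarrow>
         ((\<^bold>\<exists>\<^sub>R m. is_inf f unit_interval m \<^bold>\<and> \<^bold>0 \<^bold>< m) \<^bold>\<or> is_inf f unit_interval \<^bold>0) \<^bold>\<and>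
         (is_inf f unit_interval \<^bold>0 \<^bold>\<longrightarrow> has_discontinuity f \<^bold>\<and> WLPO))"
  proof (rule world_all_impI[OF T holds_verum[OF T]])
    show "par (\<lambda>f. positive_valued f \<^bold>\<and> quasi_convex f \<^bold>\<and> inf_exists_on_subintervals f)"
      by (simp add: positive_valued_def quasi_convex_def inf_exists_on_subintervals_def inf_exists_if_inhabited_def
          interval_def is_inf_def)
    show "par (\<lambda>f. ((\<^bold>\<exists>\<^sub>R m. is_inf f unit_interval m \<^bold>\<and> \<^bold>0 \<^bold>< m) \<^bold>\<or> is_inf f unit_interval \<^bold>0) \<^bold>\<and>
         (is_inf f unit_interval \<^bold>0 \<^bold>\<longrightarrow> has_discontinuity f \<^bold>\<and> WLPO))"
      by (simp add: has_discontinuity_def WLPO_def)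
    fix T' f assume T': "world T'" and ty: "is_fun f"
      and hyp: "T' \<tturnstile> positive_valued \<langle>f\<rangle> \<^bold>\<and> quasi_convex \<langle>f\<rangle> \<^bold>\<and> inf_exists_on_subintervals \<langle>f\<rangle>"
    have f: "T' \<tturnstile> pos_qc \<langle>f\<rangle>" and infs: "T' \<tturnstile> inf_exists_on_subintervals \<langle>f\<rangle>"
      using hyp T' by (simp_all add: pos_qc_def)
    \<comment> \<open>With the end points 0 and 1 included, the interval unfolds to
      \<open>unit_interval\<close>, so the hypothesis yields the infimum of \<open>f\<close>
      itself.\<close>
    have unit: "is_inf \<langle>f\<rangle> (interval (\<^bold>\<le>) (\<^bold>\<le>) \<langle>Con CRZero\<rangle> \<langle>Con CROne\<rangle>) = is_inf \<langle>f\<rangle> unit_interval"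
      by (simp add: fun_eq_iff is_inf_def interval_def unit_interval_def cst_con)
    have zero: "T' \<tturnstile> unit_interval \<langle>Con CRZero\<rangle>"
      by (rule unit_intervalI[OF T' holds_verum[OF T']]) (simp_all add: ev le_refl lt_imp_le lt_zero_one)
    have refl: "T' \<tturnstile> \<langle>s\<rangle> \<^bold>\<le> \<langle>s\<rangle>" if "is_real s" for s
      by (rule holds_leI[OF T' holds_verum[OF T']]) (use that le_refl in simp_all)
    have "T' \<tturnstile> inf_exists_if_inhabited \<langle>f\<rangle> (interval (\<^bold>\<le>) (\<^bold>\<le>) \<langle>Con CRZero\<rangle> \<langle>Con CROne\<rangle>) \<^bold>\<and>
        inf_exists_if_inhabited \<langle>f\<rangle> (interval (\<^bold>\<le>) (\<^bold><) \<langle>Con CRZero\<rangle> \<langle>Con CROne\<rangle>) \<^bold>\<and>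
        inf_exists_if_inhabited \<langle>f\<rangle> (interval (\<^bold><) (\<^bold>\<le>) \<langle>Con CRZero\<rangle> \<langle>Con CROne\<rangle>) \<^bold>\<and>
        inf_exists_if_inhabited \<langle>f\<rangle> (interval (\<^bold><) (\<^bold><) \<langle>Con CRZero\<rangle> \<langle>Con CROne\<rangle>)"
      by (rule world_all2_impD[OF T' infs[unfolded inf_exists_on_subintervals_def]])
        (use T' ty refl in \<open>simp_all add: inf_exists_if_inhabited_def interval_def is_inf_def cst_con\<close>)
    then have "T' \<tturnstile> (\<^bold>\<exists>\<^sub>R x. interval (\<^bold>\<le>) (\<^bold>\<le>) \<langle>Con CRZero\<rangle> \<langle>Con CROne\<rangle> x) \<^bold>\<longrightarrow>
        (\<^bold>\<exists>\<^sub>R m. is_inf \<langle>f\<rangle> unit_interval m)"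
      using T' unit by (simp add: inf_exists_if_inhabited_def)
    moreover have "T' \<tturnstile> \<^bold>\<exists>\<^sub>R x. interval (\<^bold>\<le>) (\<^bold>\<le>) \<langle>Con CRZero\<rangle> \<langle>Con CROne\<rangle> x"
      by (rule world_exI[OF T', of _ "Con CRZero"]) (use zero in \<open>simp_all add: interval_def unit_interval_def cst_con\<close>)
    ultimately have "T' \<tturnstile> \<^bold>\<exists>\<^sub>R m. is_inf \<langle>f\<rangle> unit_interval m" by (rule world_mp[OF T'])
    then obtain m where m: "is_real m" "T' \<tturnstile> is_inf \<langle>f\<rangle> unit_interval \<langle>m\<rangle>"
      by (rule world_exE[OF T']) (use ty in simp_all)
    have "(T' \<tturnstile> \<^bold>\<exists>\<^sub>R m. is_inf \<langle>f\<rangle> unit_interval m \<^bold>\<and> \<^bold>0 \<^bold>< m) \<or> (T' \<tturnstile> is_inf \<langle>f\<rangle> unit_interval \<^bold>0)"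
      using is_inf_dichotomy[OF T' f m(2) ty m(1)]
    proof
      assume "lt T' 0 (rv m)"
      then have "T' \<tturnstile> is_inf \<langle>f\<rangle> unit_interval \<langle>m\<rangle> \<^bold>\<and> \<^bold>0 \<^bold>< \<langle>m\<rangle>" using T' m by (simp add: ev)
      then have "T' \<tturnstile> \<^bold>\<exists>\<^sub>R m. is_inf \<langle>f\<rangle> unit_interval m \<^bold>\<and> \<^bold>0 \<^bold>< m"
        by (rule world_exI[OF T' _ m(1)]) (use ty in simp)
      then show ?thesis ..
    qed simp
    moreover have "T' \<tturnstile> is_inf \<langle>f\<rangle> unit_interval \<^bold>0 \<^bold>\<longrightarrow> has_discontinuity \<langle>f\<rangle> \<^bold>\<and> WLPO"
      by (rule world_impI[OF T' f]) (use zero_inf_discontinuity zero_inf_WLPO ty in simp)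
    ultimately show "T' \<tturnstile> ((\<^bold>\<exists>\<^sub>R m. is_inf \<langle>f\<rangle> unit_interval m \<^bold>\<and> \<^bold>0 \<^bold>< m) \<^bold>\<or> is_inf \<langle>f\<rangle> unit_interval \<^bold>0) \<^bold>\<and>
         (is_inf \<langle>f\<rangle> unit_interval \<^bold>0 \<^bold>\<longrightarrow> has_discontinuity \<langle>f\<rangle> \<^bold>\<and> WLPO)"
      using T' by simp
  qed
  then show "all_of (RealT \<rightarrow> RealT) (\<lambda>f.
       positive_valued f \<^bold>\<and> quasi_convex f \<^bold>\<and> inf_exists_on_subintervals f \<^bold>\<longrightarrow>
         ((\<^bold>\<exists>\<^sub>R m. is_inf f unit_interval m \<^bold>\<and> \<^bold>0 \<^bold>< m) \<^bold>\<or> is_inf f unit_interval \<^bold>0) \<^bold>\<and>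
         (is_inf f unit_interval \<^bold>0 \<^bold>\<longrightarrow> has_discontinuity f \<^bold>\<and> WLPO)) 0 \<in> T"
    by (simp only: holds_def)
qed

end
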